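(* Let $A$ be an augmented dg $K$-algebra, $M$ a dg $A$-bimodule with $M_{-2}=0$, and $\alpha,\alpha'\in C^\bullet(A,M)_{-2}=\mathrm{Hom}_{K^e}(BA,M)_{-2}$ two Hochschild cochains of degree $-2$. Then $\mathbb{T}(A,M,\alpha)$ (that is, the graded $K$-bimodule $A\oplus M$ with the coderivation $d$ determined by $\alpha$ as described in the context) is an augmented $A_\infty$-algebra if and only if $\alpha$ is a Hochschild 2-cocycle. Moreover, if $\alpha,\alpha'$ are Hochschild 2-cocycles with $[\alpha]=[\alpha']\in H^2(A,M)$, then $\mathbb{T}(A,M,\alpha)\cong \mathbb{T}(A,M,\alpha')$ as augmented $A_\infty$-algebras.
   Context: Conventions. $k$ is a field, $K=k^t$ for a positive integer $t$, $\otimes=\otimes_K$, $K^e$-modules are $K$-bimodules. Gradings are homological (differentials have degree $-1$); an element of lower degree $i$ has upper degree $-i$. $s=[1]$ is suspension, $(sV)_i=V_{i-1}$, and the Koszul sign rule is used. An augmented dg $K$-algebra is a complex of $K$-bimodules $A$ with associative unital product $A\otimes A\to A$, unit $\eta_A:K\to A$, augmentation $\varepsilon_A:A\to K$ (all morphisms of complexes of $K$-bimodules) with $\varepsilon_A\eta_A=\mathrm{id}_K$; $\overline{A}=\mathrm{Ker}\,\varepsilon_A$, $A=K\oplus\overline A$. Bar construction: $BA=T(s\overline A)=\bigoplus_{n\ge0}(s\overline A)^{\otimes n}$, the tensor coalgebra (deconcatenation), $[a_1|\cdots|a_n]=sa_1\otimes\cdots\otimes sa_n$, with differential $d_{BA}$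 the coderivation determined by $[a]\mapsto -[d_Aa]$ and $[a|b]\mapsto(-1)^{|a|}[ab]$. Hochschild cochain complex: $C^\bullet(A,M)=\mathrm{Hom}_{K^e}(BA,M)$ with differential $\delta=\delta_0+\delta_1$, where for $f\in \mathrm{Hom}_{K^e}((s\overline A)^{\otimes n},M)$ and $\varepsilon_i=\sum_{j=1}^i(|a_j|+1)$, $\delta_0(f)[a_1|\cdots|a_n]=d_Mf[a_1|\cdots|a_n]+\sum_{i=1}^n(-1)^{\varepsilon_{i-1}+|f|}f[a_1|\cdots|d_Aa_i|\cdots|a_n]$ and $\delta_1(f)[a_1|\cdots|a_{n+1}]=(-1)^{|f|(|a_1|+1)}a_1f[a_2|\cdots|a_{n+1}]+\sum_{i=1}^n(-1)^{|f|+\varepsilon_i}f[a_1|\cdots|a_ia_{i+1}|\cdots|a_{n+1}]+(-1)^{|f|+\varepsilon_n+1}f[a_1|\cdots|a_n]a_{n+1}$. $H^\bullet(A,M)$ is its cohomology; a Hochschild 2-cocycle is a cocycle of (lower) degree $-2$ (the upper index 2 is degree, not weight). An augmented $A_\infty$-algebra is a graded $K$-bimodule $X$ with degree-zero $K$-bimodule maps $\eta:K\to X$, $\varepsilon:X\to K$, $\varepsilon\eta=\mathrm{id}_K$, and, with $\overline X=\mathrm{Ker}\,\varepsilon$, a degree $-1$ $K$-coderivation $d$ of the coaugmented tensor coalgebra $T(s\overline X)$ which vanishes on the coaugmentation and satisfies $d^2=0$; $BX=(T(s\overline X),d)$. A morphism $X\to X'$ of augmented $A_\infty$-algebras is a morphism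 of coaugmented dg $K$-coalgebras $BX\to BX'$; an isomorphism is an invertible one. Hochschild extension $\mathbb{T}(A,M,\alpha)$: the graded $K$-bimodule $A\oplus M$ with unit $K\to A\hookrightarrow A\oplus M$ and augmentation $A\oplus M\twoheadrightarrow A\to K$, and with the degree $-1$ coderivation $d$ of $T(s\overline A\oplus sM)=BA\oplus(BA\otimes sM\otimes BA)\oplus(BA\otimes sM\otimes BA\otimes sM\otimes BA)\oplus\cdots$ uniquely determined by its composite $\bar d$ with the projection to $s\overline A\oplus sM$, where: on $BA$, $\bar d=(p_{s\overline A}\circ d_{BA},\,-s\circ\alpha)$; on $BA\otimes sM\otimes BA$, $\bar d$ is $p_{sM}\circ d_{BA\otimes sM\otimes BA}$, i.e. $sm\mapsto -s\,d_Mm$, $[a]\otimes sm\mapsto(-1)^{|a|}s(am)$, $sm\otimes[a]\mapsto(-1)^{|m|}s(ma)$ and zero on components with more bar entries; and $\bar d=0$ on summands with at least two factors $sM$. Here $p_{s\overline A}:BA\to s\overline A$ and $p_{sM}:BA\otimes sM\otimes BA\to sM$ are the projections.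
   Formalization: The isomorphism claim, false as stated, is proved under the extra condition that M_{-1}=0 or that α−α'=δ(β) for some cochain β of degree −1 vanishing on the weight-zero part K of BA; the augmentation of A is taken to be multiplicative. *)

theory Defs
  imports "HOL-Analysis.Finite_Cartesian_Product" "HOL-Library.Poly_Mapping"
    "HOL-Library.FuncSet" "HOL-Library.Product_Plus"
begin

text \<open>
  The base ring \<open>K = k\<^sup>t\<close> is the type \<open>'k ^ 't\<close> with its componentwise ring structure;
  \<open>vec c\<close> is the image of \<open>c \<in> k\<close> in \<open>K\<close>. Gradings are homological.
\<close>

section \<open>Graded bimodules over K\<close>

text \<open>
  A graded bimodule is the internal direct sum \<open>gcar V\<close> of the subgroups \<open>gcomp V i\<close> of an
  ambient abelian group. The last axiom of \<open>graded_bimodule\<close> says that \<open>k\<close> acts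
  centrally, so that bimodules are modules over the enveloping algebra of the \<open>k\<close>-algebra \<open>K\<close>.
\<close>

record ('k, 't, 'v) gbimod =
  gcomp :: "int \<Rightarrow> 'v set"
  lact :: "'k ^ 't \<Rightarrow> 'v \<Rightarrow> 'v"
  ract :: "'v \<Rightarrow> 'k ^ 't \<Rightarrow> 'v"

definition gcar :: "('k, 't::finite, 'v::ab_group_add, 'z) gbimod_scheme \<Rightarrow> 'v set" where
  "gcar V = {\<Sum>i\<in>I. x i | I x. finite I \<and> (\<forall>i\<in>I. x i \<in> gcomp V i)}"

locale graded_bimodule =
  fixes V :: "('k::field, 't::finite, 'v::ab_group_add, 'z) gbimod_scheme"
  assumes comp_zero: "0 \<in> gcomp V i"
    and comp_add: "\<lbrakk>x \<in> gcomp V i; y \<in> gcomp V i\<rbrakk> \<Longrightarrow> x + y \<in> gcomp V i"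
    and comp_uminus: "x \<in> gcomp V i \<Longrightarrow> - x \<in> gcomp V i"
    and comp_lact: "x \<in> gcomp V i \<Longrightarrow> lact V c x \<in> gcomp V i"
    and comp_ract: "x \<in> gcomp V i \<Longrightarrow> ract V x c \<in> gcomp V i"
    and comp_direct: "\<lbrakk>finite I; \<And>i. i \<in> I \<Longrightarrow> z i \<in> gcomp V i; (\<Sum>i\<in>I. z i) = 0; i \<in> I\<rbrakk> \<Longrightarrow> z i = 0"
    and lact_add_right: "\<lbrakk>x \<in> gcar V; y \<in> gcar V\<rbrakk> \<Longrightarrow> lact V c (x + y) = lact V c x + lact V c y"
    and ract_add_left: "\<lbrakk>x \<in> gcar V; y \<in> gcar V\<rbrakk> \<Longrightarrow> ract V (x + y) c = ract V x c + ract V y c"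
    and lact_add_left: "x \<in> gcar V \<Longrightarrow> lact V (c + c') x = lact V c x + lact V c' x"
    and ract_add_right: "x \<in> gcar V \<Longrightarrow> ract V x (c + c') = ract V x c + ract V x c'"
    and lact_mult: "x \<in> gcar V \<Longrightarrow> lact V (c * c') x = lact V c (lact V c' x)"
    and ract_mult: "x \<in> gcar V \<Longrightarrow> ract V x (c * c') = ract V (ract V x c) c'"
    and lact_one: "x \<in> gcar V \<Longrightarrow> lact V 1 x = x"
    and ract_one: "x \<in> gcar V \<Longrightarrow> ract V x 1 = x"
    and lact_ract: "x \<in> gcar V \<Longrightarrow> ract V (lact V c x) c' = lact V c (ract V x c')"
    and central: "x \<in> gcar V \<Longrightarrow> lact V (vec r) x = ract V x (vec r)"

definition bimod_hom :: "('k, 't::finite, 'v::ab_group_add, 'z) gbimod_scheme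
    \<Rightarrow> ('k, 't, 'w::ab_group_add, 'y) gbimod_scheme \<Rightarrow> int \<Rightarrow> ('v \<Rightarrow> 'w) \<Rightarrow> bool" where
  "bimod_hom V W p f \<longleftrightarrow>
     (\<forall>x\<in>gcar V. \<forall>y\<in>gcar V. f (x + y) = f x + f y) \<and>
     (\<forall>x\<in>gcar V. \<forall>c. f (lact V c x) = lact W c (f x) \<and> f (ract V x c) = ract W (f x) c) \<and>
     (\<forall>i. \<forall>x\<in>gcomp V i. f x \<in> gcomp W (i + p))"

definition base_bimod :: "('k::field, 't::finite, 'k ^ 't) gbimod" where
  "base_bimod = \<lparr>gcomp = (\<lambda>i. if i = 0 then UNIV else {0}), lact = (*), ract = (*)\<rparr>"

definition susp :: "('k, 't::finite, 'v, 'z) gbimod_scheme \<Rightarrow> ('k, 't, 'v) gbimod" where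
  "susp V = \<lparr>gcomp = (\<lambda>i. gcomp V (i - 1)), lact = lact V, ract = ract V\<rparr>"

definition kernel_bimod :: "('k, 't::finite, 'v, 'z) gbimod_scheme \<Rightarrow> ('v \<Rightarrow> 'w::zero)
    \<Rightarrow> ('k, 't, 'v) gbimod" where
  "kernel_bimod V f = \<lparr>gcomp = (\<lambda>i. {x \<in> gcomp V i. f x = 0}), lact = lact V, ract = ract V\<rparr>"

definition ksgn :: "int \<Rightarrow> 'v::ab_group_add \<Rightarrow> 'v" where
  "ksgn n x = (if even n then x else - x)"

definition hcomps :: "('k, 't::finite, 'v::ab_group_add, 'z) gbimod_scheme \<Rightarrow> 'v \<Rightarrow> int \<Rightarrow> 'v" where
  "hcomps V x = (THE c. finite {i. c i \<noteq> 0} \<and> (\<forall>i. c i \<in> gcomp V i) \<and> x = (\<Sum>i | c i \<noteq> 0. c i))"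

text \<open>The additive extension of \<open>x \<mapsto> (-1)\<^bsup>q|x|\<^esup> x\<close> from homogeneous elements.\<close>

definition koszul :: "('k, 't::finite, 'v::ab_group_add, 'z) gbimod_scheme \<Rightarrow> int \<Rightarrow> 'v \<Rightarrow> 'v" where
  "koszul V q x = (\<Sum>i | hcomps V x i \<noteq> 0. ksgn (q * i) (hcomps V x i))"


section \<open>Quotients of free vector spaces\<close>

definition fscale :: "'k::field \<Rightarrow> ('x \<Rightarrow>\<^sub>0 'k) \<Rightarrow> ('x \<Rightarrow>\<^sub>0 'k)" where
  "fscale c p = Poly_Mapping.map ((*) c) p"

lemma lookup_fscale: "Poly_Mapping.lookup (fscale c p) x = c * Poly_Mapping.lookup p x"
  by (simp add: fscale_def map.rep_eq when_def)

lemma vector_space_fscale: "vector_space (fscale :: 'k::field \<Rightarrow> ('x \<Rightarrow>\<^sub>0 'k) \<Rightarrow> _)"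
  by unfold_locales (auto intro!: poly_mapping_eqI simp: lookup_fscale lookup_add algebra_simps)

abbreviation fspan :: "('x \<Rightarrow>\<^sub>0 'k::field) set \<Rightarrow> ('x \<Rightarrow>\<^sub>0 'k) set" where
  "fspan \<equiv> module.span fscale"

definition is_quot_proj :: "('x \<Rightarrow>\<^sub>0 'k::field) set \<Rightarrow> (('x \<Rightarrow>\<^sub>0 'k) \<Rightarrow> ('x \<Rightarrow>\<^sub>0 'k)) \<Rightarrow> bool" where
  "is_quot_proj R \<rho> \<longleftrightarrow>
     (\<forall>x y. \<rho> (x + y) = \<rho> x + \<rho> y) \<and> (\<forall>c x. \<rho> (fscale c x) = fscale c (\<rho> x)) \<and>
     (\<forall>x. \<rho> (\<rho> x) = \<rho> x) \<and> (\<forall>x. \<rho> x = 0 \<longleftrightarrow> x \<in> fspan R)"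

text \<open>
  The quotient of a free vector space by the span of \<open>R\<close> is modelled by the image of a linear
  projection with kernel \<open>fspan R\<close>. Thus \<open>quot_proj R x\<close> is the class of \<open>x\<close>, and the vector
  space operations on classes are those of the ambient type. A linear map on the free space that
  kills \<open>R\<close> induces a map on the quotient simply by restriction.
\<close>

definition quot_proj :: "('x \<Rightarrow>\<^sub>0 'k::field) set \<Rightarrow> ('x \<Rightarrow>\<^sub>0 'k) \<Rightarrow> ('x \<Rightarrow>\<^sub>0 'k)" where
  "quot_proj R = (SOME \<rho>. is_quot_proj R \<rho>)"

lemma is_quot_proj_quot_proj: "is_quot_proj R (quot_proj R)"
proof -
  interpret V: vector_space "fscale :: 'b \<Rightarrow> ('a \<Rightarrow>\<^sub>0 'b) \<Rightarrow> _" by (rule vector_space_fscale)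
  interpret P: vector_space_pair "fscale :: 'b \<Rightarrow> ('a \<Rightarrow>\<^sub>0 'b) \<Rightarrow> _" "fscale :: 'b \<Rightarrow> ('a \<Rightarrow>\<^sub>0 'b) \<Rightarrow> _" ..
  obtain g where g: "range g \<subseteq> V.span R" "Vector_Spaces.linear fscale fscale g" "\<forall>v\<in>V.span R. g (id v) = v"
    using P.linear_exists_left_inverse_on[OF V.linear_id V.subspace_span[of R]] by (auto simp: inj_on_def)
  interpret g: Vector_Spaces.linear fscale fscale g by (rule g(2))
  have gg: "g (g x) = g x" for x using g(1,3) by (auto simp: image_subset_iff)
  have "is_quot_proj R (\<lambda>x. x - g x)"
    unfolding is_quot_proj_def
  proof (intro conjI allI)
    fix x
    show "x - g x = 0 \<longleftrightarrow> x \<in> V.span R"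
      using g(1,3) by (metis id_apply eq_iff_diff_eq_0 range_subsetD)
  qed (auto simp: g.add g.scale g.diff gg V.scale_right_diff_distrib)
  then show ?thesis unfolding quot_proj_def by (rule someI[of "is_quot_proj R"])
qed

lemma quot_proj_eq_iff: "quot_proj R x = quot_proj R y \<longleftrightarrow> x - y \<in> fspan R"
proof -
  have q: "\<And>x y. quot_proj R (x + y) = quot_proj R x + quot_proj R y"
    "\<And>x. quot_proj R x = 0 \<longleftrightarrow> x \<in> fspan R"
    using is_quot_proj_quot_proj[of R] by (auto simp: is_quot_proj_def)
  have "quot_proj R x = quot_proj R (x - y) + quot_proj R y"
    using q(1)[of "x - y" y] by simp
  then show ?thesis using q(2)[of "x - y"] by auto
qed

text \<open>Here \<open>sc\<close> is the scalar multiplication of the target.\<close>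

definition linext :: "('k::field \<Rightarrow> 'b \<Rightarrow> 'b) \<Rightarrow> ('x \<Rightarrow> 'b::ab_group_add) \<Rightarrow> ('x \<Rightarrow>\<^sub>0 'k) \<Rightarrow> 'b" where
  "linext sc \<phi> p = (\<Sum>x\<in>Poly_Mapping.keys p. sc (Poly_Mapping.lookup p x) (\<phi> x))"


section \<open>Tensor product over K\<close>

definition tensor_rels :: "('k::field, 't::finite, 'v::ab_group_add, 'z) gbimod_scheme
    \<Rightarrow> ('k, 't, 'w::ab_group_add, 'y) gbimod_scheme \<Rightarrow> (('v \<times> 'w) \<Rightarrow>\<^sub>0 'k) set" where
  "tensor_rels V W = (let e = (\<lambda>x y. Poly_Mapping.single (x, y) (1::'k)) in
     {e (x + x') y - e x y - e x' y | x x' y. x \<in> gcar V \<and> x' \<in> gcar V \<and> y \<in> gcar W} \<union>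
     {e x (y + y') - e x y - e x y' | x y y'. x \<in> gcar V \<and> y \<in> gcar W \<and> y' \<in> gcar W} \<union>
     {e (lact V (vec r) x) y - fscale r (e x y) | r x y. x \<in> gcar V \<and> y \<in> gcar W} \<union>
     {e (ract V x c) y - e x (lact W c y) | c x y. x \<in> gcar V \<and> y \<in> gcar W})"

definition pure_tensor :: "('k::field, 't::finite, 'v::ab_group_add, 'z) gbimod_scheme
    \<Rightarrow> ('k, 't, 'w::ab_group_add, 'y) gbimod_scheme \<Rightarrow> 'v \<Rightarrow> 'w \<Rightarrow> (('v \<times> 'w) \<Rightarrow>\<^sub>0 'k)" where
  "pure_tensor V W x y = quot_proj (tensor_rels V W) (Poly_Mapping.single (x, y) 1)"

text \<open>
  For \<open>g\<close> homogeneous of degree \<open>q\<close>, this is the map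
  \<open>x \<otimes> y \<mapsto> (-1)\<^bsup>q|x|\<^esup> f x \<otimes> g y\<close> from \<open>V \<otimes> W\<close> to \<open>V' \<otimes> W'\<close>.
\<close>

definition tensor_map :: "('k::field, 't::finite, 'v::ab_group_add, 'z) gbimod_scheme
    \<Rightarrow> ('k, 't, 'v'::ab_group_add, 'z') gbimod_scheme \<Rightarrow> ('k, 't, 'w'::ab_group_add, 'y') gbimod_scheme
    \<Rightarrow> int \<Rightarrow> ('v \<Rightarrow> 'v') \<Rightarrow> ('w \<Rightarrow> 'w') \<Rightarrow> (('v \<times> 'w) \<Rightarrow>\<^sub>0 'k) \<Rightarrow> (('v' \<times> 'w') \<Rightarrow>\<^sub>0 'k)" where
  "tensor_map V V' W' q f g =
     linext fscale (\<lambda>(x, y). pure_tensor V' W' (f (koszul V q x)) (g y))"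


section \<open>Coaugmented graded and dg coalgebras\<close>

record (overloaded) ('k, 't, 'c) coaug_coalg = "('k::zero, 't::finite, 'c) gbimod" +
  comult :: "'c \<Rightarrow> (('c \<times> 'c) \<Rightarrow>\<^sub>0 'k)"
  counit :: "'c \<Rightarrow> 'k ^ 't"
  coaug :: "'k ^ 't \<Rightarrow> 'c"

record (overloaded) ('k, 't, 'c) dg_coalg = "('k::zero, 't::finite, 'c) coaug_coalg" +
  codiff :: "'c \<Rightarrow> 'c"

definition coderivation :: "('k::field, 't::finite, 'c::ab_group_add, 'z) coaug_coalg_scheme
    \<Rightarrow> int \<Rightarrow> ('c \<Rightarrow> 'c) \<Rightarrow> bool" where
  "coderivation C p D \<longleftrightarrow> bimod_hom C C p D \<and>
     (\<forall>x\<in>gcar C. comult C (D x) =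
        tensor_map C C C 0 D id (comult C x) + tensor_map C C C p id D (comult C x))"

definition dg_coalg_hom :: "('k::field, 't::finite, 'c::ab_group_add, 'z) dg_coalg_scheme
    \<Rightarrow> ('k, 't, 'c'::ab_group_add, 'y) dg_coalg_scheme \<Rightarrow> ('c \<Rightarrow> 'c') \<Rightarrow> bool" where
  "dg_coalg_hom C C' F \<longleftrightarrow> bimod_hom C C' 0 F \<and>
     (\<forall>x\<in>gcar C. comult C' (F x) = tensor_map C C' C' 0 F F (comult C x)) \<and>
     (\<forall>x\<in>gcar C. counit C' (F x) = counit C x) \<and>
     (\<forall>c. F (coaug C c) = coaug C' c) \<and>
     (\<forall>x\<in>gcar C. F (codiff C x) = codiff C' (F x))"

definition dg_coalg_iso :: "('k::field, 't::finite, 'c::ab_group_add, 'z) dg_coalg_scheme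
    \<Rightarrow> ('k, 't, 'c'::ab_group_add, 'y) dg_coalg_scheme \<Rightarrow> bool" where
  "dg_coalg_iso C C' \<longleftrightarrow> (\<exists>F G. dg_coalg_hom C C' F \<and> dg_coalg_hom C' C G \<and>
     (\<forall>x\<in>gcar C. G (F x) = x) \<and> (\<forall>y\<in>gcar C'. F (G y) = y))"


section \<open>The tensor coalgebra\<close>

text \<open>
  \<open>T(V)\<close> is spanned by classes of pairs \<open>(c, [v\<^sub>1, \<dots>, v\<^sub>n])\<close> standing for the element
  \<open>c \<otimes> v\<^sub>1 \<otimes> \<cdots> \<otimes> v\<^sub>n\<close> of \<open>K \<otimes> V\<^sup>\<otimes>\<^sup>n\<close>, which is canonically \<open>V\<^sup>\<otimes>\<^sup>n\<close>. The coefficient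
  \<open>c\<close> makes the case \<open>n = 0\<close>, where \<open>V\<^sup>\<otimes>\<^sup>0 = K\<close>, uniform with the others.
\<close>

type_synonym ('k, 't, 'v) words = "(('k ^ 't) \<times> 'v list) \<Rightarrow>\<^sub>0 'k"

definition word_rels :: "('k::field, 't::finite, 'v::ab_group_add, 'z) gbimod_scheme
    \<Rightarrow> ('k, 't, 'v) words set" where
  "word_rels V = (let e = (\<lambda>c w. Poly_Mapping.single (c, w) (1::'k)); L = lists (gcar V) in
     {e (c + c') w - e c w - e c' w | c c' w. w \<in> L} \<union>
     {e (vec r * c) w - fscale r (e c w) | r c w. w \<in> L} \<union>
     {e c (u @ (x + y) # v) - e c (u @ x # v) - e c (u @ y # v) | c u x y v.
        u \<in> L \<and> v \<in> L \<and> x \<in> gcar V \<and> y \<in> gcar V} \<union>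
     {e (c * c') (x # v) - e c (lact V c' x # v) | c c' x v. v \<in> L \<and> x \<in> gcar V} \<union>
     {e c (u @ ract V x c' # y # v) - e c (u @ x # lact V c' y # v) | c c' u x y v.
        u \<in> L \<and> v \<in> L \<and> x \<in> gcar V \<and> y \<in> gcar V})"

definition tword :: "('k::field, 't::finite, 'v::ab_group_add, 'z) gbimod_scheme
    \<Rightarrow> 'k ^ 't \<Rightarrow> 'v list \<Rightarrow> ('k, 't, 'v) words" where
  "tword V c w = quot_proj (word_rels V) (Poly_Mapping.single (c, w) 1)"

definition hwords :: "('k, 't::finite, 'v, 'z) gbimod_scheme \<Rightarrow> (int \<times> 'v) list set" where
  "hwords V = {w. \<forall>(i, x)\<in>set w. x \<in> gcomp V i}"

definition tensor_bimod :: "('k::field, 't::finite, 'v::ab_group_add, 'z) gbimod_scheme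
    \<Rightarrow> ('k, 't, ('k, 't, 'v) words) gbimod" where
  "tensor_bimod V = \<lparr>
     gcomp = (\<lambda>n. fspan {tword V c (map snd w) | c w. w \<in> hwords V \<and> sum_list (map fst w) = n}),
     lact = (\<lambda>c'. linext fscale (\<lambda>(c, w). tword V (c' * c) w)),
     ract = (\<lambda>p c'. linext fscale (\<lambda>(c, w). if w = [] then tword V (c * c') []
                 else tword V c (butlast w @ [ract V (last w) c'])) p)\<rparr>"

definition tensor_coalg :: "('k::field, 't::finite, 'v::ab_group_add, 'z) gbimod_scheme
    \<Rightarrow> ('k, 't, ('k, 't, 'v) words) coaug_coalg" where
  "tensor_coalg V = gbimod.extend (tensor_bimod V) \<lparr>
     comult = linext fscale (\<lambda>(c, w). \<Sum>i\<le>length w.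
        pure_tensor (tensor_bimod V) (tensor_bimod V) (tword V c (take i w)) (tword V 1 (drop i w))),
     counit = linext (\<lambda>r c. vec r * c) (\<lambda>(c, w). if w = [] then c else 0),
     coaug = (\<lambda>c. tword V c [])\<rparr>"

definition tproj :: "('k::field, 't::finite, 'v::ab_group_add, 'z) gbimod_scheme
    \<Rightarrow> ('k, 't, 'v) words \<Rightarrow> 'v" where
  "tproj V = linext (\<lambda>r. lact V (vec r)) (\<lambda>(c, w). case w of [x] \<Rightarrow> lact V c x | _ \<Rightarrow> 0)"


section \<open>Augmented A-infinity algebras\<close>

record (overloaded) ('k, 't, 'x) ainf = "('k::zero, 't::finite, 'x) gbimod" +
  aunit :: "'k ^ 't \<Rightarrow> 'x"
  aaug :: "'x \<Rightarrow> 'k ^ 't"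
  acod :: "('k, 't, 'x) words \<Rightarrow> ('k, 't, 'x) words"

abbreviation ainf_sbar :: "('k::field, 't::finite, 'x::ab_group_add) ainf \<Rightarrow> ('k, 't, 'x) gbimod" where
  "ainf_sbar X \<equiv> susp (kernel_bimod X (aaug X))"

locale aug_ainf_algebra = graded_bimodule X
  for X :: "('k::field, 't::finite, 'x::ab_group_add) ainf" +
  assumes unit_hom: "bimod_hom base_bimod X 0 (aunit X)"
    and aug_hom: "bimod_hom X base_bimod 0 (aaug X)"
    and aug_unit: "aaug X (aunit X c) = c"
    and cod_coderivation: "coderivation (tensor_coalg (ainf_sbar X)) (-1) (acod X)"
    and cod_coaug: "acod X (coaug (tensor_coalg (ainf_sbar X)) c) = 0"
    and cod_square: "x \<in> gcar (tensor_coalg (ainf_sbar X)) \<Longrightarrow> acod X (acod X x) = 0"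

definition ainf_bar :: "('k::field, 't::finite, 'x::ab_group_add) ainf
    \<Rightarrow> ('k, 't, ('k, 't, 'x) words) dg_coalg" where
  "ainf_bar X = coaug_coalg.extend (tensor_coalg (ainf_sbar X)) \<lparr>codiff = acod X\<rparr>"

definition ainf_iso :: "('k::field, 't::finite, 'x::ab_group_add) ainf
    \<Rightarrow> ('k, 't, 'y::ab_group_add) ainf \<Rightarrow> bool" where
  "ainf_iso X Y \<longleftrightarrow> dg_coalg_iso (ainf_bar X) (ainf_bar Y)"


section \<open>Augmented dg algebras and dg bimodules\<close>

record ('k, 't, 'a) dga = "('k, 't::finite, 'a) gbimod" +
  mul :: "'a \<Rightarrow> 'a \<Rightarrow> 'a"
  unit :: "'k ^ 't \<Rightarrow> 'a"
  dif :: "'a \<Rightarrow> 'a"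
  aug :: "'a \<Rightarrow> 'k ^ 't"

text \<open>Morphisms out of a tensor product over \<open>K\<close> are given as \<open>K\<close>-balanced biadditive maps.\<close>

locale aug_dg_algebra = graded_bimodule A
  for A :: "('k::field, 't::finite, 'a::ab_group_add) dga" +
  assumes mul_comp: "\<lbrakk>x \<in> gcomp A i; y \<in> gcomp A j\<rbrakk> \<Longrightarrow> mul A x y \<in> gcomp A (i + j)"
    and mul_add_left: "\<lbrakk>x \<in> gcar A; x' \<in> gcar A; y \<in> gcar A\<rbrakk> \<Longrightarrow> mul A (x + x') y = mul A x y + mul A x' y"
    and mul_add_right: "\<lbrakk>x \<in> gcar A; y \<in> gcar A; y' \<in> gcar A\<rbrakk> \<Longrightarrow> mul A x (y + y') = mul A x y + mul A x y'"
    and mul_balanced: "\<lbrakk>x \<in> gcar A; y \<in> gcar A\<rbrakk> \<Longrightarrow> mul A (ract A x c) y = mul A x (lact A c y)"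
    and mul_lact: "\<lbrakk>x \<in> gcar A; y \<in> gcar A\<rbrakk> \<Longrightarrow> mul A (lact A c x) y = lact A c (mul A x y)"
    and mul_ract: "\<lbrakk>x \<in> gcar A; y \<in> gcar A\<rbrakk> \<Longrightarrow> mul A x (ract A y c) = ract A (mul A x y) c"
    and mul_assoc: "\<lbrakk>x \<in> gcar A; y \<in> gcar A; z \<in> gcar A\<rbrakk> \<Longrightarrow> mul A (mul A x y) z = mul A x (mul A y z)"
    and unit_hom: "bimod_hom base_bimod A 0 (unit A)"
    and mul_unit_left: "x \<in> gcar A \<Longrightarrow> mul A (unit A 1) x = x"
    and mul_unit_right: "x \<in> gcar A \<Longrightarrow> mul A x (unit A 1) = x"
    and dif_hom: "bimod_hom A A (-1) (dif A)"
    and dif_square: "x \<in> gcar A \<Longrightarrow> dif A (dif A x) = 0"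
    and dif_mul: "\<lbrakk>x \<in> gcomp A i; y \<in> gcar A\<rbrakk> \<Longrightarrow>
      dif A (mul A x y) = mul A (dif A x) y + ksgn i (mul A x (dif A y))"
    and dif_unit: "dif A (unit A c) = 0"
    and aug_hom: "bimod_hom A base_bimod 0 (aug A)"
    and aug_mul: "\<lbrakk>x \<in> gcar A; y \<in> gcar A\<rbrakk> \<Longrightarrow> aug A (mul A x y) = aug A x * aug A y"
    and aug_dif: "x \<in> gcar A \<Longrightarrow> aug A (dif A x) = 0"
    and aug_unit: "aug A (unit A c) = c"

record ('k, 't, 'a, 'm) dg_bimod = "('k, 't::finite, 'm) gbimod" +
  lmul :: "'a \<Rightarrow> 'm \<Rightarrow> 'm"
  rmul :: "'m \<Rightarrow> 'a \<Rightarrow> 'm"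
  mdif :: "'m \<Rightarrow> 'm"

locale dg_bimodule = A: aug_dg_algebra A + graded_bimodule M
  for A :: "('k::field, 't::finite, 'a::ab_group_add) dga"
    and M :: "('k, 't, 'a, 'm::ab_group_add) dg_bimod" +
  assumes lmul_comp: "\<lbrakk>a \<in> gcomp A i; m \<in> gcomp M j\<rbrakk> \<Longrightarrow> lmul M a m \<in> gcomp M (i + j)"
    and rmul_comp: "\<lbrakk>m \<in> gcomp M i; a \<in> gcomp A j\<rbrakk> \<Longrightarrow> rmul M m a \<in> gcomp M (i + j)"
    and lmul_add_left: "\<lbrakk>a \<in> gcar A; b \<in> gcar A; m \<in> gcar M\<rbrakk> \<Longrightarrow> lmul M (a + b) m = lmul M a m + lmul M b m"
    and lmul_add_right: "\<lbrakk>a \<in> gcar A; m \<in> gcar M; n \<in> gcar M\<rbrakk> \<Longrightarrow> lmul M a (m + n) = lmul M a m + lmul M a n"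
    and rmul_add_left: "\<lbrakk>m \<in> gcar M; n \<in> gcar M; a \<in> gcar A\<rbrakk> \<Longrightarrow> rmul M (m + n) a = rmul M m a + rmul M n a"
    and rmul_add_right: "\<lbrakk>m \<in> gcar M; a \<in> gcar A; b \<in> gcar A\<rbrakk> \<Longrightarrow> rmul M m (a + b) = rmul M m a + rmul M m b"
    and lmul_balanced: "\<lbrakk>a \<in> gcar A; m \<in> gcar M\<rbrakk> \<Longrightarrow> lmul M (ract A a c) m = lmul M a (lact M c m)"
    and lmul_lact: "\<lbrakk>a \<in> gcar A; m \<in> gcar M\<rbrakk> \<Longrightarrow> lmul M (lact A c a) m = lact M c (lmul M a m)"
    and lmul_ract: "\<lbrakk>a \<in> gcar A; m \<in> gcar M\<rbrakk> \<Longrightarrow> lmul M a (ract M m c) = ract M (lmul M a m) c"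
    and rmul_balanced: "\<lbrakk>m \<in> gcar M; a \<in> gcar A\<rbrakk> \<Longrightarrow> rmul M (ract M m c) a = rmul M m (lact A c a)"
    and rmul_lact: "\<lbrakk>m \<in> gcar M; a \<in> gcar A\<rbrakk> \<Longrightarrow> rmul M (lact M c m) a = lact M c (rmul M m a)"
    and rmul_ract: "\<lbrakk>m \<in> gcar M; a \<in> gcar A\<rbrakk> \<Longrightarrow> rmul M m (ract A a c) = ract M (rmul M m a) c"
    and lmul_assoc: "\<lbrakk>a \<in> gcar A; b \<in> gcar A; m \<in> gcar M\<rbrakk> \<Longrightarrow> lmul M (mul A a b) m = lmul M a (lmul M b m)"
    and rmul_assoc: "\<lbrakk>a \<in> gcar A; b \<in> gcar A; m \<in> gcar M\<rbrakk> \<Longrightarrow> rmul M m (mul A a b) = rmul M (rmul M m a) b"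
    and lmul_rmul: "\<lbrakk>a \<in> gcar A; b \<in> gcar A; m \<in> gcar M\<rbrakk> \<Longrightarrow> rmul M (lmul M a m) b = lmul M a (rmul M m b)"
    and lmul_unit: "m \<in> gcar M \<Longrightarrow> lmul M (unit A 1) m = m"
    and rmul_unit: "m \<in> gcar M \<Longrightarrow> rmul M m (unit A 1) = m"
    and mdif_hom: "bimod_hom M M (-1) (mdif M)"
    and mdif_square: "m \<in> gcar M \<Longrightarrow> mdif M (mdif M m) = 0"
    and mdif_lmul: "\<lbrakk>a \<in> gcomp A i; m \<in> gcar M\<rbrakk> \<Longrightarrow>
      mdif M (lmul M a m) = lmul M (dif A a) m + ksgn i (lmul M a (mdif M m))"
    and mdif_rmul: "\<lbrakk>m \<in> gcomp M i; a \<in> gcar A\<rbrakk> \<Longrightarrow>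
      mdif M (rmul M m a) = rmul M (mdif M m) a + ksgn i (rmul M m (dif A a))"


section \<open>Hochschild cochains\<close>

abbreviation aug_ideal :: "('k::field, 't::finite, 'a::ab_group_add) dga \<Rightarrow> ('k, 't, 'a) gbimod" where
  "aug_ideal A \<equiv> kernel_bimod A (aug A)"

text \<open>The element \<open>[a\<^sub>1|\<dots>|a\<^sub>n]\<close> of the bar construction.\<close>

abbreviation bar_word :: "('k::field, 't::finite, 'a::ab_group_add) dga \<Rightarrow> 'a list \<Rightarrow> ('k, 't, 'a) words" where
  "bar_word A as \<equiv> tword (susp (aug_ideal A)) 1 as"

definition hoch_cochain :: "('k::field, 't::finite, 'a::ab_group_add) dga
    \<Rightarrow> ('k, 't, 'a, 'm::ab_group_add) dg_bimod \<Rightarrow> int \<Rightarrow> (('k, 't, 'a) words \<Rightarrow> 'm) \<Rightarrow> bool" where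
  "hoch_cochain A M p f \<longleftrightarrow> bimod_hom (tensor_coalg (susp (aug_ideal A))) M p f"

text \<open>
  For a word \<open>w\<close> of homogeneous elements of the augmentation ideal, tagged with their
  (unsuspended) degrees, \<open>eps w i\<close> is the sum of the first \<open>i\<close> suspended degrees, and
  \<open>hoch_diff A M p f w\<close> is the value on \<open>[a\<^sub>1|\<dots>|a\<^sub>n]\<close> of the Hochschild differential of the
  cochain \<open>f\<close> of degree \<open>p\<close>. These elements span the bar construction as a bimodule.
\<close>

definition eps :: "(int \<times> 'a) list \<Rightarrow> nat \<Rightarrow> int" where
  "eps w i = (\<Sum>j<i. fst (w ! j) + 1)"

definition hoch_diff0 :: "('k::field, 't::finite, 'a::ab_group_add) dga
    \<Rightarrow> ('k, 't, 'a, 'm::ab_group_add) dg_bimod \<Rightarrow> int \<Rightarrow> (('k, 't, 'a) words \<Rightarrow> 'm)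
    \<Rightarrow> (int \<times> 'a) list \<Rightarrow> 'm" where
  "hoch_diff0 A M p f w = (let a = map snd w in
     mdif M (f (bar_word A a)) +
     (\<Sum>i<length w. ksgn (eps w i + p) (f (bar_word A (a[i := dif A (a ! i)])))))"

definition hoch_diff1 :: "('k::field, 't::finite, 'a::ab_group_add) dga
    \<Rightarrow> ('k, 't, 'a, 'm::ab_group_add) dg_bimod \<Rightarrow> int \<Rightarrow> (('k, 't, 'a) words \<Rightarrow> 'm)
    \<Rightarrow> (int \<times> 'a) list \<Rightarrow> 'm" where
  "hoch_diff1 A M p f w = (if w = [] then 0 else let a = map snd w; n = length w - 1 in
     ksgn (p * (fst (hd w) + 1)) (lmul M (hd a) (f (bar_word A (tl a)))) +
     (\<Sum>i=1..n. ksgn (p + eps w i)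
        (f (bar_word A (take (i - 1) a @ [mul A (a ! (i - 1)) (a ! i)] @ drop (i + 1) a)))) +
     ksgn (p + eps w n + 1) (rmul M (f (bar_word A (butlast a))) (last a)))"

definition hoch_diff :: "('k::field, 't::finite, 'a::ab_group_add) dga
    \<Rightarrow> ('k, 't, 'a, 'm::ab_group_add) dg_bimod \<Rightarrow> int \<Rightarrow> (('k, 't, 'a) words \<Rightarrow> 'm)
    \<Rightarrow> (int \<times> 'a) list \<Rightarrow> 'm" where
  "hoch_diff A M p f w = hoch_diff0 A M p f w + hoch_diff1 A M p f w"

definition hoch_cocycle :: "('k::field, 't::finite, 'a::ab_group_add) dga
    \<Rightarrow> ('k, 't, 'a, 'm::ab_group_add) dg_bimod \<Rightarrow> int \<Rightarrow> (('k, 't, 'a) words \<Rightarrow> 'm) \<Rightarrow> bool" where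
  "hoch_cocycle A M p f \<longleftrightarrow> hoch_cochain A M p f \<and> (\<forall>w\<in>hwords (aug_ideal A). hoch_diff A M p f w = 0)"

text \<open>\<open>hoch_bounds A M p \<beta> f g\<close>: the cochains \<open>f\<close>, \<open>g\<close> of degree \<open>p\<close> differ by the differential of \<open>\<beta>\<close>.\<close>

definition hoch_bounds :: "('k::field, 't::finite, 'a::ab_group_add) dga
    \<Rightarrow> ('k, 't, 'a, 'm::ab_group_add) dg_bimod \<Rightarrow> int \<Rightarrow> (('k, 't, 'a) words \<Rightarrow> 'm)
    \<Rightarrow> (('k, 't, 'a) words \<Rightarrow> 'm) \<Rightarrow> (('k, 't, 'a) words \<Rightarrow> 'm) \<Rightarrow> bool" where
  "hoch_bounds A M p \<beta> f g \<longleftrightarrow> hoch_cochain A M (p + 1) \<beta> \<and>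
     (\<forall>w\<in>hwords (aug_ideal A).
        f (bar_word A (map snd w)) - g (bar_word A (map snd w)) = hoch_diff A M (p + 1) \<beta> w)"

text \<open>The cohomology class of a cocycle of (lower) degree \<open>p\<close>, as a coset of the coboundaries.\<close>

definition hoch_class :: "('k::field, 't::finite, 'a::ab_group_add) dga
    \<Rightarrow> ('k, 't, 'a, 'm::ab_group_add) dg_bimod \<Rightarrow> int \<Rightarrow> (('k, 't, 'a) words \<Rightarrow> 'm)
    \<Rightarrow> (('k, 't, 'a) words \<Rightarrow> 'm) set" where
  "hoch_class A M p f = {g. hoch_cocycle A M p g \<and> (\<exists>\<beta>. hoch_bounds A M p \<beta> f g)}"


section \<open>Hochschild extensions\<close>

text \<open>The composite of the differential of the bar construction of \<open>A\<close> with the projection to the letters.\<close>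

fun bar_dbar :: "('k::field, 't::finite, 'a::ab_group_add) dga \<Rightarrow> (int \<times> 'a) list \<Rightarrow> 'a" where
  "bar_dbar A [(i, a)] = - dif A a"
| "bar_dbar A [(i, a), (j, b)] = ksgn i (mul A a b)"
| "bar_dbar A w = 0"

text \<open>
  Words in homogeneous letters taken from the augmentation ideal (\<open>Inl\<close>) or from \<open>M\<close> (\<open>Inr\<close>),
  tagged with their unsuspended degrees.
\<close>

definition ext_words :: "('k::field, 't::finite, 'a::ab_group_add) dga
    \<Rightarrow> ('k, 't, 'a, 'm::ab_group_add) dg_bimod \<Rightarrow> (int \<times> ('a + 'm)) list set" where
  "ext_words A M = {w. \<forall>(i, x)\<in>set w.
     case x of Inl a \<Rightarrow> a \<in> gcomp (aug_ideal A) i | Inr m \<Rightarrow> m \<in> gcomp M i}"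

definition ext_letter :: "'a::ab_group_add + 'm::ab_group_add \<Rightarrow> 'a \<times> 'm" where
  "ext_letter x = (case x of Inl a \<Rightarrow> (a, 0) | Inr m \<Rightarrow> (0, m))"

definition ext_dbar :: "('k::field, 't::finite, 'a::ab_group_add) dga
    \<Rightarrow> ('k, 't, 'a, 'm::ab_group_add) dg_bimod \<Rightarrow> (('k, 't, 'a) words \<Rightarrow> 'm)
    \<Rightarrow> (int \<times> ('a + 'm)) list \<Rightarrow> 'a \<times> 'm" where
  "ext_dbar A M \<alpha> w =
     (if \<forall>x\<in>set w. isl (snd x)
      then (bar_dbar A (map (map_prod id projl) w), - \<alpha> (bar_word A (map (projl \<circ> snd) w)))
      else (case w of
          [(i, Inr m)] \<Rightarrow> (0, - mdif M m)
        | [(i, Inl a), (j, Inr m)] \<Rightarrow> (0, ksgn i (lmul M a m))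
        | [(i, Inr m), (j, Inl a)] \<Rightarrow> (0, ksgn i (rmul M m a))
        | _ \<Rightarrow> (0, 0)))"

definition ext_bimod :: "('k::field, 't::finite, 'a::ab_group_add) dga
    \<Rightarrow> ('k, 't, 'a, 'm::ab_group_add) dg_bimod \<Rightarrow> ('k, 't, 'a \<times> 'm) gbimod" where
  "ext_bimod A M = \<lparr>gcomp = (\<lambda>i. gcomp A i \<times> gcomp M i),
     lact = (\<lambda>c (a, m). (lact A c a, lact M c m)),
     ract = (\<lambda>(a, m) c. (ract A a c, ract M m c))\<rparr>"

text \<open>
  The last field is the unique coderivation whose composite with the projection to the letters is
  \<open>ext_dbar A M \<alpha>\<close>; extensionality pins down its (irrelevant) values outside the tensor coalgebra.
\<close>

definition hoch_ext :: "('k::field, 't::finite, 'a::ab_group_add) dga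
    \<Rightarrow> ('k, 't, 'a, 'm::ab_group_add) dg_bimod \<Rightarrow> (('k, 't, 'a) words \<Rightarrow> 'm)
    \<Rightarrow> ('k, 't, 'a \<times> 'm) ainf" where
  "hoch_ext A M \<alpha> =
     (let V = susp (kernel_bimod (ext_bimod A M) (\<lambda>(a, m). aug A a)) in
      gbimod.extend (ext_bimod A M) \<lparr>
        aunit = (\<lambda>c. (unit A c, 0)),
        aaug = (\<lambda>(a, m). aug A a),
        acod = (THE D. D \<in> extensional (gcar (tensor_coalg V)) \<and>
          coderivation (tensor_coalg V) (-1) D \<and>
          (\<forall>w\<in>ext_words A M.
             tproj V (D (tword V 1 (map (ext_letter \<circ> snd) w))) = ext_dbar A M \<alpha> w))\<rparr>)"

end

theory Submission
  imports Defs
begin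

text \<open>
  Write \<open>V = s(I \<oplus> M)\<close>, where \<open>I\<close> is the augmentation ideal of \<open>A\<close>. A coderivation of the tensor
  coalgebra \<open>T(V)\<close> is determined by its corestriction, the composite with the projection to the
  letters, and so is a morphism of coaugmented coalgebras. Hence both claims reduce to identities
  between maps \<open>T(V) \<rightarrow> V\<close>, and these can be checked on words of homogeneous letters.

  The corestriction of the differential \<open>D\<close> of the extension is \<open>b = b\<^sub>0 - s\<alpha>\<close>, where \<open>b\<^sub>0\<close> belongs
  to the bar construction of the square-zero extension dg algebra \<open>A \<oplus> M\<close>. As \<open>D\<close> is odd, \<open>D\<^sup>2\<close> is
  again a coderivation, and its corestriction has three kinds of terms. Those with \<open>b\<^sub>0\<close> twice cancel
  because \<open>A \<oplus> M\<close> is a dg algebra (\<open>sq_bar_square\<close>). Those with \<open>\<alpha>\<close> twice vanish because \<open>\<alpha>\<close> takes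
  values in \<open>M\<close> and vanishes on words with a letter from \<open>M\<close>. The mixed terms add up to the Hochschild
  differential \<open>\<delta>\<alpha>\<close> (\<open>ext_b_square\<close>), so \<open>D\<^sup>2 = 0\<close> exactly if \<open>\<delta>\<alpha> = 0\<close>. The assumption \<open>M\<^sub>-\<^sub>2 = 0\<close>
  enters through the value of \<open>\<alpha>\<close> on the empty word: it has to vanish for \<open>D\<close> to kill the
  coaugmentation.

  If \<open>\<alpha> - \<alpha>' = \<delta>\<beta>\<close> and \<open>\<beta>\<close> vanishes on the empty word, let \<open>F\<^sub>\<beta>\<close> be the coalgebra map with
  corestriction the projection to the letters plus \<open>s\<beta>\<close>. Then \<open>F\<^sub>\<beta> D\<close> and \<open>D' F\<^sub>\<beta>\<close> are both
  coderivations along \<open>F\<^sub>\<beta>\<close>, and the difference of their corestrictions is \<open>\<alpha>' - \<alpha> + \<delta>\<beta>\<close>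
  (\<open>ext_f_chain\<close>), which is zero. The inverse is \<open>F\<^sub>-\<^sub>\<beta>\<close>, again because \<open>\<beta>\<close> vanishes on words with a
  letter from \<open>M\<close>.

  The general part rests on three tools. The universal properties \<open>linext_tword\<close> and
  \<open>linext_pure_tensor\<close> turn multilinear formulas into maps out of \<open>T(V)\<close> and of tensor products. The
  grading of \<open>T(V)\<close> is direct (\<open>graded_tensor\<close>), which gives Koszul signs on \<open>T(V)\<close> a meaning.
  Finally \<open>rigidity\<close> is the common source of all uniqueness statements about coderivations and
  coalgebra maps, while \<open>cod\<close> and \<open>cmap\<close> construct them from their corestrictions.
\<close>

section \<open>Graded bimodules\<close>

lemma ksgn_0 [simp]: "ksgn 0 x = x"
  by (simp add: ksgn_def)

lemma ksgn_zero [simp]: "ksgn n 0 = 0"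
  by (simp add: ksgn_def)

lemma ksgn_add: "ksgn n (x + y) = ksgn n x + ksgn n y"
  by (simp add: ksgn_def)

lemma ksgn_minus: "ksgn n (- x) = - ksgn n x"
  by (simp add: ksgn_def)

lemma ksgn_diff: "ksgn n (x - y) = ksgn n x - ksgn n y"
  by (simp add: ksgn_def)

lemma ksgn_ksgn: "ksgn m (ksgn n x) = ksgn (m + n) x"
  by (simp add: ksgn_def)

lemma ksgn_sum: "ksgn n (\<Sum>i\<in>I. f i) = (\<Sum>i\<in>I. ksgn n (f i))"
  by (simp add: ksgn_def sum_negf)

lemma gcar_gcomp: "x \<in> gcomp V i \<Longrightarrow> x \<in> gcar V"
  unfolding gcar_def by (rule CollectI, rule exI[of _ "{i}"], rule exI[of _ "\<lambda>_. x"]) simp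

lemma gcar_induct [consumes 1, case_names zero add]:
  assumes "x \<in> gcar V" and "P 0"
    and "\<And>i x y. x \<in> gcomp V i \<Longrightarrow> y \<in> gcar V \<Longrightarrow> P y \<Longrightarrow> P (x + y)"
  shows "P x"
proof -
  obtain I z where z: "finite I" "\<forall>i\<in>I. z i \<in> gcomp V i" "x = (\<Sum>i\<in>I. z i)"
    using assms(1) unfolding gcar_def by blast
  have "P (\<Sum>i\<in>I. z i)"
    using z(1,2)
  proof (induction I)
    case (insert i I)
    have "(\<Sum>i\<in>I. z i) \<in> gcar V"
      unfolding gcar_def using insert by blast
    with insert show ?case using assms(3)[of "z i" i] by simp
  qed (simp add: assms(2))
  with z(3) show ?thesis by simp
qed

lemma gcar_add:
  assumes "\<And>i. 0 \<in> gcomp V i" "\<And>i x y. x \<in> gcomp V i \<Longrightarrow> y \<in> gcomp V i \<Longrightarrow> x + y \<in> gcomp V i"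
    and "x \<in> gcar V" "y \<in> gcar V"
  shows "x + y \<in> gcar V"
proof -
  obtain I z where z: "finite I" "\<forall>i\<in>I. z i \<in> gcomp V i" "x = (\<Sum>i\<in>I. z i)"
    using assms(3) unfolding gcar_def by blast
  obtain J u where u: "finite J" "\<forall>i\<in>J. u i \<in> gcomp V i" "y = (\<Sum>i\<in>J. u i)"
    using assms(4) unfolding gcar_def by blast
  define v where "v i = (if i \<in> I then z i else 0) + (if i \<in> J then u i else 0)" for i
  have 1: "(\<Sum>i\<in>I \<union> J. if i \<in> I then z i else 0) = x"
    unfolding z(3) by (rule sum.mono_neutral_cong_right) (use z u in auto)
  have 2: "(\<Sum>i\<in>I \<union> J. if i \<in> J then u i else 0) = y"
    unfolding u(3) by (rule sum.mono_neutral_cong_right) (use z u in auto)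
  have "x + y = (\<Sum>i\<in>I \<union> J. v i)"
    unfolding v_def sum.distrib 1 2 ..
  moreover have "\<forall>i\<in>I \<union> J. v i \<in> gcomp V i"
    using z u assms(1,2) by (auto simp: v_def)
  ultimately show ?thesis
    unfolding gcar_def using z(1) u(1) by blast
qed

context graded_bimodule
begin

lemma gcar_0 [simp]: "0 \<in> gcar V"
  using gcar_gcomp comp_zero by blast

lemma gcar_plus [simp, intro]: "x \<in> gcar V \<Longrightarrow> y \<in> gcar V \<Longrightarrow> x + y \<in> gcar V"
  by (rule gcar_add) (auto simp: comp_zero comp_add)

lemma gcar_uminus [simp, intro]: "x \<in> gcar V \<Longrightarrow> - x \<in> gcar V"
proof (induction rule: gcar_induct)
  case (add i x y)
  then show ?case
    using gcar_plus[OF gcar_gcomp[OF comp_uminus[OF add(1)]], of "- y"] by simp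
qed simp

lemma gcar_diff [simp, intro]: "x \<in> gcar V \<Longrightarrow> y \<in> gcar V \<Longrightarrow> x - y \<in> gcar V"
  using gcar_plus[OF _ gcar_uminus, of x y] by simp

lemma gcar_ksgn [simp, intro]: "x \<in> gcar V \<Longrightarrow> ksgn n x \<in> gcar V"
  by (simp add: ksgn_def)

lemma comp_ksgn: "x \<in> gcomp V i \<Longrightarrow> ksgn n x \<in> gcomp V i"
  by (simp add: ksgn_def comp_uminus)

lemma lact_0 [simp]: "lact V c 0 = 0"
  using lact_add_right[of 0 0 c] by simp

lemma ract_0 [simp]: "ract V 0 c = 0"
  using ract_add_left[of 0 0 c] by simp

lemma gcar_lact [simp, intro]: "x \<in> gcar V \<Longrightarrow> lact V c x \<in> gcar V"
  by (induction rule: gcar_induct)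
    (auto simp: lact_add_right gcar_gcomp[of _ V] intro!: gcar_plus intro: gcar_gcomp[OF comp_lact])

lemma gcar_ract [simp, intro]: "x \<in> gcar V \<Longrightarrow> ract V x c \<in> gcar V"
  by (induction rule: gcar_induct)
    (auto simp: ract_add_left gcar_gcomp intro!: gcar_plus intro: gcar_gcomp[OF comp_ract])

lemma lact_uminus: "x \<in> gcar V \<Longrightarrow> lact V c (- x) = - lact V c x"
  using lact_add_right[of x "- x" c] by (simp add: eq_neg_iff_add_eq_0 add.commute)

lemma ract_uminus: "x \<in> gcar V \<Longrightarrow> ract V (- x) c = - ract V x c"
  using ract_add_left[of x "- x" c] by (simp add: eq_neg_iff_add_eq_0 add.commute)

lemma lact_ksgn: "x \<in> gcar V \<Longrightarrow> lact V c (ksgn n x) = ksgn n (lact V c x)"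
  by (simp add: ksgn_def lact_uminus)

lemma ract_ksgn: "x \<in> gcar V \<Longrightarrow> ract V (ksgn n x) c = ksgn n (ract V x c)"
  by (simp add: ksgn_def ract_uminus)

text \<open>
  The sum of the homogeneous components is direct, so the description in \<open>hcomps\<close> has only one
  solution.
\<close>

lemma hcomps_eqI:
  assumes "finite {i. c i \<noteq> 0}" "\<And>i. c i \<in> gcomp V i" "x = (\<Sum>i | c i \<noteq> 0. c i)"
  shows "hcomps V x = c"
  unfolding hcomps_def
proof (rule the_equality)
  fix d assume d: "finite {i. d i \<noteq> 0} \<and> (\<forall>i. d i \<in> gcomp V i) \<and> x = (\<Sum>i | d i \<noteq> 0. d i)"
  let ?J = "{i. c i \<noteq> 0} \<union> {i. d i \<noteq> 0}"
  have "x = (\<Sum>i\<in>?J. c i)"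
    unfolding assms(3) by (rule sum.mono_neutral_left) (use assms d in auto)
  moreover have "(\<Sum>i | d i \<noteq> 0. d i) = (\<Sum>i\<in>?J. d i)"
    by (rule sum.mono_neutral_left) (use assms d in auto)
  ultimately have "(\<Sum>i\<in>?J. d i - c i) = 0"
    using d by (simp add: sum_subtractf)
  moreover have "d i - c i \<in> gcomp V i" for i
    using d assms(2) comp_add[of "d i" i "- c i"] comp_uminus by auto
  moreover have "finite ?J" using d assms(1) by simp
  ultimately have *: "d i - c i = 0" if "i \<in> ?J" for i
    using comp_direct[of ?J "\<lambda>i. d i - c i" i] that by blast
  show "d = c"
  proof
    show "d i = c i" for i
      using *[of i] by (cases "i \<in> ?J") auto
  qed
qed (use assms in blast)

lemma hcomps_homog: "x \<in> gcomp V i \<Longrightarrow> hcomps V x = (\<lambda>j. if j = i then x else 0)"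
  by (rule hcomps_eqI) (auto simp: comp_zero if_distrib cong: if_cong)

lemma hcomps_props:
  assumes "x \<in> gcar V"
  shows "finite {i. hcomps V x i \<noteq> 0}" "hcomps V x i \<in> gcomp V i"
    "x = (\<Sum>i | hcomps V x i \<noteq> 0. hcomps V x i)"
proof -
  obtain I z where z: "finite I" "\<forall>i\<in>I. z i \<in> gcomp V i" "x = (\<Sum>i\<in>I. z i)"
    using assms unfolding gcar_def by blast
  define c where "c i = (if i \<in> I then z i else 0)" for i
  have 1: "finite {i. c i \<noteq> 0}"
    by (rule finite_subset[OF _ z(1)]) (auto simp: c_def)
  have 2: "\<And>i. c i \<in> gcomp V i"
    using z by (auto simp: c_def comp_zero)
  have 3: "x = (\<Sum>i | c i \<noteq> 0. c i)"
    unfolding z(3) by (rule sum.mono_neutral_cong_right) (use z in \<open>auto simp: c_def\<close>)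
  have "hcomps V x = c"
    by (rule hcomps_eqI[OF 1 2 3])
  with 1 2 3 show "finite {i. hcomps V x i \<noteq> 0}" "hcomps V x i \<in> gcomp V i"
    "x = (\<Sum>i | hcomps V x i \<noteq> 0. hcomps V x i)"
    by auto
qed

lemma hcomps_add:
  assumes "x \<in> gcar V" "y \<in> gcar V"
  shows "hcomps V (x + y) = (\<lambda>i. hcomps V x i + hcomps V y i)"
proof (rule hcomps_eqI)
  note X = hcomps_props[OF assms(1)] and Y = hcomps_props[OF assms(2)]
  let ?J = "{i. hcomps V x i \<noteq> 0} \<union> {i. hcomps V y i \<noteq> 0}"
  have J: "finite ?J" using X(1) Y(1) by simp
  show "finite {i. hcomps V x i + hcomps V y i \<noteq> 0}"
    by (rule finite_subset[OF _ J]) auto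
  show "hcomps V x i + hcomps V y i \<in> gcomp V i" for i
    using X(2) Y(2) by (rule comp_add)
  have "x = (\<Sum>i\<in>?J. hcomps V x i)"
    by (subst X(3), rule sum.mono_neutral_left) (use J in auto)
  moreover have "y = (\<Sum>i\<in>?J. hcomps V y i)"
    by (subst Y(3), rule sum.mono_neutral_left) (use J in auto)
  ultimately have "x + y = (\<Sum>i\<in>?J. hcomps V x i + hcomps V y i)"
    by (simp add: sum.distrib)
  also have "\<dots> = (\<Sum>i | hcomps V x i + hcomps V y i \<noteq> 0. hcomps V x i + hcomps V y i)"
    by (rule sum.mono_neutral_right) (use J in auto)
  finally show "x + y = \<dots>" .
qed

lemma koszul_superset:
  assumes "finite J" "\<And>i. i \<notin> J \<Longrightarrow> hcomps V x i = 0"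
  shows "koszul V q x = (\<Sum>i\<in>J. ksgn (q * i) (hcomps V x i))"
  unfolding koszul_def by (rule sum.mono_neutral_left) (use assms in auto)

lemma koszul_add:
  assumes "x \<in> gcar V" "y \<in> gcar V"
  shows "koszul V q (x + y) = koszul V q x + koszul V q y"
proof -
  let ?J = "{i. hcomps V x i \<noteq> 0} \<union> {i. hcomps V y i \<noteq> 0}"
  have J: "finite ?J" using assms hcomps_props(1) by simp
  have "koszul V q (x + y) = (\<Sum>i\<in>?J. ksgn (q * i) (hcomps V (x + y) i))"
    "koszul V q x = (\<Sum>i\<in>?J. ksgn (q * i) (hcomps V x i))"
    "koszul V q y = (\<Sum>i\<in>?J. ksgn (q * i) (hcomps V y i))"
    by (rule koszul_superset[OF J]; auto simp: hcomps_add assms)+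
  then show ?thesis
    by (simp add: hcomps_add assms ksgn_add sum.distrib)
qed

lemma koszul_homog: "x \<in> gcomp V i \<Longrightarrow> koszul V q x = ksgn (q * i) x"
  by (subst koszul_superset[of "{i}"]) (auto simp: hcomps_homog)

lemma koszul_0 [simp]: "koszul V q 0 = 0"
  using koszul_homog[OF comp_zero] by simp

lemma koszul_uminus: "x \<in> gcar V \<Longrightarrow> koszul V q (- x) = - koszul V q x"
  using koszul_add[of x "- x" q] by (simp add: eq_neg_iff_add_eq_0 add.commute)

lemma gcar_koszul [simp, intro]: "x \<in> gcar V \<Longrightarrow> koszul V q x \<in> gcar V"
  by (induction rule: gcar_induct)
    (auto simp: koszul_add koszul_homog gcar_gcomp intro!: gcar_plus gcar_ksgn)

lemma comp_koszul: "x \<in> gcomp V i \<Longrightarrow> koszul V q x \<in> gcomp V i"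
  by (simp add: koszul_homog comp_ksgn)

lemma koszul_lact: "x \<in> gcar V \<Longrightarrow> koszul V q (lact V c x) = lact V c (koszul V q x)"
proof (induction rule: gcar_induct)
  case (add i x y)
  then have [simp]: "x \<in> gcar V" using gcar_gcomp by blast
  with add show ?case
    by (simp add: koszul_add lact_add_right koszul_homog[OF add(1)]
        koszul_homog[OF comp_lact[OF add(1)]] lact_ksgn)
qed simp

lemma koszul_ract: "x \<in> gcar V \<Longrightarrow> koszul V q (ract V x c) = ract V (koszul V q x) c"
proof (induction rule: gcar_induct)
  case (add i x y)
  then have [simp]: "x \<in> gcar V" using gcar_gcomp by blast
  with add show ?case
    by (simp add: koszul_add ract_add_left koszul_homog[OF add(1)]
        koszul_homog[OF comp_ract[OF add(1)]] ract_ksgn)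
qed simp

lemma koszul_koszul: "x \<in> gcar V \<Longrightarrow> koszul V q (koszul V q x) = x"
proof (induction rule: gcar_induct)
  case (add i x y)
  then have [simp]: "x \<in> gcar V" using gcar_gcomp by blast
  with add show ?case
    by (simp add: koszul_add koszul_homog[OF add(1)] koszul_homog[OF comp_ksgn[OF add(1)]] ksgn_ksgn, simp add: ksgn_def)
qed simp

lemma koszul_trivial: "x \<in> gcar V \<Longrightarrow> koszul V 0 x = x"
  by (induction rule: gcar_induct) (auto simp: koszul_add koszul_homog gcar_gcomp)

end

subsection \<open>Bimodule homomorphisms\<close>

lemma bimod_homD:
  assumes "bimod_hom V W p f"
  shows "x \<in> gcar V \<Longrightarrow> y \<in> gcar V \<Longrightarrow> f (x + y) = f x + f y"
    and "x \<in> gcar V \<Longrightarrow> f (lact V c x) = lact W c (f x)"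
    and "x \<in> gcar V \<Longrightarrow> f (ract V x c) = ract W (f x) c"
    and "x \<in> gcomp V i \<Longrightarrow> f x \<in> gcomp W (i + p)"
  using assms unfolding bimod_hom_def by blast+

context
  fixes V :: "('k::field, 't::finite, 'v::ab_group_add, 'z) gbimod_scheme"
    and W :: "('k, 't, 'w::ab_group_add, 'y) gbimod_scheme" and p f
  assumes V: "graded_bimodule V" and W: "graded_bimodule W" and f: "bimod_hom V W p f"
begin

interpretation V: graded_bimodule V by (rule V)
interpretation W: graded_bimodule W by (rule W)

lemma bimod_hom_0: "f 0 = 0"
  using bimod_homD(1)[OF f, of 0 0] by simp

lemma bimod_hom_uminus: "x \<in> gcar V \<Longrightarrow> f (- x) = - f x"
  using bimod_homD(1)[OF f, of x "- x"] by (simp add: bimod_hom_0 eq_neg_iff_add_eq_0 add.commute)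

lemma bimod_hom_ksgn: "x \<in> gcar V \<Longrightarrow> f (ksgn n x) = ksgn n (f x)"
  by (simp add: ksgn_def bimod_hom_uminus)

lemma bimod_hom_gcar: "x \<in> gcar V \<Longrightarrow> f x \<in> gcar W"
proof (induction rule: gcar_induct)
  case (add i x y)
  then show ?case
    using bimod_homD(4)[OF f add(1)] by (simp add: bimod_homD(1)[OF f] gcar_gcomp W.gcar_plus)
qed (simp add: bimod_hom_0)

text \<open>
  A map of degree \<open>p\<close> shifts all degrees by \<open>p\<close>; exchanging it with a sign of weight \<open>q\<close> costs the
  Koszul sign of exchanging maps of degrees \<open>p\<close> and \<open>q\<close>.
\<close>

lemma koszul_bimod_hom: "x \<in> gcar V \<Longrightarrow> koszul W q (f x) = ksgn (q * p) (f (koszul V q x))"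
proof (induction rule: gcar_induct)
  case (add i x y)
  have [simp]: "x \<in> gcar V" using gcar_gcomp add by blast
  show ?case
    using add by (simp add: bimod_homD(1)[OF f] W.koszul_add V.koszul_add bimod_hom_gcar
        W.koszul_homog[OF bimod_homD(4)[OF f add(1)]] V.koszul_homog bimod_hom_ksgn ksgn_ksgn
        distrib_left ksgn_add add.commute)
qed (simp add: bimod_hom_0)

end

section \<open>Linear maps on quotients of free vector spaces\<close>

text \<open>
  The target of a linear extension is asked to be a vector space on a subset \<open>B\<close> only, because a
  graded bimodule satisfies its axioms on its carrier only.
\<close>

locale scaling =
  fixes sc :: "'k::field \<Rightarrow> 'b::ab_group_add \<Rightarrow> 'b" and B
  assumes zero_B: "0 \<in> B"
    and add_B: "x \<in> B \<Longrightarrow> y \<in> B \<Longrightarrow> x + y \<in> B"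
    and sc_B: "x \<in> B \<Longrightarrow> sc r x \<in> B"
    and sc_add_left: "x \<in> B \<Longrightarrow> sc (r + s) x = sc r x + sc s x"
    and sc_add_right: "x \<in> B \<Longrightarrow> y \<in> B \<Longrightarrow> sc r (x + y) = sc r x + sc r y"
    and sc_mult: "x \<in> B \<Longrightarrow> sc (r * s) x = sc r (sc s x)"
    and sc_one: "x \<in> B \<Longrightarrow> sc 1 x = x"
begin

lemma sc_0: "x \<in> B \<Longrightarrow> sc 0 x = 0"
  using sc_add_left[of x 0 0] by simp

lemma sc_zero: "sc r 0 = 0"
  using sc_add_right[OF zero_B zero_B, of r] by simp

lemma sc_sum: "(\<And>i. i \<in> I \<Longrightarrow> f i \<in> B) \<Longrightarrow> sc r (\<Sum>i\<in>I. f i) = (\<Sum>i\<in>I. sc r (f i)) \<and> (\<Sum>i\<in>I. f i) \<in> B"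
  by (induction I rule: infinite_finite_induct) (auto simp: sc_zero zero_B sc_add_right add_B)

lemma linext_superset:
  assumes "finite J" "Poly_Mapping.keys p \<subseteq> J" "\<phi> ` J \<subseteq> B"
  shows "linext sc \<phi> p = (\<Sum>x\<in>J. sc (Poly_Mapping.lookup p x) (\<phi> x))"
  unfolding linext_def
  by (rule sum.mono_neutral_left) (use assms in \<open>auto simp: in_keys_iff sc_0\<close>)

lemma linext_single: "\<phi> x \<in> B \<Longrightarrow> linext sc \<phi> (Poly_Mapping.single x r) = sc r (\<phi> x)"
  by (subst linext_superset[of "{x}"]) auto

lemma linext_add:
  assumes "\<phi> ` S \<subseteq> B" "Poly_Mapping.keys p \<subseteq> S" "Poly_Mapping.keys q \<subseteq> S"
  shows "linext sc \<phi> (p + q) = linext sc \<phi> p + linext sc \<phi> q"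
proof -
  let ?J = "Poly_Mapping.keys p \<union> Poly_Mapping.keys q"
  have "\<phi> x \<in> B" if "x \<in> ?J" for x using that assms by auto
  then have B: "\<phi> ` ?J \<subseteq> B" by auto
  have "linext sc \<phi> (p + q) = (\<Sum>x\<in>?J. sc (Poly_Mapping.lookup (p + q) x) (\<phi> x))"
    by (rule linext_superset) (use B keys_add[of p q] in auto)
  also have "\<dots> = (\<Sum>x\<in>?J. sc (Poly_Mapping.lookup p x) (\<phi> x) + sc (Poly_Mapping.lookup q x) (\<phi> x))"
    by (rule sum.cong) (use B in \<open>auto simp: lookup_add sc_add_left\<close>)
  finally show ?thesis
    using B by (simp add: sum.distrib linext_superset[of ?J])
qed

lemma keys_fscale: "Poly_Mapping.keys (fscale r p) \<subseteq> Poly_Mapping.keys p"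
  by (auto simp: in_keys_iff lookup_fscale)

lemma linext_fscale:
  assumes "\<phi> ` S \<subseteq> B" "Poly_Mapping.keys p \<subseteq> S"
  shows "linext sc \<phi> (fscale r p) = sc r (linext sc \<phi> p)"
proof -
  have "linext sc \<phi> (fscale r p) =
      (\<Sum>x\<in>Poly_Mapping.keys p. sc (r * Poly_Mapping.lookup p x) (\<phi> x))"
    by (subst linext_superset[OF _ keys_fscale]) (use assms in \<open>auto simp: lookup_fscale\<close>)
  also have "\<dots> = (\<Sum>x\<in>Poly_Mapping.keys p. sc r (sc (Poly_Mapping.lookup p x) (\<phi> x)))"
    by (rule sum.cong) (use assms in \<open>auto intro!: sc_mult\<close>)
  also have "\<dots> = sc r (linext sc \<phi> p)"
    unfolding linext_def
    by (rule sc_sum[THEN conjunct1, symmetric]) (use assms in \<open>auto intro!: sc_B\<close>)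
  finally show ?thesis .
qed

lemma linext_in_B:
  assumes "\<phi> ` S \<subseteq> B" "Poly_Mapping.keys p \<subseteq> S"
  shows "linext sc \<phi> p \<in> B"
  unfolding linext_def
  by (rule sc_sum[THEN conjunct2]) (use assms in \<open>auto intro!: sc_B\<close>)

end

interpretation fscale: scaling "fscale :: 'k::field \<Rightarrow> ('x \<Rightarrow>\<^sub>0 'k) \<Rightarrow> _" UNIV
  by unfold_locales (auto intro!: poly_mapping_eqI simp: lookup_fscale lookup_add algebra_simps)

interpretation fspace: vector_space "fscale :: 'k::field \<Rightarrow> ('x \<Rightarrow>\<^sub>0 'k) \<Rightarrow> _"
  by (rule vector_space_fscale)

lemma fscale_one [simp]: "fscale 1 p = p"
  by (simp add: fscale.sc_one)

lemma quot_proj_add: "quot_proj R (p + q) = quot_proj R p + quot_proj R q"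
  and quot_proj_fscale: "quot_proj R (fscale r p) = fscale r (quot_proj R p)"
  and quot_proj_eq_0_iff: "quot_proj R p = 0 \<longleftrightarrow> p \<in> fspan R"
  and quot_proj_idem: "quot_proj R (quot_proj R p) = quot_proj R p"
  using is_quot_proj_quot_proj[of R] unfolding is_quot_proj_def by auto

lemma quot_proj_diff: "quot_proj R (p - q) = quot_proj R p - quot_proj R q"
  using quot_proj_add[of R "p - q" q] by simp

lemma quot_proj_minus_self: "p - quot_proj R p \<in> fspan R"
  by (simp add: quot_proj_eq_0_iff[symmetric] quot_proj_diff quot_proj_idem)

lemma keys_diff': "Poly_Mapping.keys p \<subseteq> S \<Longrightarrow> Poly_Mapping.keys q \<subseteq> S \<Longrightarrow> Poly_Mapping.keys (p - q) \<subseteq> S"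
proof
  fix x assume "Poly_Mapping.keys p \<subseteq> S" "Poly_Mapping.keys q \<subseteq> S" "x \<in> Poly_Mapping.keys (p - q)"
  moreover from this(3) have "x \<in> Poly_Mapping.keys p \<or> x \<in> Poly_Mapping.keys q"
    by (auto simp: in_keys_iff lookup_minus)
  ultimately show "x \<in> S" by blast
qed

context scaling
begin

lemma linext_diff:
  assumes "\<phi> ` S \<subseteq> B" "Poly_Mapping.keys p \<subseteq> S" "Poly_Mapping.keys q \<subseteq> S"
  shows "linext sc \<phi> (p - q) = linext sc \<phi> p - linext sc \<phi> q"
  using linext_add[OF assms(1) keys_diff'[OF assms(2,3)] assms(3)] by simp

text \<open>
  The representative picked by \<open>quot_proj\<close> differs from the given vector by combinations of
  relations only, so it stays supported where the relations are, and linear maps killing the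
  relations cannot tell the two apart. The support matters because the scaling \<open>sc\<close> may
  behave well on the values of \<open>\<phi>\<close> over \<open>S\<close> only.
\<close>

lemma linext_quot_proj:
  assumes \<phi>: "\<phi> ` S \<subseteq> B" and R: "\<And>r. r \<in> R \<Longrightarrow> Poly_Mapping.keys r \<subseteq> S \<and> linext sc \<phi> r = 0"
    and p: "Poly_Mapping.keys p \<subseteq> S"
  shows "Poly_Mapping.keys (quot_proj R p) \<subseteq> S \<and> linext sc \<phi> (quot_proj R p) = linext sc \<phi> p"
proof -
  have *: "Poly_Mapping.keys z \<subseteq> S \<and> linext sc \<phi> z = 0" if "z \<in> fspan R" for z
    using that
  proof (induction rule: fspace.span_induct_alt)
    case base
    show ?case by (simp add: linext_def)
  next
    case (step r x y)
    have k: "Poly_Mapping.keys (fscale r x) \<subseteq> S"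
      using keys_fscale R[OF step(1)] by fast
    then show ?case
      using step R[OF step(1)] keys_add[of "fscale r x" y]
      by (auto simp: linext_add[OF \<phi>] linext_fscale[OF \<phi>] sc_zero)
  qed
  let ?z = "p - quot_proj R p"
  have z: "Poly_Mapping.keys ?z \<subseteq> S" "linext sc \<phi> ?z = 0"
    using *[OF quot_proj_minus_self] by auto
  have "Poly_Mapping.keys (p - ?z) \<subseteq> S" "linext sc \<phi> (p - ?z) = linext sc \<phi> p"
    using keys_diff'[OF p z(1)] linext_diff[OF \<phi> p z(1)] z(2) by simp_all
  then show ?thesis by simp
qed

end

section \<open>The tensor coalgebra as a graded bimodule\<close>

subsection \<open>Multilinear functions of words\<close>

text \<open>
  These are the functions of words that factor, for words of each length \<open>n \<ge> 1\<close>, through the tensor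
  power over \<open>K\<close> as an abelian group. The actions of \<open>K\<close> from outside on the first and last letters
  are not constrained.
\<close>

definition multilin :: "('k::field, 't::finite, 'v::ab_group_add, 'z) gbimod_scheme \<Rightarrow> ('v list \<Rightarrow> 'b::ab_group_add) \<Rightarrow> bool" where
  "multilin V h \<longleftrightarrow>
    (\<forall>u\<in>lists (gcar V). \<forall>v\<in>lists (gcar V). \<forall>x\<in>gcar V. \<forall>y\<in>gcar V.
        h (u @ (x + y) # v) = h (u @ x # v) + h (u @ y # v)) \<and>
    (\<forall>u\<in>lists (gcar V). \<forall>v\<in>lists (gcar V). \<forall>x\<in>gcar V. \<forall>y\<in>gcar V. \<forall>c.
        h (u @ ract V x c # y # v) = h (u @ x # lact V c y # v))"

lemma multilinI:
  assumes "\<And>u v x y. u \<in> lists (gcar V) \<Longrightarrow> v \<in> lists (gcar V) \<Longrightarrow> x \<in> gcar V \<Longrightarrow> y \<in> gcar V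
      \<Longrightarrow> h (u @ (x + y) # v) = h (u @ x # v) + h (u @ y # v)"
    and "\<And>u v x y c. u \<in> lists (gcar V) \<Longrightarrow> v \<in> lists (gcar V) \<Longrightarrow> x \<in> gcar V \<Longrightarrow> y \<in> gcar V
      \<Longrightarrow> h (u @ ract V x c # y # v) = h (u @ x # lact V c y # v)"
  shows "multilin V h"
  using assms unfolding multilin_def by blast

lemma multilin_add:
  "multilin V h \<Longrightarrow> u \<in> lists (gcar V) \<Longrightarrow> v \<in> lists (gcar V) \<Longrightarrow> x \<in> gcar V \<Longrightarrow> y \<in> gcar V
    \<Longrightarrow> h (u @ (x + y) # v) = h (u @ x # v) + h (u @ y # v)"
  unfolding multilin_def by blast

lemma multilin_bal:
  "multilin V h \<Longrightarrow> u \<in> lists (gcar V) \<Longrightarrow> v \<in> lists (gcar V) \<Longrightarrow> x \<in> gcar V \<Longrightarrow> y \<in> gcar V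
    \<Longrightarrow> h (u @ ract V x c # y # v) = h (u @ x # lact V c y # v)"
  unfolding multilin_def by blast

lemma multilin_const: "multilin V (\<lambda>w. 0)"
  by (simp add: multilin_def)

lemma multilin_plus: "multilin V h \<Longrightarrow> multilin V h' \<Longrightarrow> multilin V (\<lambda>w. h w + h' w)"
  by (rule multilinI) (simp_all add: multilin_add multilin_bal)

lemma multilin_uminus_fun: "multilin V h \<Longrightarrow> multilin V (\<lambda>w. - h w)"
  by (rule multilinI) (simp_all add: multilin_add multilin_bal)

lemma multilin_sum: "(\<And>i. i \<in> I \<Longrightarrow> multilin V (h i)) \<Longrightarrow> multilin V (\<lambda>w. \<Sum>i\<in>I. h i w)"
  by (induction I rule: infinite_finite_induct) (auto intro: multilin_const multilin_plus)

context graded_bimodule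
begin

abbreviation "L \<equiv> lists (gcar V)"

lemma multilin_append_right: "multilin V h \<Longrightarrow> p \<in> L \<Longrightarrow> multilin V (\<lambda>w. h (w @ p))"
  by (rule multilinI) (simp_all add: multilin_add multilin_bal)

lemma multilin_append_left: "multilin V h \<Longrightarrow> p \<in> L \<Longrightarrow> multilin V (\<lambda>w. h (p @ w))"
  by (rule multilinI)
    (use multilin_add[of V h "p @ _"] multilin_bal[of V h "p @ _"] in simp_all)

lemma multilin_Cons: "multilin V h \<Longrightarrow> x \<in> gcar V \<Longrightarrow> multilin V (\<lambda>w. h (x # w))"
  using multilin_append_left[of h "[x]"] by simp

lemma multilin_zero: "multilin V h \<Longrightarrow> u \<in> L \<Longrightarrow> v \<in> L \<Longrightarrow> h (u @ 0 # v) = 0"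
  using multilin_add[of V h u v 0 0] by simp

lemma multilin_uminus:
  "multilin V h \<Longrightarrow> u \<in> L \<Longrightarrow> v \<in> L \<Longrightarrow> x \<in> gcar V \<Longrightarrow> h (u @ (- x) # v) = - h (u @ x # v)"
  using multilin_add[of V h u v x "- x"] multilin_zero[of h u v]
  by (simp add: eq_neg_iff_add_eq_0 add.commute)

lemma multilin_ksgn:
  "multilin V h \<Longrightarrow> u \<in> L \<Longrightarrow> v \<in> L \<Longrightarrow> x \<in> gcar V \<Longrightarrow> h (u @ ksgn n x # v) = ksgn n (h (u @ x # v))"
  by (simp add: ksgn_def multilin_uminus)

lemma lists_koszul [simp]: "u \<in> L \<Longrightarrow> map (koszul V q) u \<in> L"
  by (auto simp: in_lists_conv_set)

lemma hwords_lists: "w \<in> hwords V \<Longrightarrow> map snd w \<in> L"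
  by (auto 4 3 simp: hwords_def in_lists_conv_set intro: gcar_gcomp)

lemma multilin_koszul:
  assumes "multilin V h" "w \<in> hwords V" "v \<in> L"
  shows "h (map (koszul V q) (map snd w) @ v) = ksgn (q * sum_list (map fst w)) (h (map snd w @ v))"
  using assms
proof (induction w arbitrary: h)
  case (Cons a w)
  obtain i x where a: "a = (i, x)" by fastforce
  then have x: "x \<in> gcomp V i" and w: "w \<in> hwords V" using Cons(3) by (auto simp: hwords_def)
  note xg = gcar_gcomp[OF x]
  have "h (koszul V q x # map (koszul V q) (map snd w) @ v)
      = ksgn (q * sum_list (map fst w)) (h (koszul V q x # map snd w @ v))"
    using Cons(1)[OF multilin_Cons[OF Cons(2)] w Cons(4)] xg by simp
  also have "h (koszul V q x # map snd w @ v) = ksgn (q * i) (h (x # map snd w @ v))"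
    using multilin_ksgn[OF Cons(2), of "[]" "map snd w @ v" x] hwords_lists[OF w] Cons(4) xg x
    by (simp add: koszul_homog)
  finally show ?case
    by (simp add: a ksgn_ksgn algebra_simps)
qed simp

end

text \<open>
  Each letter is a sum of homogeneous ones, so additivity in each position expresses all values by
  values on homogeneous words.
\<close>

lemma multilin_closed:
  assumes "graded_bimodule V" "multilin V h" and w: "w \<in> lists (gcar V)"
    and "0 \<in> Z" "\<And>x y. x \<in> Z \<Longrightarrow> y \<in> Z \<Longrightarrow> x + y \<in> Z"
    and "\<And>w. w \<in> hwords V \<Longrightarrow> h (map snd w) \<in> Z"
  shows "h w \<in> Z"
proof -
  interpret graded_bimodule V by fact
  have "h (map snd u @ w) \<in> Z" if "u \<in> hwords V" for u
    using w that
  proof (induction w arbitrary: u)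
    case (Cons x w)
    from Cons(1) Cons.prems show ?case
    proof (induction rule: gcar_induct)
      case zero
      then show ?case using Cons(2) by (simp add: multilin_zero assms hwords_lists)
    next
      case (add i x y)
      then have "h (map snd (u @ [(i, x)]) @ w) \<in> Z"
        by (intro Cons(3)) (auto simp: hwords_def)
      with add Cons(2) show ?case
        by (simp add: multilin_add[OF assms(2)] hwords_lists gcar_gcomp[OF add(1)] assms(5))
    qed
  qed (use assms in simp)
  from this[of "[]"] show ?thesis by (simp add: hwords_def)
qed

lemma multilin_eq_on_homogeneous:
  assumes "graded_bimodule V" "multilin V h" "multilin V h'" and w: "w \<in> lists (gcar V)"
    and "\<And>w. w \<in> hwords V \<Longrightarrow> h (map snd w) = h' (map snd w)"
  shows "h w = h' w"
proof -
  have "multilin V (\<lambda>w. (h w, h' w))"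
    by (rule multilinI) (simp_all add: multilin_add[OF assms(2)] multilin_add[OF assms(3)]
        multilin_bal[OF assms(2)] multilin_bal[OF assms(3)])
  from multilin_closed[OF assms(1) this w, of "{(x, y). x = y}"] show ?thesis
    by (simp add: assms(5) zero_prod_def split_beta)
qed

subsection \<open>The universal property of words\<close>

text \<open>
  The coefficient \<open>c\<close> of a word behaves like an additional letter from \<open>K\<close> in front: it can be merged
  into the first letter. These conditions say that \<open>\<phi>\<close> respects \<open>word_rels\<close>.
\<close>

definition word_lin :: "('k::field, 't::finite, 'v::ab_group_add, 'z) gbimod_scheme
    \<Rightarrow> ('k \<Rightarrow> 'b::ab_group_add \<Rightarrow> 'b) \<Rightarrow> ('k ^ 't \<Rightarrow> 'v list \<Rightarrow> 'b) \<Rightarrow> bool" where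
  "word_lin V sc \<phi> \<longleftrightarrow> (\<forall>c. multilin V (\<phi> c)) \<and>
    (\<forall>c c'. \<forall>w\<in>lists (gcar V). \<phi> (c + c') w = \<phi> c w + \<phi> c' w) \<and>
    (\<forall>r c. \<forall>w\<in>lists (gcar V). \<phi> (vec r * c) w = sc r (\<phi> c w)) \<and>
    (\<forall>c c'. \<forall>x\<in>gcar V. \<forall>w\<in>lists (gcar V). \<phi> (c * c') (x # w) = \<phi> c (lact V c' x # w))"

lemma word_linI:
  assumes "\<And>c. multilin V (\<phi> c)"
    and "\<And>c c' w. w \<in> lists (gcar V) \<Longrightarrow> \<phi> (c + c') w = \<phi> c w + \<phi> c' w"
    and "\<And>r c w. w \<in> lists (gcar V) \<Longrightarrow> \<phi> (vec r * c) w = sc r (\<phi> c w)"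
    and "\<And>c c' x w. x \<in> gcar V \<Longrightarrow> w \<in> lists (gcar V) \<Longrightarrow> \<phi> (c * c') (x # w) = \<phi> c (lact V c' x # w)"
  shows "word_lin V sc \<phi>"
  using assms unfolding word_lin_def by blast

context graded_bimodule
begin

lemma keys_word_rels: "r \<in> word_rels V \<Longrightarrow> Poly_Mapping.keys r \<subseteq> UNIV \<times> L"
  unfolding word_rels_def Let_def
  by (elim UnE CollectE exE conjE; hypsubst; intro keys_diff' order.trans[OF fscale.keys_fscale]) auto

lemma word_rels_linext:
  assumes sc: "scaling sc B" and \<phi>: "word_lin V sc \<phi>" and B: "\<And>c w. w \<in> L \<Longrightarrow> \<phi> c w \<in> B"
    and r: "r \<in> word_rels V"
  shows "linext sc (\<lambda>(c, w). \<phi> c w) r = 0"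
proof -
  interpret scaling sc B by (rule sc)
  let ?l = "linext sc (\<lambda>(c, w). \<phi> c w)" and ?e = "\<lambda>c w. Poly_Mapping.single (c, w) 1"
  let ?S = "UNIV \<times> L"
  have S: "(\<lambda>(c, w). \<phi> c w) ` ?S \<subseteq> B" using B by auto
  have e: "?l (?e c w) = \<phi> c w" if "w \<in> L" for c w
    using that by (subst linext_single) (auto simp: B sc_one)
  have k: "Poly_Mapping.keys (?e c w) \<subseteq> ?S" if "w \<in> L" for c w
    using that by auto
  have kf: "Poly_Mapping.keys (fscale s (?e c w)) \<subseteq> ?S" if "w \<in> L" for c w s
    using k[OF that] fscale.keys_fscale by fast
  have d: "?l (?e c w - ?e c' w') = \<phi> c w - \<phi> c' w'" if "w \<in> L" "w' \<in> L" for c w c' w'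
    by (subst linext_diff[OF S]) (use that in \<open>simp_all add: k e\<close>)
  have dd: "?l (?e c w - ?e c' w' - ?e c'' w'') = \<phi> c w - \<phi> c' w' - \<phi> c'' w''"
    if "w \<in> L" "w' \<in> L" "w'' \<in> L" for c w c' w' c'' w''
    by (subst linext_diff[OF S]) (use that in \<open>simp_all add: k e d keys_diff'\<close>)
  have df: "?l (?e c w - fscale s (?e c' w')) = \<phi> c w - sc s (\<phi> c' w')" if "w \<in> L" "w' \<in> L" for c w c' w' s
    by (subst linext_diff[OF S]) (use that in \<open>simp_all add: k e kf linext_fscale[OF S]\<close>)
  have m: "multilin V (\<phi> c)" for c using \<phi> by (simp add: word_lin_def)
  from r show ?thesis
    unfolding word_rels_def Let_def
  proof (elim UnE CollectE exE conjE, goal_cases)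
    case (1 c c' w)
    then show ?case using \<phi> by (simp add: dd word_lin_def)
  next
    case (2 s c w)
    then show ?case using \<phi> by (simp add: df word_lin_def)
  next
    case (3 c u x y v)
    then show ?case by (simp add: dd multilin_add[OF m])
  next
    case (4 c c' x v)
    then show ?case using \<phi> by (simp add: d word_lin_def)
  next
    case (5 c c' u x y v)
    then show ?case by (simp add: d multilin_bal[OF m])
  qed
qed

lemma keys_tword: "w \<in> L \<Longrightarrow> Poly_Mapping.keys (tword V c w) \<subseteq> UNIV \<times> L"
  unfolding tword_def
  using fscale.linext_quot_proj[of "\<lambda>_. 0" "UNIV \<times> L" "word_rels V"
      "Poly_Mapping.single (c, w) 1"] keys_word_rels
  by (auto simp: linext_def fscale.sc_zero)

text \<open>
  The universal property of the tensor coalgebra as a vector space: the linear extension of \<open>\<phi>\<close> kills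
  the relations between words and can be evaluated on classes of words.
\<close>

lemma linext_tword:
  assumes sc: "scaling sc B" and \<phi>: "word_lin V sc \<phi>" and B: "\<And>c w. w \<in> L \<Longrightarrow> \<phi> c w \<in> B"
    and w: "w \<in> L"
  shows "linext sc (\<lambda>(c, w). \<phi> c w) (tword V c w) = \<phi> c w"
proof -
  interpret scaling sc B by (rule sc)
  have "linext sc (\<lambda>(c, w). \<phi> c w) (tword V c w) = linext sc (\<lambda>(c, w). \<phi> c w) (Poly_Mapping.single (c, w) 1)"
    unfolding tword_def
    by (rule linext_quot_proj[of _ "UNIV \<times> L", THEN conjunct2])
      (use B w keys_word_rels word_rels_linext[OF assms(1-3)] in auto)
  also have "\<dots> = \<phi> c w"
    using w by (subst linext_single) (auto simp: B sc_one)
  finally show ?thesis .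
qed

lemmas linext_tword_fscale = linext_tword[OF fscale.scaling_axioms _ UNIV_I]

lemma tword_add: "w \<in> L \<Longrightarrow> tword V (c + c') w = tword V c w + tword V c' w"
  unfolding tword_def quot_proj_add[symmetric] quot_proj_eq_iff
  by (rule fspace.span_base, unfold diff_diff_eq[symmetric] word_rels_def Let_def,
      rule UnI1, rule UnI1, rule UnI1, rule UnI1) blast

lemma tword_scale: "w \<in> L \<Longrightarrow> tword V (vec r * c) w = fscale r (tword V c w)"
  unfolding tword_def quot_proj_fscale[symmetric] quot_proj_eq_iff
  by (rule fspace.span_base, unfold word_rels_def Let_def,
      rule UnI1, rule UnI1, rule UnI1, rule UnI2) blast

lemma tword_lact: "w \<in> L \<Longrightarrow> x \<in> gcar V \<Longrightarrow> tword V (c * c') (x # w) = tword V c (lact V c' x # w)"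
  unfolding tword_def quot_proj_eq_iff
  by (rule fspace.span_base, unfold word_rels_def Let_def, rule UnI1, rule UnI2) blast

lemma multilin_tword: "multilin V (tword V c)"
proof (rule multilinI)
  fix u v x y assume *: "u \<in> L" "v \<in> L" "x \<in> gcar V" "y \<in> gcar V"
  show "tword V c (u @ (x + y) # v) = tword V c (u @ x # v) + tword V c (u @ y # v)"
    unfolding tword_def quot_proj_add[symmetric] quot_proj_eq_iff
    by (rule fspace.span_base, unfold diff_diff_eq[symmetric] word_rels_def Let_def,
        rule UnI1, rule UnI1, rule UnI2) (use * in blast)
next
  fix u v x y c' assume *: "u \<in> L" "v \<in> L" "x \<in> gcar V" "y \<in> gcar V"
  show "tword V c (u @ ract V x c' # y # v) = tword V c (u @ x # lact V c' y # v)"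
    unfolding tword_def quot_proj_eq_iff
    by (rule fspace.span_base, unfold word_rels_def Let_def, rule UnI2) (use * in blast)
qed

lemmas tword_letter_add = multilin_add[OF multilin_tword]
  and tword_letter_bal = multilin_bal[OF multilin_tword]

lemma tword_0: "w \<in> L \<Longrightarrow> tword V 0 w = 0"
  using tword_add[of w 0 0] by simp

text \<open>
  Scalars from \<open>k\<close> act centrally, hence can be carried letter by letter to the front of the word.
\<close>

lemma tword_vec:
  "u \<in> L \<Longrightarrow> v \<in> L \<Longrightarrow> x \<in> gcar V \<Longrightarrow> tword V c (u @ lact V (vec r) x # v) = fscale r (tword V c (u @ x # v))"
proof (induction u arbitrary: x v rule: rev_induct)
  case Nil
  then show ?case
    by (simp add: tword_lact[symmetric] mult.commute[of c] tword_scale)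
next
  case (snoc y u)
  then have "tword V c (u @ lact V (vec r) y # x # v) = fscale r (tword V c (u @ y # x # v))"
    by simp
  then show ?case
    using snoc(2-) tword_letter_bal[of u v y x c "vec r"] by (simp add: central)
qed

subsection \<open>Elements of the tensor coalgebra\<close>

abbreviation "T \<equiv> tensor_bimod V"

lemma gcomp_tensor: "gcomp T n = fspan {tword V c (map snd w) |c w. w \<in> hwords V \<and> sum_list (map fst w) = n}"
  by (simp add: tensor_bimod_def)

lemma tword_gcomp: "w \<in> hwords V \<Longrightarrow> tword V c (map snd w) \<in> gcomp T (sum_list (map fst w))"
  unfolding gcomp_tensor by (rule fspace.span_base) auto

lemma gcar_tensor_0: "0 \<in> gcar T"
  by (rule gcar_gcomp[of _ _ 0]) (simp add: gcomp_tensor fspace.span_zero)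

lemma gcar_tensor_add: "x \<in> gcar T \<Longrightarrow> y \<in> gcar T \<Longrightarrow> x + y \<in> gcar T"
  by (rule gcar_add) (auto simp: gcomp_tensor fspace.span_zero fspace.span_add)

lemma tword_gcar [simp, intro]: "w \<in> L \<Longrightarrow> tword V c w \<in> gcar T"
  by (rule multilin_closed[OF graded_bimodule_axioms multilin_tword])
    (auto intro: gcar_tensor_0 gcar_tensor_add gcar_gcomp tword_gcomp)

lemma gcomp_tensor_induct [consumes 1, case_names zero add]:
  assumes "z \<in> gcomp T n" "P 0"
    and "\<And>c w y. w \<in> hwords V \<Longrightarrow> sum_list (map fst w) = n \<Longrightarrow> y \<in> gcomp T n \<Longrightarrow> P y \<Longrightarrow> P (tword V c (map snd w) + y)"
  shows "P z"
proof -
  have "z \<in> gcomp T n \<and> P z"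
    using assms(1)[unfolded gcomp_tensor]
  proof (induction rule: fspace.span_induct_alt)
    case base
    show ?case using assms(2) by (simp add: gcomp_tensor fspace.span_zero)
  next
    case (step r x y)
    then obtain c w where w: "x = tword V c (map snd w)" "w \<in> hwords V" "sum_list (map fst w) = n"
      by blast
    have x: "fscale r x = tword V (vec r * c) (map snd w)"
      unfolding w(1) by (rule tword_scale[OF hwords_lists[OF w(2)], symmetric])
    have "fscale r x \<in> gcomp T n"
      unfolding x using tword_gcomp[OF w(2)] w(3) by blast
    then have "fscale r x + y \<in> gcomp T n"
      using step(2) unfolding gcomp_tensor by (blast intro: fspace.span_add)
    moreover have "P (fscale r x + y)"
      unfolding x using assms(3)[OF w(2,3)] step(2) by blast
    ultimately show ?case ..
  qed
  then show ?thesis ..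
qed

lemma gcar_tensor_induct [consumes 1, case_names zero add tword]:
  assumes "z \<in> gcar T" "P 0"
    and "\<And>x y. x \<in> gcar T \<Longrightarrow> y \<in> gcar T \<Longrightarrow> P x \<Longrightarrow> P y \<Longrightarrow> P (x + y)"
    and "\<And>c w. w \<in> hwords V \<Longrightarrow> P (tword V c (map snd w))"
  shows "P z"
  using assms(1)
proof (induction rule: gcar_induct)
  case (add i x y)
  from add(1) have "P x"
  proof (induction rule: gcomp_tensor_induct)
    case (add c w y)
    then show ?case
      using assms(3)[OF tword_gcar[OF hwords_lists] gcar_gcomp] assms(4) by blast
  qed (rule assms(2))
  with add show ?case using assms(3) gcar_gcomp by blast
qed (rule assms(2))

lemma gcar_tensor_eqI:
  assumes "z \<in> gcar T" "f 0 = 0" "g 0 = 0"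
    and "\<And>x y. x \<in> gcar T \<Longrightarrow> y \<in> gcar T \<Longrightarrow> f (x + y) = f x + f y"
    and "\<And>x y. x \<in> gcar T \<Longrightarrow> y \<in> gcar T \<Longrightarrow> g (x + y) = g x + g y"
    and "\<And>c w. w \<in> L \<Longrightarrow> f (tword V c w) = g (tword V c w)"
  shows "f z = g z"
  using assms(1) by (induction rule: gcar_tensor_induct) (auto simp: assms hwords_lists)

lemma gcar_tensor_keys: "z \<in> gcar T \<Longrightarrow> Poly_Mapping.keys z \<subseteq> UNIV \<times> L"
proof (induction rule: gcar_tensor_induct)
  case (add x y)
  then show ?case using keys_add[of x y] by blast
next
  case (tword c w)
  then show ?case using keys_tword hwords_lists by blast
qed simp

lemma linext_gcar_add:
  assumes "scaling sc B" "\<And>c w. w \<in> L \<Longrightarrow> \<phi> c w \<in> B" "x \<in> gcar T" "y \<in> gcar T"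
  shows "linext sc (\<lambda>(c, w). \<phi> c w) (x + y) = linext sc (\<lambda>(c, w). \<phi> c w) x + linext sc (\<lambda>(c, w). \<phi> c w) y"
  by (rule scaling.linext_add[OF assms(1), of _ "UNIV \<times> L"])
    (use assms gcar_tensor_keys in auto)

lemma linext_fscale_add: "linext fscale \<phi> (x + y) = linext fscale \<phi> x + linext fscale \<phi> y"
  by (rule fscale.linext_add[of _ UNIV]) auto

lemma linext_zero [simp]: "linext sc \<phi> 0 = 0"
  by (simp add: linext_def)

subsection \<open>The grading of the tensor coalgebra\<close>

lemma word_lin_lact: "word_lin V fscale (\<lambda>c. tword V (c' * c))"
proof (rule word_linI)
  fix r c w assume "w \<in> L"
  then show "tword V (c' * (vec r * c)) w = fscale r (tword V (c' * c) w)"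
    by (simp only: mult.left_commute[of c'] tword_scale)
qed (simp_all add: multilin_tword distrib_left tword_add tword_lact mult.assoc[symmetric])

lemma lact_tword: "w \<in> L \<Longrightarrow> lact T c' (tword V c w) = tword V (c' * c) w"
  using linext_tword_fscale[OF word_lin_lact, of w c'] by (simp add: tensor_bimod_def)

lemma word_lin_ract: "word_lin V fscale
  (\<lambda>c w. if w = [] then tword V (c * c') [] else tword V c (butlast w @ [ract V (last w) c']))"
  (is "word_lin V fscale ?\<phi>")
proof (rule word_linI)
  show "multilin V (?\<phi> c)" for c
  proof (rule multilinI)
    fix u v x y assume "u \<in> L" "v \<in> L" "x \<in> gcar V" "y \<in> gcar V"
    then show "?\<phi> c (u @ (x + y) # v) = ?\<phi> c (u @ x # v) + ?\<phi> c (u @ y # v)"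
      and "?\<phi> c (u @ ract V x d # y # v) = ?\<phi> c (u @ x # lact V d y # v)" for d
      by (cases v rule: rev_cases;
          simp add: butlast_append ract_add_left tword_letter_add lact_ract tword_letter_bal)+
  qed
next
  fix d c x w assume "x \<in> gcar V" "w \<in> L"
  then show "?\<phi> (c * d) (x # w) = ?\<phi> c (lact V d x # w)"
    by (cases w rule: rev_cases) (simp_all add: lact_ract tword_lact)
next
  fix c d w assume "w \<in> L"
  then show "?\<phi> (c + d) w = ?\<phi> c w + ?\<phi> d w" "?\<phi> (vec r * c) w = fscale r (?\<phi> c w)" for r
    by (cases w rule: rev_cases; simp add: distrib_right tword_add mult.assoc tword_scale)+
qed

lemma ract_tword_Nil: "ract T (tword V c []) c' = tword V (c * c') []"
  using linext_tword_fscale[OF word_lin_ract, of "[]" c'] by (simp add: tensor_bimod_def)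

lemma ract_tword_snoc: "w \<in> L \<Longrightarrow> x \<in> gcar V \<Longrightarrow> ract T (tword V c (w @ [x])) c' = tword V c (w @ [ract V x c'])"
  using linext_tword_fscale[OF word_lin_ract, of "w @ [x]" c'] by (simp add: tensor_bimod_def)

lemma lact_tensor_add: "lact T c (x + y) = lact T c x + lact T c y"
  by (simp add: tensor_bimod_def linext_fscale_add)

lemma ract_tensor_add: "ract T (x + y) c = ract T x c + ract T y c"
  by (simp add: tensor_bimod_def linext_fscale_add)

lemma lact_tensor_0: "lact T c 0 = 0"
  by (simp add: tensor_bimod_def)

lemma ract_tensor_0: "ract T 0 c = 0"
  by (simp add: tensor_bimod_def)

text \<open>
  The part of degree \<open>n\<close> of a word whose letters have their components in the finite set \<open>J\<close>
  of degrees. Cutting off at a fixed \<open>J\<close> keeps the formula multilinear term by term; to separate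
  finitely many homogeneous elements, one finite \<open>J\<close> suffices.
\<close>

fun degpart :: "int set \<Rightarrow> int \<Rightarrow> 'k ^ 't \<Rightarrow> 'v list \<Rightarrow> 'v list \<Rightarrow> ('k, 't, 'v) words" where
  "degpart J n c p [] = (if n = 0 then tword V c p else 0)"
| "degpart J n c p (x # w) = (\<Sum>j\<in>J. degpart J (n - j) c (p @ [hcomps V x j]) w)"

lemma gcar_hcomps [simp]: "x \<in> gcar V \<Longrightarrow> hcomps V x j \<in> gcar V"
  using hcomps_props(2) gcar_gcomp by blast

lemma hcomps_lact: "x \<in> gcar V \<Longrightarrow> hcomps V (lact V c x) j = lact V c (hcomps V x j)"
proof (induction rule: gcar_induct)
  case zero
  show ?case using hcomps_homog[OF comp_zero[of 0]] by simp
next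
  case (add i x y)
  then show ?case
    by (simp add: gcar_gcomp[OF add(1)] hcomps_add lact_add_right hcomps_homog[OF add(1)]
        hcomps_homog[OF comp_lact[OF add(1)]])
qed

lemma hcomps_ract: "x \<in> gcar V \<Longrightarrow> hcomps V (ract V x c) j = ract V (hcomps V x j) c"
proof (induction rule: gcar_induct)
  case zero
  show ?case using hcomps_homog[OF comp_zero[of 0]] by simp
next
  case (add i x y)
  then show ?case
    by (simp add: gcar_gcomp[OF add(1)] hcomps_add ract_add_left hcomps_homog[OF add(1)]
        hcomps_homog[OF comp_ract[OF add(1)]])
qed

lemma multilin_degpart_prefix: "w \<in> L \<Longrightarrow> multilin V (\<lambda>p. degpart J n c p w)"
proof (induction w arbitrary: n)
  case Nil
  then show ?case by (cases "n = 0") (simp_all add: multilin_tword multilin_const)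
next
  case (Cons x w)
  have "multilin V (\<lambda>p. degpart J (n - j) c (p @ [hcomps V x j]) w)" for j
    by (rule multilin_append_right, rule Cons(1)) (use Cons(2) in simp_all)
  then show ?case by (simp add: multilin_sum)
qed

lemma multilin_degpart: "p \<in> L \<Longrightarrow> multilin V (degpart J n c p)"
proof (rule multilinI)
  fix u v x y assume "p \<in> L" "u \<in> L" "v \<in> L" "x \<in> gcar V" "y \<in> gcar V"
  then show "degpart J n c p (u @ (x + y) # v) = degpart J n c p (u @ x # v) + degpart J n c p (u @ y # v)"
  proof (induction u arbitrary: p n)
    case Nil
    then show ?case
      using multilin_add[OF multilin_degpart_prefix, of v p "[]"] by (simp add: hcomps_add sum.distrib)
  qed (simp add: sum.distrib)
next
  fix u v x y d assume "p \<in> L" "u \<in> L" "v \<in> L" "x \<in> gcar V" "y \<in> gcar V"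
  then show "degpart J n c p (u @ ract V x d # y # v) = degpart J n c p (u @ x # lact V d y # v)"
  proof (induction u arbitrary: p n)
    case Nil
    then show ?case
      using multilin_bal[OF multilin_degpart_prefix, of v p "[]"] by (simp add: hcomps_lact hcomps_ract)
  qed simp
qed

lemma degpart_c_add: "p \<in> L \<Longrightarrow> w \<in> L \<Longrightarrow> degpart J n (c + c') p w = degpart J n c p w + degpart J n c' p w"
  by (induction w arbitrary: p n) (simp_all add: tword_add sum.distrib)

lemma degpart_c_scale: "p \<in> L \<Longrightarrow> w \<in> L \<Longrightarrow> degpart J n (vec r * c) p w = fscale r (degpart J n c p w)"
  by (induction w arbitrary: p n) (simp_all add: tword_scale fspace.scale_sum_right)

lemma degpart_c_lact:
  "x \<in> gcar V \<Longrightarrow> p \<in> L \<Longrightarrow> w \<in> L \<Longrightarrow> degpart J n (c * c') (x # p) w = degpart J n c (lact V c' x # p) w"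
  by (induction w arbitrary: p n) (simp_all add: tword_lact)

lemma degpart_homog:
  assumes "finite J" "w \<in> hwords V" "fst ` set w \<subseteq> J" "p \<in> L"
  shows "degpart J n c p (map snd w) = (if n = sum_list (map fst w) then tword V c (p @ map snd w) else 0)"
  using assms(2-)
proof (induction w arbitrary: n p)
  case (Cons a w)
  obtain i x where a: "a = (i, x)" by fastforce
  then have x: "x \<in> gcomp V i" and w: "w \<in> hwords V" and i: "i \<in> J" "fst ` set w \<subseteq> J"
    using Cons(2,3) by (auto simp: hwords_def)
  note xg = gcar_gcomp[OF x]
  have "degpart J n c p (map snd (a # w)) = degpart J (n - i) c (p @ [x]) (map snd w)"
    using multilin_zero[OF multilin_degpart_prefix[OF hwords_lists[OF w]], of p "[]"] Cons(4) i(1)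
    by (simp add: a hcomps_homog[OF x] if_distrib[of "\<lambda>y. degpart _ _ _ (_ @ [y]) _"] sum.delta[OF assms(1)] cong: if_cong)
  with Cons(1)[OF w i(2), of "p @ [x]" "n - i"] Cons(4) xg show ?case
    by (auto simp: a)
qed auto

text \<open>
  For a finite set \<open>J\<close> containing the degrees of all letters that occur, \<open>degpart J\<close> is the projection
  to one degree. It kills all summands but one of a vanishing sum.
\<close>

lemma tensor_direct:
  assumes "finite I" "\<And>i. i \<in> I \<Longrightarrow> z i \<in> gcomp T i" "(\<Sum>i\<in>I. z i) = 0" "i \<in> I"
  shows "z i = 0"
proof -
  define P where "P J n = linext fscale (\<lambda>(c, w). degpart J n c [] w)" for J n
  have lin: "word_lin V fscale (\<lambda>c w. degpart J n c [] w)" for J n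
    by (rule word_linI)
      (auto simp: multilin_degpart degpart_c_add degpart_c_scale degpart_c_lact hcomps_lact
        intro!: sum.cong)
  have P: "finite J \<Longrightarrow> w \<in> hwords V \<Longrightarrow> fst ` set w \<subseteq> J \<Longrightarrow>
      P J n (tword V c (map snd w)) = (if n = sum_list (map fst w) then tword V c (map snd w) else 0)" for J n c w
    unfolding P_def by (subst linext_tword_fscale[OF lin]) (auto simp: hwords_lists degpart_homog)
  have Padd: "P J n (x + y) = P J n x + P J n y" and P0: "P J n 0 = 0" for J n x y
    by (simp_all add: P_def linext_fscale_add)
  have "\<exists>J. finite J \<and> (\<forall>J'. finite J' \<longrightarrow> J \<subseteq> J' \<longrightarrow> (\<forall>n. P J' n x = (if n = m then x else 0)))"
    if "x \<in> gcomp T m" for x m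
    using that
  proof (induction rule: gcomp_tensor_induct)
    case zero
    show ?case by (intro exI[of _ "{}"]) (simp add: P0)
  next
    case (add c w y)
    from add(4) obtain J where J: "finite J" "\<forall>J'. finite J' \<longrightarrow> J \<subseteq> J' \<longrightarrow> (\<forall>n. P J' n y = (if n = m then y else 0))"
      by (elim exE conjE)
    show ?case
    proof (intro exI[of _ "J \<union> fst ` set w"] conjI allI impI)
      fix J' n assume J': "finite J'" "J \<union> fst ` set w \<subseteq> J'"
      have "P J' n (tword V c (map snd w)) = (if n = m then tword V c (map snd w) else 0)"
        using P[OF J'(1) add(1)] J'(2) add(2) by simp
      moreover have "P J' n y = (if n = m then y else 0)"
        using J(2) J' by simp
      ultimately show "P J' n (tword V c (map snd w) + y) = (if n = m then tword V c (map snd w) + y else 0)"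
        by (simp add: Padd)
    qed (use J(1) in simp)
  qed
  then have "\<forall>i\<in>I. \<exists>J. finite J \<and> (\<forall>J'. finite J' \<longrightarrow> J \<subseteq> J' \<longrightarrow> (\<forall>n. P J' n (z i) = (if n = i then z i else 0)))"
    using assms(2) by blast
  then obtain JJ where JJ: "\<forall>i\<in>I. finite (JJ i) \<and>
      (\<forall>J'. finite J' \<longrightarrow> JJ i \<subseteq> J' \<longrightarrow> (\<forall>n. P J' n (z i) = (if n = i then z i else 0)))"
    unfolding bchoice_iff by (elim exE)
  let ?J = "\<Union>i\<in>I. JJ i"
  have fin: "finite ?J" using assms(1) JJ by (intro finite_UN_I) simp_all
  have "P J i (\<Sum>i\<in>I. z i) = (\<Sum>j\<in>I. P J i (z j))" for J
    by (induction I rule: infinite_finite_induct) (simp_all add: P0 Padd)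
  then have "P ?J i (\<Sum>i\<in>I. z i) = (\<Sum>j\<in>I. P ?J i (z j))" .
  also have "\<dots> = (\<Sum>j\<in>I. if i = j then z j else 0)"
  proof (rule sum.cong)
    fix j assume "j \<in> I"
    then have "JJ j \<subseteq> ?J" by blast
    with JJ fin \<open>j \<in> I\<close> have "P ?J i (z j) = (if i = j then z j else 0)" by simp
    then show "P ?J i (z j) = (if i = j then z j else 0)" .
  qed simp
  also have "\<dots> = z i"
    using assms(1,4) by simp
  finally show ?thesis using assms(3) by (simp add: P0)
qed

lemma tensor_comp_lact: "z \<in> gcomp T n \<Longrightarrow> lact T c z \<in> gcomp T n"
proof (induction rule: gcomp_tensor_induct)
  case zero
  then show ?case by (simp add: lact_tensor_0 gcomp_tensor fspace.span_zero)
next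
  case (add c' w y)
  then have "lact T c (tword V c' (map snd w)) \<in> gcomp T n"
    using tword_gcomp by (auto simp: lact_tword hwords_lists)
  with add(4) show ?case
    unfolding gcomp_tensor lact_tensor_add by (blast intro: fspace.span_add)
qed

lemma tensor_comp_ract: "z \<in> gcomp T n \<Longrightarrow> ract T z c \<in> gcomp T n"
proof (induction rule: gcomp_tensor_induct)
  case zero
  then show ?case by (simp add: ract_tensor_0 gcomp_tensor fspace.span_zero)
next
  case (add c' w y)
  have "ract T (tword V c' (map snd w)) c \<in> gcomp T n"
  proof (cases w rule: rev_cases)
    case Nil
    then show ?thesis using add(1,2) tword_gcomp[of "[]" "c' * c"] by (simp add: ract_tword_Nil)
  next
    case (snoc w' a)
    obtain i x where a: "a = (i, x)" by fastforce
    with snoc add(1) have x: "x \<in> gcomp V i" "w' \<in> hwords V" by (auto simp: hwords_def)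
    then have "w' @ [(i, ract V x c)] \<in> hwords V" by (auto simp: hwords_def comp_ract)
    from tword_gcomp[OF this, of c'] show ?thesis
      using snoc a x add(2) by (simp add: ract_tword_snoc gcar_gcomp[OF x(1)] hwords_lists)
  qed
  with add(4) show ?case
    unfolding gcomp_tensor ract_tensor_add by (blast intro: fspace.span_add)
qed

lemma vec_central: "w \<in> L \<Longrightarrow> ract T (tword V c w) (vec r) = fscale r (tword V c w)"
proof (cases w rule: rev_cases)
  case Nil
  then show ?thesis by (simp add: ract_tword_Nil tword_scale mult.commute[of c])
next
  case (snoc w' x)
  moreover assume "w \<in> L"
  ultimately show ?thesis
    using tword_vec[of w' "[]" x c r] by (simp add: ract_tword_snoc central)
qed

theorem graded_tensor: "graded_bimodule T"
proof
  fix i show "0 \<in> gcomp T i" by (simp add: gcomp_tensor fspace.span_zero)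
next
  fix x y i assume "x \<in> gcomp T i" "y \<in> gcomp T i"
  then show "x + y \<in> gcomp T i" unfolding gcomp_tensor by (rule fspace.span_add)
next
  fix x i assume "x \<in> gcomp T i"
  then show "- x \<in> gcomp T i" unfolding gcomp_tensor by (rule fspace.span_neg)
next
  fix I z and i :: int
  assume "finite I" "\<And>i. i \<in> I \<Longrightarrow> z i \<in> gcomp T i" "sum z I = 0" "i \<in> I"
  then show "z i = 0" by (rule tensor_direct)
next
  fix x c c' assume "x \<in> gcar T"
  then show "lact T (c + c') x = lact T c x + lact T c' x"
    by (rule gcar_tensor_eqI) (simp_all add: lact_tensor_0 lact_tensor_add lact_tword distrib_right tword_add)
next
  fix x c c' assume "x \<in> gcar T"
  then show "ract T x (c + c') = ract T x c + ract T x c'"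
  proof (rule gcar_tensor_eqI)
    fix d w assume "w \<in> L"
    then show "ract T (tword V d w) (c + c') = ract T (tword V d w) c + ract T (tword V d w) c'"
      by (cases w rule: rev_cases)
        (simp_all add: ract_tword_Nil ract_tword_snoc distrib_left tword_add ract_add_right
          tword_letter_add)
  qed (simp_all add: ract_tensor_0 ract_tensor_add)
next
  fix x c c' assume "x \<in> gcar T"
  then show "lact T (c * c') x = lact T c (lact T c' x)"
    by (rule gcar_tensor_eqI) (simp_all add: lact_tensor_0 lact_tensor_add lact_tword mult.assoc)
next
  fix x c c' assume "x \<in> gcar T"
  then show "ract T x (c * c') = ract T (ract T x c) c'"
  proof (rule gcar_tensor_eqI)
    fix d w assume "w \<in> L"
    then show "ract T (tword V d w) (c * c') = ract T (ract T (tword V d w) c) c'"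
      by (cases w rule: rev_cases) (simp_all add: ract_tword_Nil ract_tword_snoc mult.assoc ract_mult)
  qed (simp_all add: ract_tensor_0 ract_tensor_add)
next
  fix x assume "x \<in> gcar T"
  then show "lact T 1 x = x"
    by (rule gcar_tensor_eqI) (simp_all add: lact_tensor_0 lact_tensor_add lact_tword)
next
  fix x assume "x \<in> gcar T"
  then show "ract T x 1 = x"
  proof (rule gcar_tensor_eqI)
    fix d w assume "w \<in> L"
    then show "ract T (tword V d w) 1 = tword V d w"
      by (cases w rule: rev_cases) (simp_all add: ract_tword_Nil ract_tword_snoc ract_one)
  qed (simp_all add: ract_tensor_0 ract_tensor_add)
next
  fix x c c' assume "x \<in> gcar T"
  then show "ract T (lact T c x) c' = lact T c (ract T x c')"
  proof (rule gcar_tensor_eqI)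
    fix d w assume "w \<in> L"
    then show "ract T (lact T c (tword V d w)) c' = lact T c (ract T (tword V d w) c')"
      by (cases w rule: rev_cases) (simp_all add: lact_tword ract_tword_Nil ract_tword_snoc mult.assoc)
  qed (simp_all add: ract_tensor_0 ract_tensor_add lact_tensor_0 lact_tensor_add)
next
  fix x and r :: 'k assume "x \<in> gcar T"
  then show "lact T (vec r) x = ract T x (vec r)"
    by (rule gcar_tensor_eqI)
      (simp_all add: lact_tensor_0 lact_tensor_add ract_tensor_0 ract_tensor_add lact_tword tword_scale vec_central)
qed (simp_all add: tensor_comp_lact tensor_comp_ract lact_tensor_add ract_tensor_add)

lemma tensor_hom_gcar: "bimod_hom T T p f \<Longrightarrow> z \<in> gcar T \<Longrightarrow> f z \<in> gcar T"
  by (rule bimod_hom_gcar[OF graded_tensor graded_tensor])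

lemma koszul_tword:
  assumes "w \<in> L"
  shows "koszul T q (tword V c w) = tword V c (map (koszul V q) w)"
proof -
  interpret T: graded_bimodule T by (rule graded_tensor)
  show ?thesis
  proof (rule multilin_eq_on_homogeneous[OF graded_bimodule_axioms _ _ assms])
    show "multilin V (\<lambda>w. koszul T q (tword V c w))"
      by (rule multilinI)
        (simp_all add: tword_letter_add tword_letter_bal T.koszul_add)
    show "multilin V (\<lambda>w. tword V c (map (koszul V q) w))"
      by (rule multilinI)
        (simp_all add: tword_letter_add tword_letter_bal koszul_add
          koszul_lact koszul_ract)
    fix w assume "w \<in> hwords V"
    then show "koszul T q (tword V c (map snd w)) = tword V c (map (koszul V q) (map snd w))"
      using multilin_koszul[OF multilin_tword[of c], of w "[]" q]
      by (simp add: T.koszul_homog[OF tword_gcomp])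
  qed
qed

end

section \<open>Deconcatenation\<close>

text \<open>
  Sums over the ways to cut a word in two. The coproduct, coderivations and coalgebra maps are all
  expressed by this operation, and the identities between them by its recursion on the word.
\<close>

definition deconc :: "'v list \<Rightarrow> ('v list \<Rightarrow> 'v list \<Rightarrow> 'b::comm_monoid_add) \<Rightarrow> 'b" where
  "deconc w g = (\<Sum>i\<le>length w. g (take i w) (drop i w))"

lemma deconc_Nil [simp]: "deconc [] g = g [] []"
  by (simp add: deconc_def)

lemma deconc_Cons: "deconc (x # w) g = g [] (x # w) + deconc w (\<lambda>u v. g (x # u) v)"
  unfolding deconc_def by (simp add: sum.atMost_Suc_shift del: sum.atMost_Suc)

lemma deconc_cong: "(\<And>u v. u @ v = w \<Longrightarrow> g u v = g' u v) \<Longrightarrow> deconc w g = deconc w g'"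
  unfolding deconc_def by (rule sum.cong) (simp_all add: append_take_drop_id)

lemma deconc_cong_lists:
  "w \<in> lists S \<Longrightarrow> (\<And>u v. u \<in> lists S \<Longrightarrow> v \<in> lists S \<Longrightarrow> g u v = g' u v) \<Longrightarrow> deconc w g = deconc w g'"
  by (rule deconc_cong) (metis append_in_lists_conv)

lemma deconc_plus: "deconc w (\<lambda>u v. g u v + g' u v) = deconc w g + deconc w g'"
  by (simp add: deconc_def sum.distrib)

lemma deconc_zero: "(\<And>u v. u @ v = w \<Longrightarrow> g u v = 0) \<Longrightarrow> deconc w g = 0"
  unfolding deconc_def by (rule sum.neutral) (simp add: append_take_drop_id)

lemma deconc_left_Nil: "(\<And>u v. u \<noteq> [] \<Longrightarrow> u @ v = w \<Longrightarrow> g u v = 0) \<Longrightarrow> deconc w g = g [] w"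
proof (cases w)
  case (Cons x w')
  assume "\<And>u v. u \<noteq> [] \<Longrightarrow> u @ v = w \<Longrightarrow> g u v = 0"
  then have "deconc w' (\<lambda>u v. g (x # u) v) = 0" using Cons by (intro deconc_zero) simp
  then show ?thesis by (simp add: Cons deconc_Cons)
qed simp

text \<open>
  A cut of \<open>u @ y # v\<close> lies either before or after the letter \<open>y\<close>.
\<close>

lemma deconc_append_Cons:
  "deconc (u @ y # v) g = deconc u (\<lambda>a b. g a (b @ y # v)) + deconc v (\<lambda>a b. g (u @ y # a) b)"
  by (induction u arbitrary: g) (simp_all add: deconc_Cons add.assoc)

lemma deconc_snoc: "deconc (u @ [y]) g = deconc u (\<lambda>a b. g a (b @ [y])) + g (u @ [y]) []"
  by (simp add: deconc_append_Cons)

lemma deconc_right_Nil: "(\<And>u v. v \<noteq> [] \<Longrightarrow> u @ v = w \<Longrightarrow> g u v = 0) \<Longrightarrow> deconc w g = g w []"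
proof (cases w rule: rev_cases)
  case (snoc w' x)
  assume "\<And>u v. v \<noteq> [] \<Longrightarrow> u @ v = w \<Longrightarrow> g u v = 0"
  then have "deconc w' (\<lambda>u v. g u (v @ [x])) = 0" using snoc by (intro deconc_zero) simp
  then show ?thesis by (simp add: snoc deconc_snoc)
qed simp

lemma deconc_assoc:
  "deconc w (\<lambda>x v. deconc x (\<lambda>u s. g u s v)) = deconc w (\<lambda>u r. deconc r (\<lambda>s v. g u s v))"
  by (induction w arbitrary: g) (simp_all add: deconc_Cons deconc_plus add.assoc)

lemma deconc_map: "deconc (map f w) g = deconc w (\<lambda>u v. g (map f u) (map f v))"
  by (simp add: deconc_def take_map drop_map)

text \<open>
  The set \<open>Z\<close> stands for a carrier: the maps \<open>h\<close> to which this applies are additive there only.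
\<close>

lemma deconc_hom:
  assumes "w \<in> lists S" "h 0 = 0" "\<And>x y. x \<in> Z \<Longrightarrow> y \<in> Z \<Longrightarrow> h (x + y) = h x + h y"
    and "\<And>x y. x \<in> Z \<Longrightarrow> y \<in> Z \<Longrightarrow> x + y \<in> Z"
    and "\<And>u v. u \<in> lists S \<Longrightarrow> v \<in> lists S \<Longrightarrow> g u v \<in> Z"
  shows "h (deconc w g) = deconc w (\<lambda>u v. h (g u v)) \<and> deconc w g \<in> Z"
  using assms(1,5)
proof (induction w arbitrary: g)
  case (Cons x w)
  then have "h (deconc w (\<lambda>u. g (x # u))) = deconc w (\<lambda>u v. h (g (x # u) v)) \<and> deconc w (\<lambda>u. g (x # u)) \<in> Z"
    by (intro Cons(3)) auto
  moreover have "g [] (x # w) \<in> Z" using Cons by auto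
  ultimately show ?case using assms(3,4) by (simp add: deconc_Cons)
qed simp

text \<open>
  Sums over the ways to single out a subword \<open>s\<close> of \<open>u @ s @ v\<close>.
\<close>

definition deconc3 :: "'v list \<Rightarrow> ('v list \<Rightarrow> 'v list \<Rightarrow> 'v list \<Rightarrow> 'b::comm_monoid_add) \<Rightarrow> 'b" where
  "deconc3 w g = deconc w (\<lambda>u r. deconc r (g u))"

lemma deconc3_plus: "deconc3 w (\<lambda>u s v. g u s v + h u s v) = deconc3 w g + deconc3 w h"
  by (simp add: deconc3_def deconc_plus)

lemma deconc3_cong: "(\<And>u s v. u @ s @ v = w \<Longrightarrow> g u s v = h u s v) \<Longrightarrow> deconc3 w g = deconc3 w h"
  unfolding deconc3_def by (intro deconc_cong) simp

lemma deconc3_zero: "(\<And>u s v. u @ s @ v = w \<Longrightarrow> g u s v = 0) \<Longrightarrow> deconc3 w g = 0"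
  unfolding deconc3_def by (intro deconc_zero) simp

lemma deconc3_map: "deconc3 (map f w) g = deconc3 w (\<lambda>u s v. g (map f u) (map f s) (map f v))"
  by (simp add: deconc3_def deconc_map)

text \<open>
  The bar differential takes at most two letters; if a subword is contracted to one letter first, at
  most one other letter can remain.
\<close>

lemma deconc3_two:
  assumes "\<And>u s v. length u + length v > 1 \<Longrightarrow> g u s v = 0" and "w \<noteq> []"
  shows "deconc3 w g = g [] w [] + g [] (butlast w) [last w] + g [hd w] (tl w) []"
proof -
  obtain x v where w: "w = x # v" using assms(2) by (cases w) auto
  have "deconc v (\<lambda>u r. deconc r (g (x # u))) = deconc v (g [x])"
    by (rule deconc_left_Nil) (auto intro!: deconc_zero assms(1) simp: Suc_lessI)
  also have "\<dots> = g [x] v []"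
    by (rule deconc_right_Nil) (auto intro!: assms(1))
  finally have 1: "deconc v (\<lambda>u r. deconc r (g (x # u))) = g [x] v []" .
  obtain p y where p: "w = p @ [y]" using assms(2) by (cases w rule: rev_cases) auto
  have "deconc p (\<lambda>a b. g [] a (b @ [y])) = g [] p [y]"
    by (subst deconc_right_Nil) (auto intro!: assms(1))
  then have 2: "deconc w (g []) = g [] w [] + g [] (butlast w) [last w]"
    unfolding p deconc_snoc by (simp add: add.commute)
  show ?thesis
    using 1 2 by (simp add: deconc3_def w deconc_Cons add.assoc)
qed

lemma deconc_short:
  assumes "\<And>s v. s @ v = r \<Longrightarrow> length s \<noteq> 1 \<Longrightarrow> length s \<noteq> 2 \<Longrightarrow> h s v = 0"
  shows "deconc r h = (if r = [] then 0 else h [hd r] (tl r)) + (if length r < 2 then 0 else h (take 2 r) (drop 2 r))"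
proof (cases r)
  case (Cons x v)
  show ?thesis
  proof (cases v)
    case Nil
    with Cons show ?thesis by (simp add: deconc_Cons assms)
  next
    case (Cons y w)
    have "deconc w (\<lambda>s v. h (x # y # s) v) = h [x, y] w"
      by (rule deconc_left_Nil) (use Cons \<open>r = x # v\<close> in \<open>auto intro!: assms\<close>)
    then show ?thesis
      using Cons \<open>r = x # v\<close> by (simp add: deconc_Cons assms numeral_2_eq_2)
  qed
qed (simp add: assms)

lemma lists_parts:
  assumes "w \<in> lists S" "w \<noteq> []"
  shows "hd w \<in> S \<and> tl w \<in> lists S \<and> last w \<in> S \<and> butlast w \<in> lists S"
  using assms by (auto simp: in_lists_conv_set dest: in_set_butlastD list.set_sel(2))

text \<open>
  The last condition is the balancing between the two letters next to the cut; with it, the sum over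
  all cuts is multilinear in the whole word.
\<close>

definition multilin2 :: "('k::field, 't::finite, 'v::ab_group_add, 'z) gbimod_scheme
    \<Rightarrow> ('v list \<Rightarrow> 'v list \<Rightarrow> 'b::ab_group_add) \<Rightarrow> bool" where
  "multilin2 V g \<longleftrightarrow> (\<forall>a\<in>lists (gcar V). multilin V (g a)) \<and>
    (\<forall>b\<in>lists (gcar V). multilin V (\<lambda>a. g a b)) \<and>
    (\<forall>a\<in>lists (gcar V). \<forall>b\<in>lists (gcar V). \<forall>x\<in>gcar V. \<forall>y\<in>gcar V. \<forall>c.
       g (a @ [ract V x c]) (y # b) = g (a @ [x]) (lact V c y # b))"

lemma multilin2I:
  assumes "\<And>a. a \<in> lists (gcar V) \<Longrightarrow> multilin V (g a)"
    and "\<And>b. b \<in> lists (gcar V) \<Longrightarrow> multilin V (\<lambda>a. g a b)"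
    and "\<And>a b x y c. a \<in> lists (gcar V) \<Longrightarrow> b \<in> lists (gcar V) \<Longrightarrow> x \<in> gcar V \<Longrightarrow> y \<in> gcar V \<Longrightarrow>
       g (a @ [ract V x c]) (y # b) = g (a @ [x]) (lact V c y # b)"
  shows "multilin2 V g"
  using assms unfolding multilin2_def by blast

context graded_bimodule
begin

lemma multilin_deconc:
  assumes "multilin2 V g"
  shows "multilin V (\<lambda>w. deconc w g)"
proof (rule multilinI)
  have 1: "multilin V (g a)" and 2: "multilin V (\<lambda>b. g b a)" if "a \<in> L" for a
    using assms that unfolding multilin2_def by blast+
  {
    fix u v x y assume *: "u \<in> L" "v \<in> L" "x \<in> gcar V" "y \<in> gcar V"
    show "deconc (u @ (x + y) # v) g = deconc (u @ x # v) g + deconc (u @ y # v) g"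
    proof -
      have "deconc u (\<lambda>a b. g a (b @ (x + y) # v)) = deconc u (\<lambda>a b. g a (b @ x # v) + g a (b @ y # v))"
        by (rule deconc_cong_lists[OF *(1)]) (use * in \<open>simp add: multilin_add[OF 1]\<close>)
      moreover have "deconc v (\<lambda>a b. g (u @ (x + y) # a) b) = deconc v (\<lambda>a b. g (u @ x # a) b + g (u @ y # a) b)"
        by (rule deconc_cong_lists[OF *(2)]) (use * in \<open>simp add: multilin_add[OF 2]\<close>)
      ultimately show ?thesis
        by (simp add: deconc_append_Cons deconc_plus)
    qed
  next
    fix u v x y c assume *: "u \<in> L" "v \<in> L" "x \<in> gcar V" "y \<in> gcar V"
    show "deconc (u @ ract V x c # y # v) g = deconc (u @ x # lact V c y # v) g"
    proof -
      have "deconc u (\<lambda>a b. g a (b @ ract V x c # y # v)) = deconc u (\<lambda>a b. g a (b @ x # lact V c y # v))"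
        by (rule deconc_cong_lists[OF *(1)]) (use * in \<open>simp add: multilin_bal[OF 1]\<close>)
      moreover have "deconc v (\<lambda>a b. g (u @ ract V x c # y # a) b) = deconc v (\<lambda>a b. g (u @ x # lact V c y # a) b)"
        by (rule deconc_cong_lists[OF *(2)]) (use * in \<open>simp add: multilin_bal[OF 2]\<close>)
      moreover have "g (u @ [ract V x c]) (y # v) = g (u @ [x]) (lact V c y # v)"
        using assms * unfolding multilin2_def by blast
      ultimately show ?thesis
        by (simp add: deconc_append_Cons deconc_Cons)
    qed
  }
qed

end

section \<open>Tensor products\<close>

definition bilin :: "('k::field, 't::finite, 'v::ab_group_add, 'z) gbimod_scheme
    \<Rightarrow> ('k, 't, 'w::ab_group_add, 'y) gbimod_scheme \<Rightarrow> ('k \<Rightarrow> 'b::ab_group_add \<Rightarrow> 'b) \<Rightarrow> ('v \<Rightarrow> 'w \<Rightarrow> 'b) \<Rightarrow> bool" where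
  "bilin V W sc \<phi> \<longleftrightarrow>
    (\<forall>x\<in>gcar V. \<forall>x'\<in>gcar V. \<forall>y\<in>gcar W. \<phi> (x + x') y = \<phi> x y + \<phi> x' y) \<and>
    (\<forall>x\<in>gcar V. \<forall>y\<in>gcar W. \<forall>y'\<in>gcar W. \<phi> x (y + y') = \<phi> x y + \<phi> x y') \<and>
    (\<forall>r. \<forall>x\<in>gcar V. \<forall>y\<in>gcar W. \<phi> (lact V (vec r) x) y = sc r (\<phi> x y)) \<and>
    (\<forall>c. \<forall>x\<in>gcar V. \<forall>y\<in>gcar W. \<phi> (ract V x c) y = \<phi> x (lact W c y))"

lemma bilinI:
  assumes "\<And>x x' y. x \<in> gcar V \<Longrightarrow> x' \<in> gcar V \<Longrightarrow> y \<in> gcar W \<Longrightarrow> \<phi> (x + x') y = \<phi> x y + \<phi> x' y"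
    and "\<And>x y y'. x \<in> gcar V \<Longrightarrow> y \<in> gcar W \<Longrightarrow> y' \<in> gcar W \<Longrightarrow> \<phi> x (y + y') = \<phi> x y + \<phi> x y'"
    and "\<And>r x y. x \<in> gcar V \<Longrightarrow> y \<in> gcar W \<Longrightarrow> \<phi> (lact V (vec r) x) y = sc r (\<phi> x y)"
    and "\<And>c x y. x \<in> gcar V \<Longrightarrow> y \<in> gcar W \<Longrightarrow> \<phi> (ract V x c) y = \<phi> x (lact W c y)"
  shows "bilin V W sc \<phi>"
  using assms unfolding bilin_def by blast

lemma linext_pure_tensor:
  assumes sc: "scaling sc UNIV" and \<phi>: "bilin V W sc \<phi>" and xy: "x \<in> gcar V" "y \<in> gcar W"
  shows "linext sc (\<lambda>(x, y). \<phi> x y) (pure_tensor V W x y) = \<phi> x y"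
proof -
  interpret scaling sc UNIV by (rule sc)
  let ?l = "linext sc (\<lambda>(x, y). \<phi> x y)" and ?e = "\<lambda>x y. Poly_Mapping.single (x, y) 1"
  have e: "?l (?e x y) = \<phi> x y" for x y
    by (subst linext_single) (auto simp: sc_one)
  have d: "?l (p - q) = ?l p - ?l q" for p q
    by (rule linext_diff[of _ UNIV]) auto
  have f: "?l (fscale r p) = sc r (?l p)" for r p
    by (rule linext_fscale[of _ UNIV]) auto
  have "?l r = 0" if "r \<in> tensor_rels V W" for r
    using that unfolding tensor_rels_def Let_def
  proof (elim UnE CollectE exE conjE, goal_cases)
    case 1 then show ?case using \<phi> by (simp add: d e bilin_def)
  next
    case 2 then show ?case using \<phi> by (simp add: d e bilin_def)
  next
    case 3 then show ?case using \<phi> by (simp add: d e f bilin_def)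
  next
    case 4 then show ?case using \<phi> by (simp add: d e bilin_def)
  qed
  then have "?l (pure_tensor V W x y) = ?l (?e x y)"
    unfolding pure_tensor_def by (intro linext_quot_proj[of _ UNIV, THEN conjunct2]) auto
  then show ?thesis by (simp add: e)
qed

lemma bilin_pure_tensor: "bilin V W fscale (pure_tensor V W)"
proof (rule bilinI)
  fix x x' y assume *: "x \<in> gcar V" "x' \<in> gcar V" "y \<in> gcar W"
  show "pure_tensor V W (x + x') y = pure_tensor V W x y + pure_tensor V W x' y"
    unfolding pure_tensor_def quot_proj_add[symmetric] quot_proj_eq_iff
    by (rule fspace.span_base, unfold diff_diff_eq[symmetric] tensor_rels_def Let_def,
        rule UnI1, rule UnI1, rule UnI1) (use * in blast)
next
  fix x y y' assume *: "x \<in> gcar V" "y \<in> gcar W" "y' \<in> gcar W"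
  show "pure_tensor V W x (y + y') = pure_tensor V W x y + pure_tensor V W x y'"
    unfolding pure_tensor_def quot_proj_add[symmetric] quot_proj_eq_iff
    by (rule fspace.span_base, unfold diff_diff_eq[symmetric] tensor_rels_def Let_def,
        rule UnI1, rule UnI1, rule UnI2) (use * in blast)
next
  fix r x y assume *: "x \<in> gcar V" "y \<in> gcar W"
  show "pure_tensor V W (lact V (vec r) x) y = fscale r (pure_tensor V W x y)"
    unfolding pure_tensor_def quot_proj_fscale[symmetric] quot_proj_eq_iff
    by (rule fspace.span_base, unfold tensor_rels_def Let_def, rule UnI1, rule UnI2) (use * in blast)
next
  fix c x y assume *: "x \<in> gcar V" "y \<in> gcar W"
  show "pure_tensor V W (ract V x c) y = pure_tensor V W x (lact W c y)"
    unfolding pure_tensor_def quot_proj_eq_iff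
    by (rule fspace.span_base, unfold tensor_rels_def Let_def, rule UnI2) (use * in blast)
qed

lemmas bilinD = bilin_def[THEN iffD1, THEN conjunct1, rule_format]
  bilin_def[THEN iffD1, THEN conjunct2, THEN conjunct1, rule_format]
  bilin_def[THEN iffD1, THEN conjunct2, THEN conjunct2, THEN conjunct1, rule_format]
  bilin_def[THEN iffD1, THEN conjunct2, THEN conjunct2, THEN conjunct2, rule_format]

lemmas pure_tensor_add_left = bilinD(1)[OF bilin_pure_tensor]
  and pure_tensor_add_right = bilinD(2)[OF bilin_pure_tensor]
  and pure_tensor_scale = bilinD(3)[OF bilin_pure_tensor]
  and pure_tensor_bal = bilinD(4)[OF bilin_pure_tensor]

lemma tensor_map_pure:
  assumes "graded_bimodule V" "graded_bimodule W" "graded_bimodule V'" "graded_bimodule W'"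
    and f: "bimod_hom V V' p f" and g: "bimod_hom W W' p' g" and xy: "x \<in> gcar V" "y \<in> gcar W"
  shows "tensor_map V V' W' q f g (pure_tensor V W x y) = pure_tensor V' W' (f (koszul V q x)) (g y)"
proof -
  interpret V: graded_bimodule V by fact
  interpret W: graded_bimodule W by fact
  have [simp]: "x \<in> gcar V \<Longrightarrow> f x \<in> gcar V'" "y \<in> gcar W \<Longrightarrow> g y \<in> gcar W'" for x y
    using bimod_hom_gcar[OF assms(1,3) f] bimod_hom_gcar[OF assms(2,4) g] by auto
  have "bilin V W fscale (\<lambda>x y. pure_tensor V' W' (f (koszul V q x)) (g y))"
    by (rule bilinI)
      (simp_all add: V.koszul_add V.koszul_lact V.koszul_ract bimod_homD[OF f] bimod_homD[OF g]
        pure_tensor_add_left pure_tensor_add_right pure_tensor_scale pure_tensor_bal)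
  from linext_pure_tensor[OF fscale.scaling_axioms this xy] show ?thesis
    unfolding tensor_map_def .
qed

lemma tensor_map_add: "tensor_map V V' W' q f g (s + t) = tensor_map V V' W' q f g s + tensor_map V V' W' q f g t"
  unfolding tensor_map_def by (rule fscale.linext_add[of _ UNIV]) auto

lemma tensor_map_0 [simp]: "tensor_map V V' W' q f g 0 = 0"
  by (simp add: tensor_map_def linext_def)

text \<open>
  The sums of pure tensors of carrier elements. Coproducts lie in this set, and additive maps are
  compared on it by comparing them on pure tensors.
\<close>

inductive_set tensors :: "('k::field, 't::finite, 'v::ab_group_add, 'z) gbimod_scheme
    \<Rightarrow> ('k, 't, 'w::ab_group_add, 'y) gbimod_scheme \<Rightarrow> (('v \<times> 'w) \<Rightarrow>\<^sub>0 'k) set" for V W where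
  tensors_0: "0 \<in> tensors V W"
| tensors_step: "x \<in> gcar V \<Longrightarrow> y \<in> gcar W \<Longrightarrow> s \<in> tensors V W \<Longrightarrow> pure_tensor V W x y + s \<in> tensors V W"

lemma tensors_add: "s \<in> tensors V W \<Longrightarrow> t \<in> tensors V W \<Longrightarrow> s + t \<in> tensors V W"
  by (induction rule: tensors.induct) (auto simp: add.assoc intro: tensors.intros)

lemma tensors_pure: "x \<in> gcar V \<Longrightarrow> y \<in> gcar W \<Longrightarrow> pure_tensor V W x y \<in> tensors V W"
  using tensors_step[OF _ _ tensors_0, of x V y W] by simp

lemma tensors_eqI:
  assumes "s \<in> tensors V W" "f 0 = 0" "g 0 = 0"
    and "\<And>s t. f (s + t) = f s + f t" "\<And>s t. g (s + t) = g s + g t"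
    and "\<And>x y. x \<in> gcar V \<Longrightarrow> y \<in> gcar W \<Longrightarrow> f (pure_tensor V W x y) = g (pure_tensor V W x y)"
  shows "f s = g s"
  using assms(1) by (induction rule: tensors.induct) (simp_all add: assms)

section \<open>Deconcatenation coproduct and rigidity\<close>

lemma scaling_vec: "scaling (\<lambda>(r::'k::field) (c::'k ^ 't::finite). vec r * c) UNIV"
  by unfold_locales (auto simp: vec_eq_iff algebra_simps)

lemma tensor_coalg_sel [simp]:
  "gcomp (tensor_coalg V) = gcomp (tensor_bimod V)"
  "lact (tensor_coalg V) = lact (tensor_bimod V)"
  "ract (tensor_coalg V) = ract (tensor_bimod V)"
  "coaug (tensor_coalg V) = (\<lambda>c. tword V c [])"
  by (simp_all add: tensor_coalg_def gbimod.defs)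

context graded_bimodule
begin

abbreviation "\<Delta> \<equiv> comult (tensor_coalg V)"
abbreviation "\<epsilon> \<equiv> counit (tensor_coalg V)"

lemma word_lin_comult: "word_lin V fscale (\<lambda>c w. deconc w (\<lambda>u v. pure_tensor T T (tword V c u) (tword V 1 v)))"
  (is "word_lin V fscale (\<lambda>c w. deconc w (?g c))")
proof (rule word_linI)
  fix c
  show "multilin V (\<lambda>w. deconc w (?g c))"
  proof (rule multilin_deconc, rule multilin2I)
    fix a assume a: "a \<in> L"
    show "multilin V (?g c a)" "multilin V (\<lambda>u. ?g c u a)"
      by (rule multilinI;
          simp add: a tword_letter_add tword_letter_bal pure_tensor_add_left pure_tensor_add_right)+
  next
    fix a b x y d assume "a \<in> L" "b \<in> L" "x \<in> gcar V" "y \<in> gcar V"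
    then show "?g c (a @ [ract V x d]) (y # b) = ?g c (a @ [x]) (lact V d y # b)"
      using tword_lact[of b y 1 d]
      by (simp add: ract_tword_snoc[symmetric] pure_tensor_bal lact_tword)
  qed
next
  fix c c' w assume w: "w \<in> L"
  show "deconc w (?g (c + c')) = deconc w (?g c) + deconc w (?g c')"
    unfolding deconc_plus[symmetric]
    by (rule deconc_cong_lists[OF w]) (simp add: tword_add pure_tensor_add_left)
next
  fix r c w assume w: "w \<in> L"
  have "fscale r (deconc w (?g c)) = deconc w (\<lambda>u v. fscale r (?g c u v))"
    unfolding deconc_def by (rule fspace.scale_sum_right)
  also have "\<dots> = deconc w (?g (vec r * c))"
    by (rule deconc_cong_lists[OF w]) (simp add: lact_tword[symmetric] pure_tensor_scale)
  finally show "deconc w (?g (vec r * c)) = fscale r (deconc w (?g c))" ..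
next
  fix c c' x w assume *: "x \<in> gcar V" "w \<in> L"
  have "?g (c * c') [] (x # w) = ?g c [] (lact V c' x # w)"
    using * tword_lact[of w x 1 c'] by (simp add: ract_tword_Nil[symmetric] pure_tensor_bal lact_tword)
  moreover have "deconc w (\<lambda>u. ?g (c * c') (x # u)) = deconc w (\<lambda>u. ?g c (lact V c' x # u))"
    by (rule deconc_cong_lists[OF *(2)]) (use * in \<open>simp add: tword_lact\<close>)
  ultimately show "deconc (x # w) (?g (c * c')) = deconc (lact V c' x # w) (?g c)"
    by (simp add: deconc_Cons)
qed

lemma comult_eq: "\<Delta> = linext fscale (\<lambda>(c, w). deconc w (\<lambda>u v. pure_tensor T T (tword V c u) (tword V 1 v)))"
  by (simp add: tensor_coalg_def gbimod.defs deconc_def)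

lemma comult_tword: "w \<in> L \<Longrightarrow> \<Delta> (tword V c w) = deconc w (\<lambda>u v. pure_tensor T T (tword V c u) (tword V 1 v))"
  unfolding comult_eq by (rule linext_tword_fscale[OF word_lin_comult])

lemma comult_add: "\<Delta> (x + y) = \<Delta> x + \<Delta> y"
  unfolding comult_eq by (rule linext_fscale_add)

lemma comult_0 [simp]: "\<Delta> 0 = 0"
  by (simp add: comult_eq)

lemma deconc_tensors:
  assumes "w \<in> L" "\<And>u v. u \<in> L \<Longrightarrow> v \<in> L \<Longrightarrow> g u v \<in> tensors T T"
  shows "deconc w g \<in> tensors T T"
  using deconc_hom[OF assms(1), of id "tensors T T" g] assms(2) tensors_add[where V=T and W=T] by auto

lemma comult_tensors: "z \<in> gcar T \<Longrightarrow> \<Delta> z \<in> tensors T T"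
proof (induction rule: gcar_tensor_induct)
  case (tword c w)
  then show ?case
    using hwords_lists[OF tword] by (simp add: comult_tword deconc_tensors tensors_pure)
qed (simp_all add: tensors_0 tensors_add comult_add)

lemma word_lin_counit: "word_lin V (\<lambda>r c. vec r * c) (\<lambda>c w. if w = [] then c else 0)"
  by (rule word_linI) (auto simp: multilin_def)

lemma counit_tword: "w \<in> L \<Longrightarrow> \<epsilon> (tword V c w) = (if w = [] then c else 0)"
  using linext_tword[OF scaling_vec word_lin_counit UNIV_I, of w c] by (simp add: tensor_coalg_def gbimod.defs)

lemma counit_add: "\<epsilon> (x + y) = \<epsilon> x + \<epsilon> y"
  using scaling.linext_add[OF scaling_vec, of _ UNIV x y] by (simp add: tensor_coalg_def gbimod.defs)

lemma counit_0 [simp]: "\<epsilon> 0 = 0"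
  by (simp add: tensor_coalg_def gbimod.defs)

lemma counit_lact: "z \<in> gcar T \<Longrightarrow> \<epsilon> (lact T c z) = c * \<epsilon> z"
  by (rule gcar_tensor_eqI)
    (simp_all add: lact_tensor_0 lact_tensor_add counit_add distrib_left lact_tword counit_tword)

lemma counit_ract: "z \<in> gcar T \<Longrightarrow> \<epsilon> (ract T z c) = \<epsilon> z * c"
proof (rule gcar_tensor_eqI)
  fix d w assume "w \<in> L"
  then show "\<epsilon> (ract T (tword V d w) c) = \<epsilon> (tword V d w) * c"
    by (cases w rule: rev_cases) (simp_all add: ract_tword_Nil ract_tword_snoc counit_tword)
qed (simp_all add: ract_tensor_0 ract_tensor_add counit_add distrib_right)

lemma scaling_V: "scaling (\<lambda>r. lact V (vec r)) (gcar V)"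
proof
  fix r s :: 'k and x assume x: "x \<in> gcar V"
  have "vec (r + s) = (vec r + vec s :: 'k ^ 't)" "vec (r * s) = (vec r * vec s :: 'k ^ 't)"
    by (simp_all add: vec_eq_iff)
  with x show "lact V (vec (r + s)) x = lact V (vec r) x + lact V (vec s) x"
    "lact V (vec (r * s)) x = lact V (vec r) (lact V (vec s) x)"
    by (simp_all add: lact_add_left lact_mult)
next
  fix x assume "x \<in> gcar V"
  moreover have "(vec 1 :: 'k ^ 't) = 1" by (simp add: vec_eq_iff)
  ultimately show "lact V (vec 1) x = x" by (simp add: lact_one)
qed (simp_all add: lact_add_right)

lemma word_lin_tproj: "word_lin V (\<lambda>r. lact V (vec r)) (\<lambda>c w. case w of [x] \<Rightarrow> lact V c x | _ \<Rightarrow> 0)"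
proof (rule word_linI)
  fix c show "multilin V (\<lambda>w. case w of [x] \<Rightarrow> lact V c x | _ \<Rightarrow> 0)"
    by (rule multilinI; case_tac u; case_tac v) (auto simp: lact_add_right split: list.split)
qed (auto simp: lact_add_left lact_mult split: list.split)

lemma gcar_case: "w \<in> L \<Longrightarrow> (case w of [x] \<Rightarrow> lact V c x | _ \<Rightarrow> 0) \<in> gcar V"
  by (auto split: list.split)

lemma tproj_eq: "tproj V = linext (\<lambda>r. lact V (vec r)) (\<lambda>(c, w). case w of [x] \<Rightarrow> lact V c x | _ \<Rightarrow> 0)"
  by (simp add: tproj_def)

lemma tproj_tword: "w \<in> L \<Longrightarrow> tproj V (tword V c w) = (case w of [x] \<Rightarrow> lact V c x | _ \<Rightarrow> 0)"
  unfolding tproj_eq by (rule linext_tword[OF scaling_V word_lin_tproj gcar_case])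

lemma tproj_add: "x \<in> gcar T \<Longrightarrow> y \<in> gcar T \<Longrightarrow> tproj V (x + y) = tproj V x + tproj V y"
  unfolding tproj_eq by (rule linext_gcar_add[OF scaling_V gcar_case])

lemma tproj_0 [simp]: "tproj V 0 = 0"
  by (simp add: tproj_eq)

lemma tproj_gcar [simp]: "z \<in> gcar T \<Longrightarrow> tproj V z \<in> gcar V"
  unfolding tproj_eq by (rule scaling.linext_in_B[OF scaling_V _ gcar_tensor_keys]) (use gcar_case in auto)

lemma tproj_lact: "z \<in> gcar T \<Longrightarrow> tproj V (lact T c z) = lact V c (tproj V z)"
proof (induction rule: gcar_tensor_induct)
  case (add x y)
  interpret T: graded_bimodule T by (rule graded_tensor)
  from add show ?case by (simp add: lact_tensor_add tproj_add lact_add_right)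
next
  case (tword d w)
  from hwords_lists[OF this] show ?case
    by (simp add: lact_tword tproj_tword split: list.split) (auto simp: lact_mult Cons_in_lists_iff)
qed (simp add: lact_tensor_0)

lemma tproj_ract: "z \<in> gcar T \<Longrightarrow> tproj V (ract T z c) = ract V (tproj V z) c"
proof (induction rule: gcar_tensor_induct)
  case (add x y)
  interpret T: graded_bimodule T by (rule graded_tensor)
  from add show ?case by (simp add: ract_tensor_add tproj_add ract_add_left)
next
  case (tword d w)
  from hwords_lists[OF this] show ?case
    by (cases "map snd w" rule: rev_cases)
      (auto simp: ract_tword_Nil ract_tword_snoc tproj_tword lact_ract split: list.split)
qed (simp add: ract_tensor_0)

text \<open>
  Multiplication by a letter on the left in the tensor algebra. The coefficient of the word acts on
  the letter that follows, or on \<open>x\<close> itself if there is none.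
\<close>

definition tcons :: "'v \<Rightarrow> ('k, 't, 'v) words \<Rightarrow> ('k, 't, 'v) words" where
  "tcons x = linext fscale (\<lambda>(c, w). tword V 1 (case w of [] \<Rightarrow> [ract V x c] | y # v \<Rightarrow> x # lact V c y # v))"

lemma word_lin_tcons:
  assumes x: "x \<in> gcar V"
  shows "word_lin V fscale (\<lambda>c w. tword V 1 (case w of [] \<Rightarrow> [ract V x c] | y # v \<Rightarrow> x # lact V c y # v))"
    (is "word_lin V fscale ?\<phi>")
proof (rule word_linI)
  show "multilin V (?\<phi> c)" for c
  proof (rule multilinI)
    fix u v y z assume *: "u \<in> L" "v \<in> L" "y \<in> gcar V" "z \<in> gcar V"
    then show "?\<phi> c (u @ (y + z) # v) = ?\<phi> c (u @ y # v) + ?\<phi> c (u @ z # v)"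
      using x tword_letter_add[of "[x]" v] tword_letter_add[of "x # lact V c (hd u) # tl u" v]
      by (cases u) (simp_all add: lact_add_right)
    show "?\<phi> c (u @ ract V y d # z # v) = ?\<phi> c (u @ y # lact V d z # v)" for d
      using * x tword_letter_bal[of "[x]" v] tword_letter_bal[of "x # lact V c (hd u) # tl u" v]
      by (cases u) (simp_all add: lact_ract[symmetric])
  qed
next
  fix c c' w assume "w \<in> L"
  then show "?\<phi> (c + c') w = ?\<phi> c w + ?\<phi> c' w"
    using x tword_letter_add[of "[]" "[]"] tword_letter_add[of "[x]" "tl w"]
    by (cases w) (simp_all add: ract_add_right lact_add_left)
next
  fix r c w assume "w \<in> L"
  moreover have "ract V x (vec r * c) = lact V (vec r) (ract V x c)"
    using x by (simp add: mult.commute[of "vec r"] ract_mult central)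
  ultimately show "?\<phi> (vec r * c) w = fscale r (?\<phi> c w)"
    using x tword_vec[of "[]" "[]"] tword_vec[of "[x]" "tl w"]
    by (cases w) (simp_all add: lact_mult)
next
  fix c c' y w assume "y \<in> gcar V" "w \<in> L"
  then show "?\<phi> (c * c') (y # w) = ?\<phi> c (lact V c' y # w)"
    by (simp add: lact_mult)
qed

lemma tcons_tword_Nil: "x \<in> gcar V \<Longrightarrow> tcons x (tword V c []) = tword V 1 [ract V x c]"
  unfolding tcons_def using linext_tword_fscale[OF word_lin_tcons, of x "[]" c] by simp

lemma tcons_tword_Cons:
  "x \<in> gcar V \<Longrightarrow> y \<in> gcar V \<Longrightarrow> w \<in> L \<Longrightarrow> tcons x (tword V c (y # w)) = tword V 1 (x # lact V c y # w)"
  unfolding tcons_def using linext_tword_fscale[OF word_lin_tcons, of x "y # w" c] by simp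

lemma tcons_tword_1: "x \<in> gcar V \<Longrightarrow> w \<in> L \<Longrightarrow> tcons x (tword V 1 w) = tword V 1 (x # w)"
  by (cases w) (simp_all add: tcons_tword_Nil tcons_tword_Cons ract_one lact_one)

lemma tcons_add_right: "tcons x (y + z) = tcons x y + tcons x z"
  unfolding tcons_def by (rule linext_fscale_add)

lemma tcons_0_right [simp]: "tcons x 0 = 0"
  by (simp add: tcons_def)

lemma tcons_add_left: "z \<in> gcar T \<Longrightarrow> x \<in> gcar V \<Longrightarrow> y \<in> gcar V \<Longrightarrow> tcons (x + y) z = tcons x z + tcons y z"
proof (rule gcar_tensor_eqI[where z = z])
  fix c w assume *: "w \<in> L" "x \<in> gcar V" "y \<in> gcar V"
  then show "tcons (x + y) (tword V c w) = tcons x (tword V c w) + tcons y (tword V c w)"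
    using tword_letter_add[of "[]"]
    by (cases w) (simp_all add: tcons_tword_Nil tcons_tword_Cons ract_add_left)
qed (simp_all add: tcons_add_right)

lemma tcons_0_left [simp]: "z \<in> gcar T \<Longrightarrow> tcons 0 z = 0"
  using tcons_add_left[of z 0 0] by simp

lemma bilin_tcons: "bilin T T fscale (\<lambda>a b. tcons (tproj V a) b)"
proof (rule bilinI)
  fix r a b assume a: "a \<in> gcar T" and b: "b \<in> gcar T"
  have "tcons (lact V (vec r) x) b = fscale r (tcons x b)" if x: "x \<in> gcar V" for x
    using b
  proof (rule gcar_tensor_eqI)
    fix c w assume w: "w \<in> L"
    show "tcons (lact V (vec r) x) (tword V c w) = fscale r (tcons x (tword V c w))"
      using x w tword_vec[of "[]"]
      by (cases w) (simp_all add: tcons_tword_Nil tcons_tword_Cons lact_ract)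
  qed (simp_all add: tcons_add_right fspace.scale_right_distrib)
  then show "tcons (tproj V (lact T (vec r) a)) b = fscale r (tcons (tproj V a) b)"
    using a by (simp add: tproj_lact)
next
  fix c a b assume a: "a \<in> gcar T" and b: "b \<in> gcar T"
  have "tcons (ract V x c) b = tcons x (lact T c b)" if x: "x \<in> gcar V" for x
    using b
  proof (rule gcar_tensor_eqI)
    fix d w assume w: "w \<in> L"
    show "tcons (ract V x c) (tword V d w) = tcons x (lact T c (tword V d w))"
      using x w tword_letter_bal[of "[]"]
      by (cases w) (simp_all add: tcons_tword_Nil tcons_tword_Cons lact_tword ract_mult lact_mult)
  qed (simp_all add: tcons_add_right lact_tensor_add lact_tensor_0)
  then show "tcons (tproj V (ract T a c)) b = tcons (tproj V a) (lact T c b)"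
    using a by (simp add: tproj_ract)
qed (simp_all add: tcons_add_left tcons_add_right tproj_add)

definition glue :: "(('k, 't, 'v) words \<times> ('k, 't, 'v) words \<Rightarrow>\<^sub>0 'k) \<Rightarrow> ('k, 't, 'v) words" where
  "glue = linext fscale (\<lambda>(a, b). tcons (tproj V a) b)"

lemma glue_pure: "a \<in> gcar T \<Longrightarrow> b \<in> gcar T \<Longrightarrow> glue (pure_tensor T T a b) = tcons (tproj V a) b"
  unfolding glue_def by (rule linext_pure_tensor[OF fscale.scaling_axioms bilin_tcons])

lemma glue_add: "glue (s + t) = glue s + glue t"
  unfolding glue_def by (rule linext_fscale_add)

lemma glue_0 [simp]: "glue 0 = 0"
  by (simp add: glue_def)

lemma glue_deconc:
  assumes "w \<in> L" "\<And>u. u \<in> L \<Longrightarrow> A u \<in> gcar T" "\<And>v. v \<in> L \<Longrightarrow> B v \<in> gcar T"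
  shows "glue (deconc w (\<lambda>u v. pure_tensor T T (A u) (B v))) = deconc w (\<lambda>u v. tcons (tproj V (A u)) (B v))"
proof -
  have "glue (deconc w (\<lambda>u v. pure_tensor T T (A u) (B v))) = deconc w (\<lambda>u v. glue (pure_tensor T T (A u) (B v)))"
    using deconc_hom[OF assms(1), of glue UNIV] by (simp add: glue_add)
  also have "\<dots> = deconc w (\<lambda>u v. tcons (tproj V (A u)) (B v))"
    by (rule deconc_cong_lists[OF assms(1)]) (simp add: glue_pure assms)
  finally show ?thesis .
qed

text \<open>
  Splitting off the first letter and gluing it back: on the augmentation coideal, \<open>glue\<close> is a
  left inverse of the coproduct. An element of the tensor coalgebra can therefore be
  recovered from its coproduct and its counit.
\<close>

lemma counit_glue_decomposition:
  assumes "z \<in> gcar T"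
  shows "z = tword V (\<epsilon> z) [] + glue (\<Delta> z)"
  using assms
proof (rule gcar_tensor_eqI)
  fix c w assume w: "w \<in> L"
  have "glue (\<Delta> (tword V c w)) = deconc w (\<lambda>u v. tcons (tproj V (tword V c u)) (tword V 1 v))"
    using w by (simp add: comult_tword glue_deconc)
  also have "\<dots> = (if w = [] then 0 else tword V c w)"
  proof (cases w)
    case (Cons x v)
    have "deconc v (\<lambda>u v. tcons (tproj V (tword V c (x # u))) (tword V 1 v))
        = tcons (tproj V (tword V c [x])) (tword V 1 v)"
      by (rule deconc_left_Nil) (use w Cons in \<open>auto simp: tproj_tword in_lists_conv_set split: list.split\<close>)
    then show ?thesis
      using w Cons tword_lact[of v x 1 c] multilin_zero[OF multilin_tword, of "[]"]
      by (simp add: deconc_Cons tproj_tword tcons_tword_1)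
  qed (simp add: tproj_tword)
  finally show "tword V c w = tword V (\<epsilon> (tword V c w)) [] + glue (\<Delta> (tword V c w))"
    using w by (simp add: counit_tword tword_0)
qed (simp_all add: tword_0 counit_add comult_add glue_add tword_add)

definition counit2 :: "(('k, 't, 'v) words \<times> ('k, 't, 'v) words \<Rightarrow>\<^sub>0 'k) \<Rightarrow> 'k ^ 't" where
  "counit2 = linext (\<lambda>r c. vec r * c) (\<lambda>(a, b). \<epsilon> a * \<epsilon> b)"

lemma counit2_pure: "a \<in> gcar T \<Longrightarrow> b \<in> gcar T \<Longrightarrow> counit2 (pure_tensor T T a b) = \<epsilon> a * \<epsilon> b"
  unfolding counit2_def
  by (rule linext_pure_tensor[OF scaling_vec])
    (auto intro!: bilinI simp: counit_add counit_lact counit_ract distrib_left distrib_right mult.assoc)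

lemma counit2_add: "counit2 (s + t) = counit2 s + counit2 t"
  unfolding counit2_def by (rule scaling.linext_add[OF scaling_vec, of _ UNIV]) auto

lemma counit2_0 [simp]: "counit2 0 = 0"
  by (simp add: counit2_def)

lemma counit2_deconc:
  assumes "w \<in> L" "\<And>u. u \<in> L \<Longrightarrow> A u \<in> gcar T" "\<And>v. v \<in> L \<Longrightarrow> B v \<in> gcar T"
  shows "counit2 (deconc w (\<lambda>u v. pure_tensor T T (A u) (B v))) = deconc w (\<lambda>u v. \<epsilon> (A u) * \<epsilon> (B v))"
proof -
  have "counit2 (deconc w (\<lambda>u v. pure_tensor T T (A u) (B v))) = deconc w (\<lambda>u v. counit2 (pure_tensor T T (A u) (B v)))"
    using deconc_hom[OF assms(1), of counit2 UNIV] by (simp add: counit2_add)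
  also have "\<dots> = deconc w (\<lambda>u v. \<epsilon> (A u) * \<epsilon> (B v))"
    by (rule deconc_cong_lists[OF assms(1)]) (simp add: counit2_pure assms)
  finally show ?thesis .
qed

lemma counit2_comult: "z \<in> gcar T \<Longrightarrow> counit2 (\<Delta> z) = \<epsilon> z"
proof (rule gcar_tensor_eqI)
  fix c w assume w: "w \<in> L"
  have "counit2 (\<Delta> (tword V c w)) = deconc w (\<lambda>u v. \<epsilon> (tword V c u) * \<epsilon> (tword V 1 v))"
    using w by (simp add: comult_tword counit2_deconc)
  also have "\<dots> = \<epsilon> (tword V c w) * \<epsilon> (tword V 1 [])"
    by (rule deconc_right_Nil) (use w in \<open>auto simp: counit_tword in_lists_conv_set\<close>)
  finally show "counit2 (\<Delta> (tword V c w)) = \<epsilon> (tword V c w)"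
    by (simp add: counit_tword)
qed (simp_all add: comult_add counit2_add counit_add)

lemma tensor_map_comult_tword:
  assumes F: "bimod_hom T T p F" and G: "bimod_hom T T p' G" and w: "w \<in> L"
  shows "tensor_map T T T q F G (\<Delta> (tword V c w)) =
    deconc w (\<lambda>u v. pure_tensor T T (F (tword V c (map (koszul V q) u))) (G (tword V 1 v)))"
proof -
  have "tensor_map T T T q F G (\<Delta> (tword V c w)) =
      deconc w (\<lambda>u v. tensor_map T T T q F G (pure_tensor T T (tword V c u) (tword V 1 v)))"
    using deconc_hom[OF w, of "tensor_map T T T q F G" UNIV] w by (simp add: comult_tword tensor_map_add)
  also have "\<dots> = deconc w (\<lambda>u v. pure_tensor T T (F (tword V c (map (koszul V q) u))) (G (tword V 1 v)))"
    by (rule deconc_cong_lists[OF w])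
      (simp add: tensor_map_pure[OF graded_tensor graded_tensor graded_tensor graded_tensor F G] koszul_tword)
  finally show ?thesis .
qed

text \<open>
  A map \<open>X\<close> that is a coderivation along two coalgebra maps \<open>F\<close> and \<open>G\<close> vanishes as soon as its
  projection to the letters does. This one statement covers the uniqueness of
  coderivations (\<open>F = G = id\<close>), squares of odd coderivations, and, with \<open>X\<close> a difference of two
  coalgebra maps, the uniqueness of coalgebra maps.

  The reason is that \<open>X w\<close> is recovered from its coproduct, which by the hypothesis only involves
  projections to letters and values of \<open>X\<close> on shorter words.
\<close>

theorem rigidity:
  assumes X: "bimod_hom T T p X" and F: "bimod_hom T T p1 F" and G: "bimod_hom T T p2 G"
    and \<Delta>X: "\<And>z. z \<in> gcar T \<Longrightarrow> \<Delta> (X z) = tensor_map T T T 0 X F (\<Delta> z) + tensor_map T T T q G X (\<Delta> z)"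
    and \<epsilon>F: "\<And>z. z \<in> gcar T \<Longrightarrow> \<epsilon> (F z) = \<epsilon> z" and \<epsilon>G: "\<And>z. z \<in> gcar T \<Longrightarrow> \<epsilon> (G z) = \<epsilon> z"
    and G1: "\<And>c. G (tword V c []) = tword V c []"
    and proj: "\<And>c w. w \<in> L \<Longrightarrow> tproj V (X (tword V c w)) = 0"
    and z: "z \<in> gcar T"
  shows "X z = 0"
proof -
  interpret T: graded_bimodule T by (rule graded_tensor)
  note [simp] = tensor_hom_gcar[OF X]
    tensor_hom_gcar[OF F] tensor_hom_gcar[OF G]
  have [simp]: "map (koszul V 0) u = u" if "u \<in> L" for u
    using that by (auto simp: koszul_trivial in_lists_conv_set intro!: map_idI)
  have cp: "\<Delta> (X (tword V c w)) = deconc w (\<lambda>u v. pure_tensor T T (X (tword V c u)) (F (tword V 1 v)))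
      + deconc w (\<lambda>u v. pure_tensor T T (G (tword V c (map (koszul V q) u))) (X (tword V 1 v)))"
    if w: "w \<in> L" for c w
  proof -
    have "deconc w (\<lambda>u v. pure_tensor T T (X (tword V c (map (koszul V 0) u))) (F (tword V 1 v)))
        = deconc w (\<lambda>u v. pure_tensor T T (X (tword V c u)) (F (tword V 1 v)))"
      by (rule deconc_cong_lists[OF w]) simp
    with w show ?thesis
      by (simp add: \<Delta>X tensor_map_comult_tword[OF X F] tensor_map_comult_tword[OF G X])
  qed
  \<comment> \<open>Counting \<open>\<epsilon> (X w)\<close> through the coproduct gives twice the same value.\<close>
  have \<epsilon>X: "\<epsilon> (X (tword V c w)) = 0" if w: "w \<in> L" for c w
  proof -
    have "\<epsilon> (X (tword V c w)) = counit2 (\<Delta> (X (tword V c w)))"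
      using w by (simp add: counit2_comult)
    also have "\<dots> = deconc w (\<lambda>u v. \<epsilon> (X (tword V c u)) * \<epsilon> (F (tword V 1 v)))
        + deconc w (\<lambda>u v. \<epsilon> (G (tword V c (map (koszul V q) u))) * \<epsilon> (X (tword V 1 v)))"
      using w by (simp add: cp counit2_add counit2_deconc)
    also have "deconc w (\<lambda>u v. \<epsilon> (X (tword V c u)) * \<epsilon> (F (tword V 1 v))) = \<epsilon> (X (tword V c w))"
      by (subst deconc_right_Nil) (use w in \<open>auto simp: \<epsilon>F counit_tword in_lists_conv_set\<close>)
    also have "deconc w (\<lambda>u v. \<epsilon> (G (tword V c (map (koszul V q) u))) * \<epsilon> (X (tword V 1 v)))
        = c * \<epsilon> (X (tword V 1 w))"
    proof (subst deconc_left_Nil)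
      fix u v assume "u \<noteq> []" "u @ v = w"
      moreover from this w have "u \<in> L" by auto
      ultimately show "\<epsilon> (G (tword V c (map (koszul V q) u))) * \<epsilon> (X (tword V 1 v)) = 0"
        by (simp add: \<epsilon>G counit_tword)
    qed (simp add: G1 counit_tword)
    also have "\<dots> = \<epsilon> (X (lact T c (tword V 1 w)))"
      using w by (simp add: bimod_homD(2)[OF X] counit_lact)
    also have "\<dots> = \<epsilon> (X (tword V c w))"
      using w by (simp add: lact_tword)
    finally show ?thesis by simp
  qed
  have X0: "X (tword V c w) = 0" if "w \<in> L" for c w
    using that
  proof (induction "length w" arbitrary: c w rule: less_induct)
    case less
    note w = \<open>w \<in> L\<close>
    have "X (tword V c w) = tword V (\<epsilon> (X (tword V c w))) [] + glue (\<Delta> (X (tword V c w)))"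
      using w by (intro counit_glue_decomposition) simp
    also have "\<dots> = glue (\<Delta> (X (tword V c w)))"
      using w by (simp add: \<epsilon>X tword_0)
    also have "\<dots> = deconc w (\<lambda>u v. tcons (tproj V (X (tword V c u))) (F (tword V 1 v)))
      + deconc w (\<lambda>u v. tcons (tproj V (G (tword V c (map (koszul V q) u)))) (X (tword V 1 v)))"
      using w by (simp add: cp glue_add glue_deconc)
    also have "deconc w (\<lambda>u v. tcons (tproj V (X (tword V c u))) (F (tword V 1 v))) = 0"
    proof (rule deconc_zero)
      fix u v assume "u @ v = w"
      with w have "u \<in> L" "v \<in> L" by auto
      then show "tcons (tproj V (X (tword V c u))) (F (tword V 1 v)) = 0" by (simp add: proj)
    qed
    also have "deconc w (\<lambda>u v. tcons (tproj V (G (tword V c (map (koszul V q) u)))) (X (tword V 1 v))) = 0"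
    proof (rule deconc_zero)
      fix u v assume uv: "u @ v = w"
      show "tcons (tproj V (G (tword V c (map (koszul V q) u)))) (X (tword V 1 v)) = 0"
      proof (cases "u = []")
        case True
        with w uv show ?thesis by (simp add: G1 tproj_tword)
      next
        case False
        with uv have "length v < length w" by auto
        moreover have "v \<in> L" using w uv by auto
        ultimately show ?thesis using less(1)[of v 1] by simp
      qed
    qed
    finally show ?case by simp
  qed
  show ?thesis
    using z by (rule gcar_tensor_eqI[of z X "\<lambda>_. 0"])
      (simp_all add: X0 bimod_homD(1)[OF X] bimod_hom_0[OF graded_tensor graded_tensor X])
qed

end

section \<open>Coderivations and coalgebra maps of the tensor coalgebra\<close>

lemma deconc_closed:
  assumes "0 \<in> Z" "\<And>x y. x \<in> Z \<Longrightarrow> y \<in> Z \<Longrightarrow> x + y \<in> Z" "\<And>u v. u @ v = w \<Longrightarrow> g u v \<in> Z"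
  shows "deconc w g \<in> Z"
  using assms(3)
proof (induction w arbitrary: g)
  case (Cons x w)
  then have "deconc w (\<lambda>u. g (x # u)) \<in> Z" by simp
  with Cons(2)[of "[]"] show ?case by (simp add: deconc_Cons assms(2))
qed simp

lemma deconc_swap:
  "deconc w (\<lambda>u v. deconc w' (\<lambda>a b. g u v a b)) = deconc w' (\<lambda>a b. deconc w (\<lambda>u v. g u v a b))"
  unfolding deconc_def by (rule sum.swap)

text \<open>
  The corestrictions of coderivations (and, for \<open>q = 0\<close>, of coalgebra maps): maps of \<open>K\<close>-bimodules of
  degree \<open>q\<close> from words to letters that vanish on the coaugmentation, given by their values on words.
\<close>

definition letter_cochain :: "('k::field, 't::finite, 'v::ab_group_add, 'z) gbimod_scheme \<Rightarrow> int \<Rightarrow> ('v list \<Rightarrow> 'v) \<Rightarrow> bool" where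
  "letter_cochain V q b \<longleftrightarrow> multilin V b \<and> b [] = 0 \<and>
    (\<forall>c. \<forall>x\<in>gcar V. \<forall>w\<in>lists (gcar V). b (lact V c x # w) = lact V c (b (x # w))) \<and>
    (\<forall>c. \<forall>x\<in>gcar V. \<forall>w\<in>lists (gcar V). b (w @ [ract V x c]) = ract V (b (w @ [x])) c) \<and>
    (\<forall>w\<in>hwords V. b (map snd w) \<in> gcomp V (sum_list (map fst w) + q))"

lemma letter_cochainI:
  assumes "multilin V b" "b [] = 0"
    and "\<And>c x w. x \<in> gcar V \<Longrightarrow> w \<in> lists (gcar V) \<Longrightarrow> b (lact V c x # w) = lact V c (b (x # w))"
    and "\<And>c x w. x \<in> gcar V \<Longrightarrow> w \<in> lists (gcar V) \<Longrightarrow> b (w @ [ract V x c]) = ract V (b (w @ [x])) c"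
    and "\<And>w. w \<in> hwords V \<Longrightarrow> b (map snd w) \<in> gcomp V (sum_list (map fst w) + q)"
  shows "letter_cochain V q b"
  using assms unfolding letter_cochain_def by blast

lemma letter_cochainD:
  assumes "letter_cochain V q b"
  shows "multilin V b" "b [] = 0"
    and "x \<in> gcar V \<Longrightarrow> w \<in> lists (gcar V) \<Longrightarrow> b (lact V c x # w) = lact V c (b (x # w))"
    and "x \<in> gcar V \<Longrightarrow> w \<in> lists (gcar V) \<Longrightarrow> b (w @ [ract V x c]) = ract V (b (w @ [x])) c"
    and "u \<in> hwords V \<Longrightarrow> b (map snd u) \<in> gcomp V (sum_list (map fst u) + q)"
  using assms unfolding letter_cochain_def by blast+

context graded_bimodule
begin

lemma letter_cochain_gcar: "letter_cochain V q b \<Longrightarrow> w \<in> L \<Longrightarrow> b w \<in> gcar V"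
  by (rule multilin_closed[OF graded_bimodule_axioms letter_cochainD(1)])
    (auto dest: letter_cochainD(5) intro: gcar_gcomp)

lemma letter_cochain_plus:
  assumes b: "letter_cochain V q b" and b': "letter_cochain V q b'"
  shows "letter_cochain V q (\<lambda>w. b w + b' w)"
proof -
  note [simp] = letter_cochain_gcar[OF b] letter_cochain_gcar[OF b']
  show ?thesis
    by (rule letter_cochainI)
      (simp_all add: multilin_plus letter_cochainD[OF b] letter_cochainD[OF b'] lact_add_right ract_add_left comp_add)
qed

lemma letter_cochain_uminus:
  assumes b: "letter_cochain V q b"
  shows "letter_cochain V q (\<lambda>w. - b w)"
proof -
  note [simp] = letter_cochain_gcar[OF b]
  show ?thesis
    by (rule letter_cochainI)
      (simp_all add: multilin_uminus_fun letter_cochainD[OF b] lact_uminus ract_uminus comp_uminus)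
qed

lemma letter_cochain_id:
  "letter_cochain V 0 (\<lambda>w. case w of [x] \<Rightarrow> x | _ \<Rightarrow> 0)"
proof (rule letter_cochainI)
  show "multilin V (\<lambda>w. case w of [x] \<Rightarrow> x | _ \<Rightarrow> 0)"
    by (rule multilinI; case_tac u; case_tac v) (auto split: list.split)
next
  fix c x w assume "x \<in> gcar V" "w \<in> L"
  then show "(case w @ [ract V x c] of [x] \<Rightarrow> x | _ \<Rightarrow> 0) = ract V (case w @ [x] of [x] \<Rightarrow> x | _ \<Rightarrow> 0) c"
    by (cases w) (auto split: list.split)
next
  fix w assume "w \<in> hwords V"
  then show "(case map snd w of [x] \<Rightarrow> x | _ \<Rightarrow> 0) \<in> gcomp V (sum_list (map fst w) + 0)"
    by (cases w; cases "tl w") (auto simp: hwords_def comp_zero)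
qed (auto split: list.split)

lemma multilin_map_koszul: "multilin V h \<Longrightarrow> multilin V (\<lambda>u. h (map (koszul V q) u))"
  by (rule multilinI) (simp_all add: multilin_add multilin_bal koszul_add koszul_lact koszul_ract)

lemma multilin_deconc_param:
  assumes "w \<in> L" "\<And>s v. s \<in> L \<Longrightarrow> v \<in> L \<Longrightarrow> multilin V (\<lambda>u. t u s v)"
  shows "multilin V (\<lambda>u. deconc w (t u))"
  unfolding deconc_def
  by (rule multilin_sum, rule assms(2)) (use assms(1) in \<open>auto simp: in_lists_conv_set dest: in_set_takeD in_set_dropD\<close>)

lemma bimod_hom_id: "bimod_hom T T 0 id"
  by (simp add: bimod_hom_def)

lemma pure_tensor_0_left [simp]: "y \<in> gcar T \<Longrightarrow> pure_tensor T T 0 y = 0"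
  using pure_tensor_add_left[of 0 T 0 y T] by (simp add: gcar_tensor_0)

lemma pure_tensor_0_right [simp]: "y \<in> gcar T \<Longrightarrow> pure_tensor T T y 0 = 0"
  using pure_tensor_add_right[of y T 0 T 0] by (simp add: gcar_tensor_0)

lemma tword_zero: "u \<in> L \<Longrightarrow> v \<in> L \<Longrightarrow> tword V c (u @ 0 # v) = 0"
  by (rule multilin_zero[OF multilin_tword])

subsection \<open>The coderivation with given corestriction\<close>

text \<open>
  Each subword \<open>s\<close> is replaced by the letter \<open>b s\<close>; the Koszul sign arises from moving \<open>b\<close>, of degree
  \<open>q\<close>, past the letters in front of \<open>s\<close>.
\<close>

definition cod :: "int \<Rightarrow> ('v list \<Rightarrow> 'v) \<Rightarrow> ('k, 't, 'v) words \<Rightarrow> ('k, 't, 'v) words" where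
  "cod q b = linext fscale (\<lambda>(c, w).
     deconc w (\<lambda>u r. deconc r (\<lambda>s v. tword V c (map (koszul V q) u @ b s # v))))"

context
  fixes q b assumes b: "letter_cochain V q b"
begin

lemma b_gcar [simp]: "s \<in> L \<Longrightarrow> b s \<in> gcar V"
  by (rule letter_cochain_gcar[OF b])

lemma b_add: "u \<in> L \<Longrightarrow> v \<in> L \<Longrightarrow> x \<in> gcar V \<Longrightarrow> y \<in> gcar V \<Longrightarrow> b (u @ (x + y) # v) = b (u @ x # v) + b (u @ y # v)"
  by (rule multilin_add[OF letter_cochainD(1)[OF b]])

lemma b_bal: "u \<in> L \<Longrightarrow> v \<in> L \<Longrightarrow> x \<in> gcar V \<Longrightarrow> y \<in> gcar V \<Longrightarrow> b (u @ ract V x c # y # v) = b (u @ x # lact V c y # v)"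
  by (rule multilin_bal[OF letter_cochainD(1)[OF b]])

lemma multilin_cod_inner:
  assumes "u \<in> L"
  shows "multilin V (\<lambda>r. deconc r (\<lambda>s v. tword V c (u @ b s # v)))"
proof (rule multilin_deconc, rule multilin2I)
  fix s assume s: "s \<in> L"
  show "multilin V (\<lambda>v. tword V c (u @ b s # v))"
    using multilin_append_left[OF multilin_tword, of "u @ [b s]"] assms s by simp
  show "multilin V (\<lambda>a. tword V c (u @ b a # s))"
    by (rule multilinI) (simp_all add: assms s b_add b_bal tword_letter_add)
next
  fix a v x y d assume "a \<in> L" "v \<in> L" "x \<in> gcar V" "y \<in> gcar V"
  then show "tword V c (u @ b (a @ [ract V x d]) # y # v) = tword V c (u @ b (a @ [x]) # lact V d y # v)"
    using assms by (simp add: letter_cochainD(4)[OF b] tword_letter_bal)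
qed

lemma multilin_cod: "multilin V (\<lambda>w. deconc w (\<lambda>u r. deconc r (\<lambda>s v. tword V c (map (koszul V q) u @ b s # v))))"
proof (rule multilin_deconc, rule multilin2I)
  fix a assume a: "a \<in> L"
  show "multilin V (\<lambda>r. deconc r (\<lambda>s v. tword V c (map (koszul V q) a @ b s # v)))"
    using a by (intro multilin_cod_inner) simp
  show "multilin V (\<lambda>u. deconc a (\<lambda>s v. tword V c (map (koszul V q) u @ b s # v)))"
    by (rule multilin_deconc_param[OF a], rule multilin_map_koszul, rule multilin_append_right[OF multilin_tword]) simp
next
  fix a r x y d assume *: "a \<in> L" "r \<in> L" "x \<in> gcar V" "y \<in> gcar V"
  have "deconc r (\<lambda>s v. tword V c (map (koszul V q) (a @ [ract V x d]) @ b (y # s) # v)) =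
      deconc r (\<lambda>s v. tword V c (map (koszul V q) (a @ [x]) @ b (lact V d y # s) # v))"
    by (rule deconc_cong_lists[OF *(2)])
      (use * in \<open>simp add: koszul_ract tword_letter_bal letter_cochainD(3)[OF b]\<close>)
  then show "deconc (y # r) (\<lambda>s v. tword V c (map (koszul V q) (a @ [ract V x d]) @ b s # v)) =
      deconc (lact V d y # r) (\<lambda>s v. tword V c (map (koszul V q) (a @ [x]) @ b s # v))"
    using * by (simp only: deconc_Cons letter_cochainD(2)[OF b])
      (simp add: tword_zero[of "_ @ [_]", simplified])
qed

lemma word_lin_cod: "word_lin V fscale (\<lambda>c w. deconc w (\<lambda>u r. deconc r (\<lambda>s v. tword V c (map (koszul V q) u @ b s # v))))"
  (is "word_lin V fscale (\<lambda>c w. deconc w (\<lambda>u r. deconc r (?g c u)))")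
proof (rule word_linI)
  fix c c' w assume w: "w \<in> L"
  show "deconc w (\<lambda>u r. deconc r (?g (c + c') u)) = deconc w (\<lambda>u r. deconc r (?g c u)) + deconc w (\<lambda>u r. deconc r (?g c' u))"
    unfolding deconc_plus[symmetric]
    by (rule deconc_cong_lists[OF w], rule deconc_cong_lists[where S = "gcar V"]) (simp_all add: tword_add)
next
  fix r c w assume w: "w \<in> L"
  have [symmetric, simp]: "deconc w (\<lambda>u v. fscale r (g u v)) = fscale r (deconc w g)"
    for w :: "'v list" and g :: "_ \<Rightarrow> _ \<Rightarrow> ('k, 't, 'v) words"
    unfolding deconc_def by (simp add: fspace.scale_sum_right)
  show "deconc w (\<lambda>u s. deconc s (?g (vec r * c) u)) = fscale r (deconc w (\<lambda>u r. deconc r (?g c u)))"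
    by (simp, rule deconc_cong_lists[OF w], rule deconc_cong_lists[where S = "gcar V"]) (simp_all add: tword_scale)
next
  fix c c' x w assume *: "x \<in> gcar V" "w \<in> L"
  have "deconc w (\<lambda>s. ?g (c * c') [] (x # s)) = deconc w (\<lambda>s. ?g c [] (lact V c' x # s))"
    by (rule deconc_cong_lists[OF *(2)]) (use * in \<open>simp add: tword_lact letter_cochainD(3)[OF b]\<close>)
  moreover have "deconc w (\<lambda>u r. deconc r (?g (c * c') (x # u))) = deconc w (\<lambda>u r. deconc r (?g c (lact V c' x # u)))"
    by (rule deconc_cong_lists[OF *(2)], rule deconc_cong_lists[where S = "gcar V"])
      (use * in \<open>simp_all add: tword_lact koszul_lact\<close>)
  ultimately show "deconc (x # w) (\<lambda>u r. deconc r (?g (c * c') u)) = deconc (lact V c' x # w) (\<lambda>u r. deconc r (?g c u))"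
    using * tword_zero[of "[]"] by (simp add: deconc_Cons letter_cochainD(2)[OF b])
qed (rule multilin_cod)

lemma cod_tword: "w \<in> L \<Longrightarrow> cod q b (tword V c w) =
    deconc w (\<lambda>u r. deconc r (\<lambda>s v. tword V c (map (koszul V q) u @ b s # v)))"
  unfolding cod_def by (rule linext_tword_fscale[OF word_lin_cod])

lemma cod_add: "cod q b (x + y) = cod q b x + cod q b y"
  unfolding cod_def by (rule linext_fscale_add)

lemma cod_0: "cod q b 0 = 0"
  by (simp add: cod_def)

lemma cod_tword_hom:
  assumes w: "w \<in> L" and h: "h 0 = 0" "\<And>x y. x \<in> gcar T \<Longrightarrow> y \<in> gcar T \<Longrightarrow> h (x + y) = h x + h y"
  shows "h (cod q b (tword V c w)) =
    deconc w (\<lambda>u r. deconc r (\<lambda>s v. h (tword V c (map (koszul V q) u @ b s # v))))"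
proof -
  have 1: "h (deconc r (\<lambda>s v. tword V c (map (koszul V q) u @ b s # v))) =
      deconc r (\<lambda>s v. h (tword V c (map (koszul V q) u @ b s # v))) \<and>
      deconc r (\<lambda>s v. tword V c (map (koszul V q) u @ b s # v)) \<in> gcar T" if "u \<in> L" "r \<in> L" for u r
    by (rule deconc_hom[OF that(2), of h]) (use h that in \<open>simp_all add: gcar_tensor_add\<close>)
  have "h (cod q b (tword V c w)) = deconc w (\<lambda>u r. h (deconc r (\<lambda>s v. tword V c (map (koszul V q) u @ b s # v))))"
    unfolding cod_tword[OF w]
    by (rule deconc_hom[OF w, of h "gcar T", THEN conjunct1]) (use h 1 in \<open>simp_all add: gcar_tensor_add\<close>)
  also have "\<dots> = deconc w (\<lambda>u r. deconc r (\<lambda>s v. h (tword V c (map (koszul V q) u @ b s # v))))"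
    by (rule deconc_cong_lists[OF w]) (use 1 in simp)
  finally show ?thesis .
qed

lemma cod_lact: "z \<in> gcar T \<Longrightarrow> cod q b (lact T c z) = lact T c (cod q b z)"
proof (rule gcar_tensor_eqI[where z = z])
  fix d w assume w: "w \<in> L"
  have "lact T c (cod q b (tword V d w)) =
      deconc w (\<lambda>u r. deconc r (\<lambda>s v. lact T c (tword V d (map (koszul V q) u @ b s # v))))"
    by (rule cod_tword_hom[OF w]) (simp_all add: lact_tensor_0 lact_tensor_add)
  also have "\<dots> = deconc w (\<lambda>u r. deconc r (\<lambda>s v. tword V (c * d) (map (koszul V q) u @ b s # v)))"
    by (rule deconc_cong_lists[OF w], rule deconc_cong_lists[where S = "gcar V"]) (simp_all add: lact_tword)
  finally show "cod q b (lact T c (tword V d w)) = lact T c (cod q b (tword V d w))"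
    using w by (simp add: lact_tword cod_tword)
qed (simp_all add: cod_add cod_0 lact_tensor_0 lact_tensor_add)

lemma cod_ract: "z \<in> gcar T \<Longrightarrow> cod q b (ract T z c) = ract T (cod q b z) c"
proof (rule gcar_tensor_eqI[where z = z])
  fix d w assume w: "w \<in> L"
  show "cod q b (ract T (tword V d w) c) = ract T (cod q b (tword V d w)) c"
  proof (cases w rule: rev_cases)
    case Nil
    then show ?thesis
      using tword_zero[of "[]" "[]"] by (simp add: ract_tword_Nil cod_tword letter_cochainD(2)[OF b] ract_tensor_0)
  next
    case (snoc w' x)
    with w have w': "w' \<in> L" and x: "x \<in> gcar V" by auto
    have eq: "tword V d (u @ b [] # []) = 0" if "u \<in> L" for u
      using tword_zero[OF that, of "[]"] by (simp add: letter_cochainD(2)[OF b])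
    have "ract T (cod q b (tword V d w)) c =
        deconc w (\<lambda>u r. deconc r (\<lambda>s v. ract T (tword V d (map (koszul V q) u @ b s # v)) c))"
      by (rule cod_tword_hom[OF w]) (simp_all add: ract_tensor_0 ract_tensor_add)
    also have "\<dots> = deconc w' (\<lambda>u r. deconc r (\<lambda>s v. ract T (tword V d ((map (koszul V q) u @ b s # v) @ [x])) c)
        + ract T (tword V d (map (koszul V q) u @ [b (r @ [x])])) c)"
      using x w' by (simp add: snoc deconc_snoc deconc_plus letter_cochainD(2)[OF b] eq ract_tensor_0)
        (simp add: eq[of "map (koszul V q) w' @ [koszul V q x]", unfolded letter_cochainD(2)[OF b], simplified] ract_tensor_0)
    also have "\<dots> = deconc w' (\<lambda>u r. deconc r (\<lambda>s v. tword V d ((map (koszul V q) u @ b s # v) @ [ract V x c]))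
        + tword V d (map (koszul V q) u @ [b (r @ [ract V x c])]))"
    proof (rule deconc_cong_lists[OF w'], rule arg_cong2[where f = "(+)"], rule deconc_cong_lists[where S = "gcar V"])
      fix u r s v assume *: "u \<in> L" "r \<in> L"
      show "r \<in> L" by fact
      show "ract T (tword V d (map (koszul V q) u @ [b (r @ [x])])) c = tword V d (map (koszul V q) u @ [b (r @ [ract V x c])])"
        using * x by (simp add: ract_tword_snoc letter_cochainD(4)[OF b])
      assume "s \<in> L" "v \<in> L"
      then show "ract T (tword V d ((map (koszul V q) u @ b s # v) @ [x])) c = tword V d ((map (koszul V q) u @ b s # v) @ [ract V x c])"
        using * x by (subst ract_tword_snoc) simp_all
    qed
    also have "\<dots> = cod q b (tword V d (w' @ [ract V x c]))"
      using x w' by (simp add: cod_tword deconc_snoc deconc_plus letter_cochainD(2)[OF b])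
        (simp add: eq[of "map (koszul V q) w' @ [_]", unfolded letter_cochainD(2)[OF b], simplified])
    finally show ?thesis
      using x w' by (simp add: snoc ract_tword_snoc)
  qed
qed (simp_all add: cod_add cod_0 ract_tensor_0 ract_tensor_add)

lemma cod_degree: "z \<in> gcomp T n \<Longrightarrow> cod q b z \<in> gcomp T (n + q)"
proof (induction rule: gcomp_tensor_induct)
  case zero
  then show ?case by (simp add: cod_0 gcomp_tensor fspace.span_zero)
next
  case (add c w y)
  have Z: "0 \<in> gcomp T (n + q)" "x \<in> gcomp T (n + q) \<Longrightarrow> y \<in> gcomp T (n + q) \<Longrightarrow> x + y \<in> gcomp T (n + q)" for x y
    by (auto simp: gcomp_tensor fspace.span_zero fspace.span_add)
  have "cod q b (tword V c (map snd w)) = deconc w (\<lambda>u r. deconc r (\<lambda>s v.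
      tword V c (map (koszul V q) (map snd u) @ b (map snd s) # map snd v)))"
    by (simp only: cod_tword[OF hwords_lists[OF add(1)]] deconc_map)
  also have "\<dots> \<in> gcomp T (n + q)"
  proof (intro deconc_closed Z)
    fix u r s v assume *: "u @ r = w" "s @ v = r"
    let ?w = "map (\<lambda>(i, x). (i, koszul V q x)) u @ (sum_list (map fst s) + q, b (map snd s)) # v"
    have 1: "s \<in> hwords V" using * add(1) by (auto simp: hwords_def)
    then have "?w \<in> hwords V"
      using * add(1) letter_cochainD(5)[OF b 1] by (auto 4 4 simp: hwords_def intro!: comp_koszul)
    moreover have "sum_list (map fst ?w) = n + q"
      using * add(2) by (auto simp: comp_def case_prod_unfold)
    moreover have "map snd ?w = map (koszul V q) (map snd u) @ b (map snd s) # map snd v"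
      by (simp add: comp_def case_prod_unfold)
    ultimately show "tword V c (map (koszul V q) (map snd u) @ b (map snd s) # map snd v) \<in> gcomp T (n + q)"
      using tword_gcomp[of ?w c] by metis
  qed
  finally show ?case
    using add(4) Z(2) by (simp add: cod_add)
qed

lemma bimod_hom_cod: "bimod_hom T T q (cod q b)"
  by (auto simp: bimod_hom_def cod_add cod_lact cod_ract cod_degree)

text \<open>
  A cut of \<open>u @ b s # v\<close> lies in \<open>u\<close> or in \<open>v\<close>. In the second case the letter \<open>b s\<close> belongs to the
  left factor, in the first case to the right factor, and the letters of \<open>u\<close> left of the cut keep
  the sign. Coassociativity of \<open>deconc\<close> identifies the two sums with the two terms.
\<close>

lemma cod_comult:
  assumes "z \<in> gcar T"
  shows "\<Delta> (cod q b z) = tensor_map T T T 0 (cod q b) id (\<Delta> z) + tensor_map T T T q id (cod q b) (\<Delta> z)"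
  using assms
proof (rule gcar_tensor_eqI)
  fix c w assume w: "w \<in> L"
  let ?k = "map (koszul V q)"
  define P where "P u s a e = pure_tensor T T (tword V c (?k u @ b s # a)) (tword V 1 e)" for u s a e
  define Q where "Q a e s v = pure_tensor T T (tword V c (?k a)) (tword V 1 (?k e @ b s # v))" for a e s v
  have k0: "map (koszul V 0) u = u" if "u \<in> L" for u
    using that by (auto simp: koszul_trivial in_lists_conv_set intro!: map_idI)
  have "\<Delta> (cod q b (tword V c w)) = deconc w (\<lambda>u r. deconc r (\<lambda>s v. \<Delta> (tword V c (?k u @ b s # v))))"
    by (rule cod_tword_hom[OF w]) (simp_all add: comult_add)
  also have "\<dots> = deconc w (\<lambda>u r. deconc r (\<lambda>s v. deconc u (\<lambda>a e. Q a e s v) + deconc v (\<lambda>a e. P u s a e)))"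
    by (rule deconc_cong_lists[OF w], rule deconc_cong_lists[where S = "gcar V"])
      (simp_all add: comult_tword deconc_append_Cons deconc_map P_def Q_def)
  also have "\<dots> = deconc w (\<lambda>u r. deconc r (\<lambda>s v. deconc v (\<lambda>a e. P u s a e)))
      + deconc w (\<lambda>u r. deconc u (\<lambda>a e. deconc r (\<lambda>s v. Q a e s v)))"
    by (simp add: deconc_plus add.commute deconc_swap[of _ _ "\<lambda>s v a e. Q a e s v"])
  also have "deconc w (\<lambda>u r. deconc r (\<lambda>s v. deconc v (\<lambda>a e. P u s a e))) =
      deconc w (\<lambda>x e. deconc x (\<lambda>u r. deconc r (\<lambda>s a. P u s a e)))"
    by (simp add: deconc_assoc)
  also have "\<dots> = tensor_map T T T 0 (cod q b) id (\<Delta> (tword V c w))"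
  proof (subst tensor_map_comult_tword[OF bimod_hom_cod bimod_hom_id w], rule deconc_cong_lists[OF w])
    fix x e assume *: "x \<in> L" "e \<in> L"
    show "deconc x (\<lambda>u r. deconc r (\<lambda>s a. P u s a e)) =
        pure_tensor T T (cod q b (tword V c (map (koszul V 0) x))) (id (tword V 1 e))"
      using * cod_tword_hom[OF *(1), of "\<lambda>y. pure_tensor T T y (tword V 1 e)" c]
      by (simp add: k0 P_def pure_tensor_add_left)
  qed
  also have "deconc w (\<lambda>u r. deconc u (\<lambda>a e. deconc r (\<lambda>s v. Q a e s v))) =
      deconc w (\<lambda>a y. deconc y (\<lambda>e r. deconc r (\<lambda>s v. Q a e s v)))"
    by (rule deconc_assoc)
  also have "\<dots> = tensor_map T T T q id (cod q b) (\<Delta> (tword V c w))"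
  proof (subst tensor_map_comult_tword[OF bimod_hom_id bimod_hom_cod w], rule deconc_cong_lists[OF w])
    fix a y assume *: "a \<in> L" "y \<in> L"
    show "deconc y (\<lambda>e r. deconc r (\<lambda>s v. Q a e s v)) =
        pure_tensor T T (id (tword V c (?k a))) (cod q b (tword V 1 y))"
      using * cod_tword_hom[OF *(2), of "\<lambda>z. pure_tensor T T (tword V c (?k a)) z" 1]
      by (simp add: Q_def pure_tensor_add_right)
  qed
  finally show "\<Delta> (cod q b (tword V c w)) = tensor_map T T T 0 (cod q b) id (\<Delta> (tword V c w)) +
      tensor_map T T T q id (cod q b) (\<Delta> (tword V c w))" .
qed (simp_all add: cod_add cod_0 comult_add tensor_map_add)

lemma tproj_cod:
  assumes w: "w \<in> L"
  shows "tproj V (cod q b (tword V c w)) = lact V c (b w)"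
proof -
  have "tproj V (cod q b (tword V c w)) = deconc w (\<lambda>u r. deconc r (\<lambda>s v. tproj V (tword V c (map (koszul V q) u @ b s # v))))"
    by (rule cod_tword_hom[OF w]) (simp_all add: tproj_add)
  also have "\<dots> = deconc w (\<lambda>u r. deconc r (\<lambda>s v. if u = [] \<and> v = [] then lact V c (b s) else 0))"
    by (rule deconc_cong_lists[OF w], rule deconc_cong_lists[where S = "gcar V"])
      (auto simp: tproj_tword append_eq_Cons_conv Cons_eq_append_conv split: list.split)
  also have "\<dots> = deconc w (\<lambda>s v. if v = [] then lact V c (b s) else 0)"
    by (subst deconc_left_Nil) (auto intro!: deconc_zero)
  also have "\<dots> = lact V c (b w)"
    by (subst deconc_right_Nil) auto
  finally show ?thesis .
qed

lemma cod_unit: "cod q b (tword V c []) = 0"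
  using tword_zero[of "[]" "[]"] by (simp add: cod_tword letter_cochainD(2)[OF b])

end

end

subsection \<open>The coalgebra map with given corestriction\<close>

text \<open>
  The sum of \<open>g [f s\<^sub>1, \<dots>, f s\<^sub>r]\<close> over all ways to cut \<open>s @ w\<close> into nonempty blocks \<open>s\<^sub>1, \<dots>, s\<^sub>r\<close> such
  that \<open>s\<close> lies in the first one. Reading the next letter, the current block is either extended or
  closed. The continuation \<open>g\<close> makes the recursion structural in \<open>w\<close>.
\<close>

fun blocks :: "('v list \<Rightarrow> 'v) \<Rightarrow> 'v list \<Rightarrow> 'v list \<Rightarrow> ('v list \<Rightarrow> 'b::ab_group_add) \<Rightarrow> 'b" where
  "blocks f s [] g = g [f s]"
| "blocks f s (x # w) g = blocks f (s @ [x]) w g + blocks f [x] w (\<lambda>l. g (f s # l))"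

definition block_sum :: "('v list \<Rightarrow> 'v) \<Rightarrow> 'v list \<Rightarrow> ('v list \<Rightarrow> 'b::ab_group_add) \<Rightarrow> 'b" where
  "block_sum f w g = (case w of [] \<Rightarrow> g [] | x # w' \<Rightarrow> blocks f [x] w' g)"

lemma block_sum_Nil [simp]: "block_sum f [] g = g []"
  and block_sum_Cons [simp]: "block_sum f (x # w) g = blocks f [x] w g"
  by (simp_all add: block_sum_def)

lemma blocks_plus: "blocks f s w (\<lambda>l. g l + g' l) = blocks f s w g + blocks f s w g'"
  by (induction w arbitrary: s g g') (simp_all add: algebra_simps)

lemma blocks_zero: "(\<And>l. l \<noteq> [] \<Longrightarrow> g l = 0) \<Longrightarrow> blocks f s w g = 0"
  by (induction w arbitrary: s g) simp_all

lemma blocks_letters: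
  assumes "\<And>l. length l > 1 \<Longrightarrow> g l = 0"
  shows "blocks f s w g = g [f (s @ w)]"
proof (induction w arbitrary: s)
  case (Cons x w)
  have "blocks f [x] w (\<lambda>l. g (f s # l)) = 0"
    by (rule blocks_zero) (simp add: assms)
  with Cons show ?case by simp
qed simp

lemma blocks_pairs:
  assumes "\<And>l. length l > 2 \<Longrightarrow> g l = 0"
  shows "blocks f s v g = g [f (s @ v)] + deconc v (\<lambda>x y. if y = [] then 0 else g [f (s @ x), f y])"
proof (induction v arbitrary: s)
  case (Cons z v)
  have "blocks f [z] v (\<lambda>l. g (f s # l)) = g [f s, f (z # v)]"
    by (subst blocks_letters) (simp_all add: assms)
  with Cons show ?case by (simp add: deconc_Cons algebra_simps cong: if_cong)
qed simp

text \<open>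
  A cut of the list of blocks amounts to a cut of the word together with a decomposition of each
  part. The cut in front of the first block is separate, as the block \<open>s\<close> has already been begun.
\<close>

lemma blocks_deconc:
  "blocks f s w (\<lambda>l. deconc l h) =
    blocks f s w (h []) + deconc w (\<lambda>u v. blocks f s u (\<lambda>l. block_sum f v (h l)))"
proof (induction w arbitrary: s h)
  case Nil
  show ?case by (simp add: deconc_Cons)
next
  case (Cons x w)
  show ?case
    by (simp add: deconc_Cons blocks_plus Cons deconc_plus algebra_simps)
qed

lemma block_sum_deconc:
  "block_sum f w (\<lambda>l. deconc l h) = deconc w (\<lambda>u v. block_sum f u (\<lambda>l. block_sum f v (h l)))"
proof (cases w)
  case (Cons x w')
  show ?thesis by (simp add: Cons deconc_Cons blocks_deconc)
qed simp

context graded_bimodule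
begin

context
  fixes f assumes f: "letter_cochain V 0 f"
begin

lemma f_gcar [simp]: "s \<in> L \<Longrightarrow> f s \<in> gcar V"
  by (rule letter_cochain_gcar[OF f])

lemma blocks_cong:
  "s \<in> L \<Longrightarrow> w \<in> L \<Longrightarrow> (\<And>l. l \<in> L \<Longrightarrow> l \<noteq> [] \<Longrightarrow> g l = g' l) \<Longrightarrow> blocks f s w g = blocks f s w g'"
proof (induction w arbitrary: s g g')
  case (Cons x w)
  have "blocks f (s @ [x]) w g = blocks f (s @ [x]) w g'"
    using Cons(2-) by (intro Cons(1)) auto
  moreover have "blocks f [x] w (\<lambda>l. g (f s # l)) = blocks f [x] w (\<lambda>l. g' (f s # l))"
    using Cons(2-) by (intro Cons(1)) auto
  ultimately show ?case by simp
qed simp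

lemma block_sum_cong: "w \<in> L \<Longrightarrow> (\<And>l. l \<in> L \<Longrightarrow> g l = g' l) \<Longrightarrow> block_sum f w g = block_sum f w g'"
proof (cases w)
  case (Cons x w')
  assume "w \<in> L" "\<And>l. l \<in> L \<Longrightarrow> g l = g' l"
  then have "blocks f [x] w' g = blocks f [x] w' g'"
    using Cons by (intro blocks_cong) simp_all
  then show ?thesis by (simp add: Cons)
qed simp

lemma multilin_blocks_prefix: "w \<in> L \<Longrightarrow> multilin V g \<Longrightarrow> multilin V (\<lambda>s. blocks f s w g)"
proof (induction w arbitrary: g)
  case Nil
  note fm = letter_cochainD(1)[OF f]
  show ?case
    by (rule multilinI)
      (use multilin_add[OF Nil(2), of "[]" "[]"] in \<open>simp_all add: multilin_add[OF fm] multilin_bal[OF fm]\<close>)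
next
  case (Cons x w)
  note fm = letter_cochainD(1)[OF f]
  have x: "x \<in> gcar V" and w: "w \<in> L" using Cons(2) by auto
  have "multilin V (\<lambda>s. blocks f (s @ [x]) w g)"
    using multilin_append_right[OF Cons(1)[OF w Cons(3)], of "[x]"] x by simp
  moreover have "multilin V (\<lambda>s. blocks f [x] w (\<lambda>l. g (f s # l)))"
  proof (rule multilinI)
    fix u v y z assume *: "u \<in> L" "v \<in> L" "y \<in> gcar V" "z \<in> gcar V"
    have "blocks f [x] w (\<lambda>l. g (f (u @ (y + z) # v) # l)) =
        blocks f [x] w (\<lambda>l. g (f (u @ y # v) # l) + g (f (u @ z # v) # l))"
      by (rule blocks_cong)
        (use * x w multilin_add[OF Cons(3), of "[]"] in \<open>simp_all add: multilin_add[OF fm]\<close>)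
    then show "blocks f [x] w (\<lambda>l. g (f (u @ (y + z) # v) # l)) =
        blocks f [x] w (\<lambda>l. g (f (u @ y # v) # l)) + blocks f [x] w (\<lambda>l. g (f (u @ z # v) # l))"
      by (simp add: blocks_plus)
  qed (simp add: multilin_bal[OF fm])
  ultimately show ?case by (simp add: multilin_plus)
qed

text \<open>
  Balancing between a block that is already closed and the first letter of the current block.
\<close>

lemma blocks_head_bal:
  "y \<in> gcar V \<Longrightarrow> z \<in> gcar V \<Longrightarrow> p \<in> L \<Longrightarrow> w \<in> L \<Longrightarrow> multilin V g \<Longrightarrow>
    blocks f (y # p) w (\<lambda>l. g (ract V z c # l)) = blocks f (lact V c y # p) w (\<lambda>l. g (z # l))"
proof (induction w arbitrary: p)
  case Nil
  then show ?case
    using multilin_bal[OF Nil(5), of "[]" "[]"] by (simp add: letter_cochainD(3)[OF f])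
next
  case (Cons a w)
  have "blocks f [a] w (\<lambda>l. g (ract V z c # f (y # p) # l)) = blocks f [a] w (\<lambda>l. g (z # f (lact V c y # p) # l))"
    by (rule blocks_cong)
      (use Cons(2-) multilin_bal[OF Cons(6), of "[]"] in \<open>simp_all add: letter_cochainD(3)[OF f]\<close>)
  with Cons show ?case by simp
qed

lemma multilin_blocks: "s \<in> L \<Longrightarrow> multilin V g \<Longrightarrow> multilin V (\<lambda>w. blocks f s w g)"
proof (rule multilinI)
  fix u v x y assume "s \<in> L" "multilin V g" "u \<in> L" "v \<in> L" "x \<in> gcar V" "y \<in> gcar V"
  then show "blocks f s (u @ (x + y) # v) g = blocks f s (u @ x # v) g + blocks f s (u @ y # v) g"
  proof (induction u arbitrary: s g)
    case Nil
    then show ?case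
      using multilin_add[OF multilin_blocks_prefix[OF Nil(4,2)], of s "[]"]
        multilin_add[OF multilin_blocks_prefix[OF Nil(4) multilin_Cons[OF Nil(2)]], of "f s" "[]" "[]"]
      by simp
  next
    case (Cons z u)
    then show ?case by (simp add: multilin_Cons)
  qed
next
  fix u v x y c assume "s \<in> L" "multilin V g" "u \<in> L" "v \<in> L" "x \<in> gcar V" "y \<in> gcar V"
  then show "blocks f s (u @ ract V x c # y # v) g = blocks f s (u @ x # lact V c y # v) g"
  proof (induction u arbitrary: s g)
    case Nil
    note m = multilin_Cons[OF Nil(2), of "f s"]
    have "blocks f (s @ [ract V x c, y]) v g = blocks f (s @ [x, lact V c y]) v g"
      using multilin_bal[OF multilin_blocks_prefix[OF Nil(4,2)], of s "[]"] Nil by simp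
    moreover have "blocks f [ract V x c, y] v (\<lambda>l. g (f s # l)) = blocks f [x, lact V c y] v (\<lambda>l. g (f s # l))"
      using multilin_bal[OF multilin_blocks_prefix[OF Nil(4) m], of "[]" "[]"] Nil by simp
    moreover have "blocks f [y] v (\<lambda>l. g (f (s @ [ract V x c]) # l)) = blocks f [lact V c y] v (\<lambda>l. g (f (s @ [x]) # l))"
      using blocks_head_bal[of y "f (s @ [x])" "[]" v g c] Nil by (simp add: letter_cochainD(4)[OF f])
    moreover have "blocks f [y] v (\<lambda>l. g (f s # f [ract V x c] # l)) = blocks f [lact V c y] v (\<lambda>l. g (f s # f [x] # l))"
      using blocks_head_bal[OF Nil(6) _ _ Nil(4) m, of "f [x]" "[]" c] letter_cochainD(4)[OF f, of x "[]" c] Nil by simp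
    ultimately show ?case by simp
  next
    case (Cons z u)
    then show ?case by (simp add: multilin_Cons)
  qed
qed

lemma multilin_block_sum: "multilin V g \<Longrightarrow> multilin V (\<lambda>w. block_sum f w g)"
proof (rule multilinI)
  fix u v x y assume *: "multilin V g" "u \<in> L" "v \<in> L" "x \<in> gcar V" "y \<in> gcar V"
  then show "block_sum f (u @ (x + y) # v) g = block_sum f (u @ x # v) g + block_sum f (u @ y # v) g"
    using multilin_add[OF multilin_blocks_prefix[OF *(3,1)], of "[]" "[]"]
    by (cases u) (simp_all add: multilin_add[OF multilin_blocks])
next
  fix u v x y c assume *: "multilin V g" "u \<in> L" "v \<in> L" "x \<in> gcar V" "y \<in> gcar V"
  then show "block_sum f (u @ ract V x c # y # v) g = block_sum f (u @ x # lact V c y # v) g"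
    using multilin_bal[OF multilin_blocks_prefix[OF *(3,1)], of "[]" "[]"]
      blocks_head_bal[of y "f [x]" "[]" v g c] letter_cochainD(4)[OF f, of x "[]" c]
    by (cases u) (simp_all add: multilin_bal[OF multilin_blocks])
qed

text \<open>
  The word is cut into blocks in all possible ways and \<open>f\<close> is applied to each block. No signs
  occur because \<open>f\<close> has degree zero.
\<close>

definition cmap :: "('k, 't, 'v) words \<Rightarrow> ('k, 't, 'v) words" where
  "cmap = linext fscale (\<lambda>(c, w). block_sum f w (tword V c))"

lemma word_lin_cmap: "word_lin V fscale (\<lambda>c w. block_sum f w (tword V c))"
proof (rule word_linI)
  show "multilin V (\<lambda>w. block_sum f w (tword V c))" for c
    by (rule multilin_block_sum[OF multilin_tword])
next
  fix c c' w assume w: "w \<in> L"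
  show "block_sum f w (tword V (c + c')) = block_sum f w (tword V c) + block_sum f w (tword V c')"
  proof (cases w)
    case (Cons x w')
    have "blocks f [x] w' (tword V (c + c')) = blocks f [x] w' (\<lambda>l. tword V c l + tword V c' l)"
      by (rule blocks_cong) (use w Cons in \<open>auto simp: tword_add\<close>)
    then show ?thesis by (simp add: Cons blocks_plus)
  qed (simp add: tword_add)
next
  fix r c w assume w: "w \<in> L"
  have *: "blocks f s w (\<lambda>l. fscale r (g l)) = fscale r (blocks f s w g)" for s w and g :: "_ \<Rightarrow> ('k, 't, 'v) words"
    by (induction w arbitrary: s g) (simp_all add: fspace.scale_right_distrib)
  show "block_sum f w (tword V (vec r * c)) = fscale r (block_sum f w (tword V c))"
  proof (cases w)
    case (Cons x w')
    have "blocks f [x] w' (tword V (vec r * c)) = blocks f [x] w' (\<lambda>l. fscale r (tword V c l))"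
      by (rule blocks_cong) (use w Cons in \<open>auto simp: tword_scale\<close>)
    then show ?thesis by (simp add: Cons *)
  qed (simp add: tword_scale)
next
  fix c c' x w assume x: "x \<in> gcar V" and w: "w \<in> L"
  have "blocks f (x # p) w (tword V (c * c')) = blocks f (lact V c' x # p) w (tword V c)" if "p \<in> L" for p
    using w that
  proof (induction w arbitrary: p)
    case Nil
    then show ?case using x by (simp add: letter_cochainD(3)[OF f] tword_lact)
  next
    case (Cons a w)
    have "blocks f [a] w (\<lambda>l. tword V (c * c') (f (x # p) # l)) = blocks f [a] w (\<lambda>l. tword V c (f (lact V c' x # p) # l))"
      by (rule blocks_cong) (use x Cons in \<open>auto simp: letter_cochainD(3)[OF f] tword_lact\<close>)
    with Cons show ?case by simp
  qed
  from this[of "[]"] show "block_sum f (x # w) (tword V (c * c')) = block_sum f (lact V c' x # w) (tword V c)"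
    by simp
qed

lemma cmap_tword: "w \<in> L \<Longrightarrow> cmap (tword V c w) = block_sum f w (tword V c)"
  unfolding cmap_def by (rule linext_tword_fscale[OF word_lin_cmap])

lemma cmap_add: "cmap (x + y) = cmap x + cmap y"
  unfolding cmap_def by (rule linext_fscale_add)

lemma cmap_0 [simp]: "cmap 0 = 0"
  by (simp add: cmap_def)

lemma blocks_hom:
  assumes h: "\<And>x y. x \<in> Z \<Longrightarrow> y \<in> Z \<Longrightarrow> h (x + y) = h x + h y"
    "\<And>x y. x \<in> Z \<Longrightarrow> y \<in> Z \<Longrightarrow> x + y \<in> Z"
  shows "s \<in> L \<Longrightarrow> w \<in> L \<Longrightarrow> (\<And>l. l \<in> L \<Longrightarrow> g l \<in> Z) \<Longrightarrow>
    h (blocks f s w g) = blocks f s w (\<lambda>l. h (g l)) \<and> blocks f s w g \<in> Z"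
proof (induction w arbitrary: s g)
  case (Cons x w)
  have "h (blocks f (s @ [x]) w g) = blocks f (s @ [x]) w (\<lambda>l. h (g l)) \<and> blocks f (s @ [x]) w g \<in> Z"
    using Cons(2-) by (intro Cons(1)) auto
  moreover have "h (blocks f [x] w (\<lambda>l. g (f s # l))) = blocks f [x] w (\<lambda>l. h (g (f s # l))) \<and> blocks f [x] w (\<lambda>l. g (f s # l)) \<in> Z"
    using Cons(2-) by (intro Cons(1)) auto
  ultimately show ?case using h by simp
qed simp

lemma cmap_tword_hom:
  assumes w: "w \<in> L" and h: "\<And>x y. x \<in> gcar T \<Longrightarrow> y \<in> gcar T \<Longrightarrow> h (x + y) = h x + h y"
  shows "h (cmap (tword V c w)) = block_sum f w (\<lambda>l. h (tword V c l))"
proof (cases w)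
  case (Cons x w')
  then show ?thesis
    using blocks_hom[of "gcar T" h "[x]" w' "tword V c"] w h by (simp add: cmap_tword gcar_tensor_add)
qed (simp add: cmap_tword)

lemma cmap_tword_gcar: "w \<in> L \<Longrightarrow> cmap (tword V c w) \<in> gcar T"
  using blocks_hom[of "gcar T" id "[hd w]" "tl w" "tword V c"]
  by (cases w) (auto simp: cmap_tword gcar_tensor_add)

lemma cmap_lact: "z \<in> gcar T \<Longrightarrow> cmap (lact T c z) = lact T c (cmap z)"
proof (rule gcar_tensor_eqI[where z = z])
  fix d w assume w: "w \<in> L"
  have "lact T c (cmap (tword V d w)) = block_sum f w (\<lambda>l. lact T c (tword V d l))"
    by (rule cmap_tword_hom[OF w]) (simp add: lact_tensor_add)
  also have "\<dots> = block_sum f w (tword V (c * d))"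
    by (rule block_sum_cong[OF w]) (simp add: lact_tword)
  finally show "cmap (lact T c (tword V d w)) = lact T c (cmap (tword V d w))"
    using w by (simp add: lact_tword cmap_tword)
qed (simp_all add: cmap_add lact_tensor_0 lact_tensor_add)

lemma blocks_last:
  assumes "x \<in> gcar V"
  shows "s \<in> L \<Longrightarrow> w \<in> L \<Longrightarrow> (\<And>l y. l \<in> L \<Longrightarrow> y \<in> gcar V \<Longrightarrow> g (l @ [ract V y c]) = g' (l @ [y])) \<Longrightarrow>
    blocks f s (w @ [ract V x c]) g = blocks f s (w @ [x]) g'"
proof (induction w arbitrary: s g g')
  case Nil
  then show ?case
    using assms Nil(3)[of "[]" "f (s @ [x])"] Nil(3)[of "[f s]" "f [x]"] letter_cochainD(4)[OF f, of x "[]" c]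
    by (simp add: letter_cochainD(4)[OF f])
next
  case (Cons a w)
  have "blocks f (s @ [a]) (w @ [ract V x c]) g = blocks f (s @ [a]) (w @ [x]) g'"
    using Cons(2-) by (intro Cons(1)) auto
  moreover have "blocks f [a] (w @ [ract V x c]) (\<lambda>l. g (f s # l)) = blocks f [a] (w @ [x]) (\<lambda>l. g' (f s # l))"
    using Cons(2-3) Cons(4)[of "f s # _"] by (intro Cons(1)) auto
  ultimately show ?case by simp
qed

lemma cmap_ract: "z \<in> gcar T \<Longrightarrow> cmap (ract T z c) = ract T (cmap z) c"
proof (rule gcar_tensor_eqI[where z = z])
  fix d w assume w: "w \<in> L"
  show "cmap (ract T (tword V d w) c) = ract T (cmap (tword V d w)) c"
  proof (cases w rule: rev_cases)
    case (snoc w' x)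
    with w have x: "x \<in> gcar V" and w': "w' \<in> L" by auto
    have "cmap (ract T (tword V d w) c) = block_sum f (w' @ [ract V x c]) (tword V d)"
      using x w' by (simp add: snoc ract_tword_snoc cmap_tword)
    also have "\<dots> = block_sum f (w' @ [x]) (\<lambda>l. ract T (tword V d l) c)"
    proof (cases w')
      case Nil
      then show ?thesis
        using x ract_tword_snoc[of "[]" "f [x]" d c] letter_cochainD(4)[OF f, of x "[]" c] by simp
    next
      case (Cons a v)
      then have "blocks f [a] (v @ [ract V x c]) (tword V d) = blocks f [a] (v @ [x]) (\<lambda>l. ract T (tword V d l) c)"
        using w' x by (intro blocks_last) (simp_all add: ract_tword_snoc)
      then show ?thesis by (simp add: Cons)
    qed
    also have "\<dots> = ract T (cmap (tword V d w)) c"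
      unfolding snoc[symmetric] by (rule cmap_tword_hom[OF w, symmetric]) (simp add: ract_tensor_add)
    finally show ?thesis .
  qed (simp add: ract_tword_Nil cmap_tword)
qed (simp_all add: cmap_add ract_tensor_0 ract_tensor_add)

lemma blocks_homog_closed:
  assumes Z: "\<And>x y. x \<in> Z \<Longrightarrow> y \<in> Z \<Longrightarrow> x + y \<in> Z"
  shows "s \<in> hwords V \<Longrightarrow> w \<in> hwords V \<Longrightarrow>
    (\<And>l. l \<in> hwords V \<Longrightarrow> sum_list (map fst l) = sum_list (map fst s) + sum_list (map fst w) \<Longrightarrow> g (map snd l) \<in> Z) \<Longrightarrow>
    blocks f (map snd s) (map snd w) g \<in> Z"
proof (induction w arbitrary: s g)
  case Nil
  then show ?case
    using letter_cochainD(5)[OF f Nil(1)] Nil(3)[of "[(sum_list (map fst s), f (map snd s))]"]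
    by (simp add: hwords_def)
next
  case (Cons a w)
  then have a: "s @ [a] \<in> hwords V" "[a] \<in> hwords V" and w: "w \<in> hwords V" by (auto simp: hwords_def)
  have "blocks f (map snd (s @ [a])) (map snd w) g \<in> Z"
    by (rule Cons(1)[OF a(1) w]) (rule Cons(4), simp_all)
  moreover have "blocks f (map snd [a]) (map snd w) (\<lambda>l. g (f (map snd s) # l)) \<in> Z"
  proof (rule Cons(1)[OF a(2) w])
    fix l assume l: "l \<in> hwords V" "sum_list (map fst l) = sum_list (map fst [a]) + sum_list (map fst w)"
    have "(sum_list (map fst s), f (map snd s)) # l \<in> hwords V"
      using l letter_cochainD(5)[OF f Cons(2)] by (simp add: hwords_def)
    from Cons(4)[OF this] l show "g (f (map snd s) # map snd l) \<in> Z" by simp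
  qed
  ultimately show ?case by (simp add: Z)
qed

lemma cmap_degree: "z \<in> gcomp T n \<Longrightarrow> cmap z \<in> gcomp T n"
proof (induction rule: gcomp_tensor_induct)
  case zero
  then show ?case by (simp add: gcomp_tensor fspace.span_zero)
next
  case (add c w y)
  have Z: "x \<in> gcomp T n \<Longrightarrow> y \<in> gcomp T n \<Longrightarrow> x + y \<in> gcomp T n" for x y
    by (auto simp: gcomp_tensor fspace.span_add)
  have "block_sum f (map snd w) (tword V c) \<in> gcomp T n"
  proof (cases w)
    case Nil
    then show ?thesis using tword_gcomp[of "[]" c] add(2) by (simp add: hwords_def)
  next
    case (Cons a v)
    then have "[a] \<in> hwords V" "v \<in> hwords V" using add(1) by (auto simp: hwords_def)
    then have "blocks f (map snd [a]) (map snd v) (tword V c) \<in> gcomp T n"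
    proof (rule blocks_homog_closed[OF Z, rotated 2])
      fix l assume "l \<in> hwords V" "sum_list (map fst l) = sum_list (map fst [a]) + sum_list (map fst v)"
      then show "tword V c (map snd l) \<in> gcomp T n"
        using tword_gcomp[of l c] add(2) Cons by simp
    qed
    then show ?thesis by (simp add: Cons)
  qed
  with add show ?case by (simp add: cmap_add Z cmap_tword hwords_lists)
qed

lemma bimod_hom_cmap: "bimod_hom T T 0 cmap"
  by (auto simp: bimod_hom_def cmap_add cmap_lact cmap_ract cmap_degree)

lemma cmap_comult:
  assumes "z \<in> gcar T"
  shows "\<Delta> (cmap z) = tensor_map T T T 0 cmap cmap (\<Delta> z)"
  using assms
proof (rule gcar_tensor_eqI)
  fix c w assume w: "w \<in> L"
  define h where "h u v = pure_tensor T T (tword V c u) (tword V 1 v)" for u v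
  have k0: "map (koszul V 0) u = u" if "u \<in> L" for u
    using that by (auto simp: koszul_trivial in_lists_conv_set intro!: map_idI)
  have "\<Delta> (cmap (tword V c w)) = block_sum f w (\<lambda>l. \<Delta> (tword V c l))"
    by (rule cmap_tword_hom[OF w]) (simp add: comult_add)
  also have "\<dots> = block_sum f w (\<lambda>l. deconc l h)"
    unfolding h_def by (rule block_sum_cong[OF w]) (simp add: comult_tword)
  also have "\<dots> = deconc w (\<lambda>u v. block_sum f u (\<lambda>l. block_sum f v (h l)))"
    by (rule block_sum_deconc)
  also have "\<dots> = tensor_map T T T 0 cmap cmap (\<Delta> (tword V c w))"
  proof (subst tensor_map_comult_tword[OF bimod_hom_cmap bimod_hom_cmap w], rule deconc_cong_lists[OF w])
    fix u v assume *: "u \<in> L" "v \<in> L"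
    have "pure_tensor T T (cmap (tword V c u)) (cmap (tword V 1 v)) =
        block_sum f u (\<lambda>l. pure_tensor T T (tword V c l) (cmap (tword V 1 v)))"
      by (rule cmap_tword_hom[OF *(1)]) (simp add: pure_tensor_add_left cmap_tword_gcar *)
    also have "\<dots> = block_sum f u (\<lambda>l. block_sum f v (h l))"
    proof -
      have "pure_tensor T T (tword V c l) (cmap (tword V 1 v)) = block_sum f v (h l)" if "l \<in> L" for l
        unfolding h_def by (rule cmap_tword_hom[OF *(2)]) (simp add: pure_tensor_add_right that)
      then show ?thesis
        by (intro block_sum_cong[OF *(1)])
    qed
    finally show "block_sum f u (\<lambda>l. block_sum f v (h l)) =
        pure_tensor T T (cmap (tword V c (map (koszul V 0) u))) (cmap (tword V 1 v))"
      using * by (simp add: k0)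
  qed
  finally show "\<Delta> (cmap (tword V c w)) = tensor_map T T T 0 cmap cmap (\<Delta> (tword V c w))" .
qed (simp_all add: cmap_add comult_add tensor_map_add)

lemma cmap_counit: "z \<in> gcar T \<Longrightarrow> \<epsilon> (cmap z) = \<epsilon> z"
proof (rule gcar_tensor_eqI[where z = z])
  fix c w assume w: "w \<in> L"
  have "\<epsilon> (cmap (tword V c w)) = block_sum f w (\<lambda>l. \<epsilon> (tword V c l))"
    by (rule cmap_tword_hom[OF w]) (simp add: counit_add)
  also have "\<dots> = block_sum f w (\<lambda>l. if l = [] then c else 0)"
    by (rule block_sum_cong[OF w]) (simp add: counit_tword)
  also have "\<dots> = \<epsilon> (tword V c w)"
    by (cases w) (use w in \<open>auto simp: counit_tword blocks_zero\<close>)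
  finally show "\<epsilon> (cmap (tword V c w)) = \<epsilon> (tword V c w)" .
qed (simp_all add: cmap_add counit_add)

lemma cmap_unit: "cmap (tword V c []) = tword V c []"
  by (simp add: cmap_tword)

lemma tproj_cmap:
  assumes w: "w \<in> L"
  shows "tproj V (cmap (tword V c w)) = lact V c (f w)"
proof -
  have "tproj V (cmap (tword V c w)) = block_sum f w (\<lambda>l. tproj V (tword V c l))"
    by (rule cmap_tword_hom[OF w]) (simp add: tproj_add)
  also have "\<dots> = block_sum f w (\<lambda>l. case l of [x] \<Rightarrow> lact V c x | _ \<Rightarrow> 0)"
    by (rule block_sum_cong[OF w]) (simp add: tproj_tword)
  also have "\<dots> = lact V c (f w)"
  proof (cases w)
    case (Cons x w')
    have "blocks f [x] w' (\<lambda>l. case l of [x] \<Rightarrow> lact V c x | _ \<Rightarrow> 0) = (case [f ([x] @ w')] of [x] \<Rightarrow> lact V c x | _ \<Rightarrow> 0)"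
      by (rule blocks_letters) (auto split: list.split)
    then show ?thesis by (simp add: Cons)
  qed (simp add: letter_cochainD(2)[OF f])
  finally show ?thesis .
qed

end

end

subsection \<open>Dependence on the underlying graded bimodule\<close>

lemma gcar_cong: "gcomp X = gcomp Y \<Longrightarrow> gcar X = gcar Y"
  by (simp add: gcar_def)

lemma koszul_cong: "gcomp X = gcomp Y \<Longrightarrow> koszul X = koszul Y"
  by (simp add: koszul_def hcomps_def fun_eq_iff)

lemma pure_tensor_cong:
  assumes "gcomp X = gcomp Y" "lact X = lact Y" "ract X = ract Y"
  shows "pure_tensor X X = pure_tensor Y Y"
  using assms gcar_cong[OF assms(1)] by (simp add: pure_tensor_def tensor_rels_def fun_eq_iff)

lemma tensor_map_cong:
  assumes "gcomp X = gcomp Y" and "gcomp X' = gcomp Y'" "lact X' = lact Y'" "ract X' = ract Y'"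
  shows "tensor_map X X' X' = tensor_map Y Y' Y'"
  using pure_tensor_cong[OF assms(2-4)] koszul_cong[OF assms(1)] by (simp add: tensor_map_def fun_eq_iff)

lemma bimod_hom_cong:
  assumes "gcomp X = gcomp X'" "lact X = lact X'" "ract X = ract X'"
    and "gcomp Y = gcomp Y'" "lact Y = lact Y'" "ract Y = ract Y'"
  shows "bimod_hom X Y p f = bimod_hom X' Y' p f"
  using assms gcar_cong[OF assms(1)] by (simp add: bimod_hom_def)

context graded_bimodule
begin

lemma gcar_tensor_coalg [simp]: "gcar (tensor_coalg V) = gcar T"
  by (rule gcar_cong) simp

lemma coderivation_iff:
  "coderivation (tensor_coalg V) q D \<longleftrightarrow> bimod_hom T T q D \<and>
    (\<forall>z\<in>gcar T. \<Delta> (D z) = tensor_map T T T 0 D id (\<Delta> z) + tensor_map T T T q id D (\<Delta> z))"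
proof -
  have "bimod_hom (tensor_coalg V) (tensor_coalg V) q D = bimod_hom T T q D"
    by (rule bimod_hom_cong) simp_all
  then show ?thesis by (simp add: coderivation_def tensor_map_cong[of "tensor_coalg V" T "tensor_coalg V" T])
qed

lemma coderivation_cod: "letter_cochain V q b \<Longrightarrow> coderivation (tensor_coalg V) q (cod q b)"
  by (simp add: coderivation_iff bimod_hom_cod cod_comult)

definition coalg_map :: "(('k, 't, 'v) words \<Rightarrow> ('k, 't, 'v) words) \<Rightarrow> bool" where
  "coalg_map F \<longleftrightarrow> bimod_hom T T 0 F \<and> (\<forall>z\<in>gcar T. \<Delta> (F z) = tensor_map T T T 0 F F (\<Delta> z)) \<and>
    (\<forall>z\<in>gcar T. \<epsilon> (F z) = \<epsilon> z) \<and> (\<forall>c. F (tword V c []) = tword V c [])"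

lemma coalg_map_cmap: "letter_cochain V 0 f \<Longrightarrow> coalg_map (cmap f)"
  by (simp add: coalg_map_def bimod_hom_cmap cmap_comult cmap_counit cmap_unit)

lemmas bimod_hom_id' = bimod_hom_id[unfolded id_def]

subsection \<open>Uniqueness of coderivations and of coalgebra maps\<close>

lemma pure_tensor_diff_left: "x \<in> gcar T \<Longrightarrow> x' \<in> gcar T \<Longrightarrow> y \<in> gcar T \<Longrightarrow>
    pure_tensor T T (x - x') y = pure_tensor T T x y - pure_tensor T T x' y"
  using pure_tensor_add_left[of "x - x'" T x' y T] graded_bimodule.gcar_diff[OF graded_tensor] by simp

lemma pure_tensor_diff_right: "x \<in> gcar T \<Longrightarrow> y \<in> gcar T \<Longrightarrow> y' \<in> gcar T \<Longrightarrow>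
    pure_tensor T T x (y - y') = pure_tensor T T x y - pure_tensor T T x y'"
  using pure_tensor_add_right[of x T "y - y'" T y'] graded_bimodule.gcar_diff[OF graded_tensor] by simp

lemma bimod_hom_comp:
  assumes f: "bimod_hom T T p f" and g: "bimod_hom T T p' g"
  shows "bimod_hom T T (p + p') (\<lambda>z. f (g z))"
  unfolding bimod_hom_def
  using bimod_homD(4)[OF f bimod_homD(4)[OF g]]
  by (auto simp: bimod_homD(1-3)[OF f] bimod_homD(1-3)[OF g] tensor_hom_gcar[OF g] algebra_simps)

lemma bimod_hom_diff:
  assumes f: "bimod_hom T T p f" and g: "bimod_hom T T p g"
  shows "bimod_hom T T p (\<lambda>z. f z - g z)"
proof -
  interpret T: graded_bimodule T by (rule graded_tensor)
  note [simp] = tensor_hom_gcar[OF f] tensor_hom_gcar[OF g]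
  have d: "x \<in> gcomp T n \<Longrightarrow> y \<in> gcomp T n \<Longrightarrow> x - y \<in> gcomp T n" for x y n
    using T.comp_add[of x n "- y"] T.comp_uminus by simp
  have l: "lact T c (x - y) = lact T c x - lact T c y" "ract T (x - y) c = ract T x c - ract T y c" for x y c
    using lact_tensor_add[of c "x - y" y] ract_tensor_add[of "x - y" y c] by simp_all
  show ?thesis
    unfolding bimod_hom_def by (auto simp: bimod_homD[OF f] bimod_homD[OF g] l intro!: d)
qed

lemmas tensor_map_pure' = tensor_map_pure[OF graded_tensor graded_tensor graded_tensor graded_tensor]

text \<open>
  The difference of \<open>F\<close> and \<open>G\<close> is a coderivation along \<open>F\<close> and \<open>G\<close>, so \<open>rigidity\<close> applies.
\<close>

theorem coalg_map_unique:
  assumes F: "coalg_map F" and G: "coalg_map G"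
    and proj: "\<And>c w. w \<in> L \<Longrightarrow> tproj V (F (tword V c w)) = tproj V (G (tword V c w))"
    and z: "z \<in> gcar T"
  shows "F z = G z"
proof -
  interpret T: graded_bimodule T by (rule graded_tensor)
  have f: "bimod_hom T T 0 F" and g: "bimod_hom T T 0 G"
    using F G by (simp_all add: coalg_map_def)
  define X where "X z = F z - G z" for z
  have x': "bimod_hom T T 0 (\<lambda>z. F z - G z)"
    by (rule bimod_hom_diff[OF f g])
  then have x: "bimod_hom T T 0 X"
    by (simp add: X_def[abs_def])
  note [simp] = tensor_hom_gcar[OF f] tensor_hom_gcar[OF g]
  have "tensor_map T T T 0 F F t = tensor_map T T T 0 X F t + tensor_map T T T 0 G X t + tensor_map T T T 0 G G t"
    if "t \<in> tensors T T" for t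
    using that
    by (rule tensors_eqI)
      (simp_all add: tensor_map_add tensor_map_pure'[OF f f] tensor_map_pure'[OF x' f] tensor_map_pure'[OF g x']
        tensor_map_pure'[OF g g] X_def T.koszul_trivial pure_tensor_diff_left pure_tensor_diff_right)
  then have "\<Delta> (X z) = tensor_map T T T 0 X F (\<Delta> z) + tensor_map T T T 0 G X (\<Delta> z)" if "z \<in> gcar T" for z
    using that F G comult_add[of "F z - G z" "G z"] by (simp add: coalg_map_def X_def comult_tensors)
  moreover have "tproj V (X (tword V c w)) = 0" if "w \<in> L" for c w
    using tproj_add[of "X (tword V c w)" "G (tword V c w)"] proj[OF that] that by (simp add: X_def)
  ultimately have "X z = 0"
    using F G by (intro rigidity[OF x f g _ _ _ _ _ z]) (simp_all add: coalg_map_def)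
  then show ?thesis by (simp add: X_def)
qed

text \<open>
  Both \<open>F D\<close> and \<open>D' F\<close> are coderivations along \<open>F\<close>; the signs agree since \<open>F\<close> has degree zero.
\<close>

theorem coalg_map_intertwines:
  assumes F: "coalg_map F" and D: "coderivation (tensor_coalg V) q D" and D': "coderivation (tensor_coalg V) q D'"
    and proj: "\<And>c w. w \<in> L \<Longrightarrow> tproj V (F (D (tword V c w))) = tproj V (D' (F (tword V c w)))"
    and z: "z \<in> gcar T"
  shows "F (D z) = D' (F z)"
proof -
  interpret T: graded_bimodule T by (rule graded_tensor)
  have f: "bimod_hom T T 0 F" and d: "bimod_hom T T q D" and d': "bimod_hom T T q D'"
    using F D D' by (simp_all add: coalg_map_def coderivation_iff)
  define X where "X z = F (D z) - D' (F z)" for z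
  have x': "bimod_hom T T q (\<lambda>z. F (D z) - D' (F z))"
    using bimod_hom_comp[OF f d] bimod_hom_comp[OF d' f] by (intro bimod_hom_diff) simp_all
  then have x: "bimod_hom T T q X"
    by (simp add: X_def[abs_def])
  note [simp] = tensor_hom_gcar[OF f] tensor_hom_gcar[OF d]
    tensor_hom_gcar[OF d']
  note k = koszul_bimod_hom[OF graded_tensor graded_tensor f]
  have "tensor_map T T T 0 F F (tensor_map T T T 0 D id t + tensor_map T T T q id D t) =
      tensor_map T T T 0 X F t + tensor_map T T T q F X t +
      (tensor_map T T T 0 D' id (tensor_map T T T 0 F F t) + tensor_map T T T q id D' (tensor_map T T T 0 F F t))"
    if "t \<in> tensors T T" for t
    using that
    by (rule tensors_eqI)
      (simp_all add: tensor_map_add tensor_map_pure'[OF f f] tensor_map_pure'[OF x' f] tensor_map_pure'[OF f x']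
        tensor_map_pure'[OF d bimod_hom_id'] tensor_map_pure'[OF bimod_hom_id' d]
        tensor_map_pure'[OF d' bimod_hom_id'] tensor_map_pure'[OF bimod_hom_id' d']
        X_def pure_tensor_diff_left pure_tensor_diff_right T.koszul_trivial k)
  then have "\<Delta> (X z) = tensor_map T T T 0 X F (\<Delta> z) + tensor_map T T T q F X (\<Delta> z)" if "z \<in> gcar T" for z
    using that F D D' comult_add[of "F (D z) - D' (F z)" "D' (F z)"]
    by (simp add: coalg_map_def coderivation_iff X_def comult_tensors)
  moreover have "tproj V (X (tword V c w)) = 0" if "w \<in> L" for c w
    using tproj_add[of "X (tword V c w)" "D' (F (tword V c w))"] proj[OF that] that by (simp add: X_def)
  ultimately have "X z = 0"
    using F by (intro rigidity[OF x f f _ _ _ _ _ z]) (simp_all add: coalg_map_def)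
  then show ?thesis by (simp add: X_def)
qed

lemma coalg_map_id: "coalg_map id"
proof -
  interpret T: graded_bimodule T by (rule graded_tensor)
  have "tensor_map T T T 0 id id t = t" if "t \<in> tensors T T" for t
    using that
    by (rule tensors_eqI) (simp_all add: tensor_map_add tensor_map_pure'[OF bimod_hom_id' bimod_hom_id'] T.koszul_trivial)
  then show ?thesis
    by (simp add: coalg_map_def bimod_hom_id comult_tensors)
qed

lemma coalg_map_comp:
  assumes F: "coalg_map F" and G: "coalg_map G"
  shows "coalg_map (\<lambda>z. F (G z))"
proof -
  interpret T: graded_bimodule T by (rule graded_tensor)
  have f: "bimod_hom T T 0 F" and g: "bimod_hom T T 0 G"
    using F G by (simp_all add: coalg_map_def)
  have fg: "bimod_hom T T 0 (\<lambda>z. F (G z))"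
    using bimod_hom_comp[OF f g] by simp
  note [simp] = tensor_hom_gcar[OF f] tensor_hom_gcar[OF g]
  have "tensor_map T T T 0 F F (tensor_map T T T 0 G G t) = tensor_map T T T 0 (\<lambda>z. F (G z)) (\<lambda>z. F (G z)) t"
    if "t \<in> tensors T T" for t
    using that
    by (rule tensors_eqI)
      (simp_all add: tensor_map_add tensor_map_pure'[OF f f] tensor_map_pure'[OF g g] tensor_map_pure'[OF fg fg] T.koszul_trivial)
  with F G fg show ?thesis
    by (simp add: coalg_map_def comult_tensors)
qed

lemma coderivation_cong:
  assumes D: "coderivation (tensor_coalg V) q D" and eq: "\<And>z. z \<in> gcar T \<Longrightarrow> D z = D' z"
  shows "coderivation (tensor_coalg V) q D'"
proof -
  interpret T: graded_bimodule T by (rule graded_tensor)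
  have d: "bimod_hom T T q D" using D by (simp add: coderivation_iff)
  have deg: "D' x \<in> gcomp T (i + q)" if "x \<in> gcomp T i" for x i
    using bimod_homD(4)[OF d that] eq[OF gcar_gcomp[OF that]] by simp
  have d': "bimod_hom T T q D'"
    unfolding bimod_hom_def by (simp add: eq[symmetric] bimod_homD(1-3)[OF d]) (simp add: deg)
  have "tensor_map T T T 0 D id t = tensor_map T T T 0 D' id t" "tensor_map T T T q id D t = tensor_map T T T q id D' t"
    if "t \<in> tensors T T" for t
    using that
    by (rule tensors_eqI;
        simp add: tensor_map_add tensor_map_pure'[OF d bimod_hom_id'] tensor_map_pure'[OF bimod_hom_id' d]
          tensor_map_pure'[OF d' bimod_hom_id'] tensor_map_pure'[OF bimod_hom_id' d'] eq)+
  with D d' eq show ?thesis by (simp add: coderivation_iff comult_tensors)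
qed

corollary coderivation_unique:
  assumes "coderivation (tensor_coalg V) q D" "coderivation (tensor_coalg V) q D'"
    and "\<And>c w. w \<in> L \<Longrightarrow> tproj V (D (tword V c w)) = tproj V (D' (tword V c w))" and "z \<in> gcar T"
  shows "D z = D' z"
  using coalg_map_intertwines[OF coalg_map_id assms(1,2)] assms(3,4) by simp

text \<open>
  In the coproduct of \<open>D\<^sup>2\<close> the two terms with one \<open>D\<close> in each factor carry opposite signs as \<open>D\<close> is
  odd, so \<open>D\<^sup>2\<close> is itself a coderivation.
\<close>

theorem coderivation_square_zero:
  assumes D: "coderivation (tensor_coalg V) q D" and q: "odd q"
    and proj: "\<And>c w. w \<in> L \<Longrightarrow> tproj V (D (D (tword V c w))) = 0"
    and z: "z \<in> gcar T"
  shows "D (D z) = 0"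
proof -
  interpret T: graded_bimodule T by (rule graded_tensor)
  have d: "bimod_hom T T q D" using D by (simp add: coderivation_iff)
  have dd: "bimod_hom T T (q + q) (\<lambda>z. D (D z))" by (rule bimod_hom_comp[OF d d])
  note [simp] = tensor_hom_gcar[OF d]
  note k = koszul_bimod_hom[OF graded_tensor graded_tensor d]
  have sgn: "ksgn (q * q) x = - x" for x :: "('k, 't, 'v) words"
    using q by (simp add: ksgn_def)
  have neg: "pure_tensor T T (- x) y = - pure_tensor T T x y" if "x \<in> gcar T" "y \<in> gcar T" for x y
    using pure_tensor_diff_left[of 0 x y] that by (simp add: gcar_tensor_0)
  have "tensor_map T T T 0 D id (tensor_map T T T 0 D id t + tensor_map T T T q id D t)
      + tensor_map T T T q id D (tensor_map T T T 0 D id t + tensor_map T T T q id D t)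
      = tensor_map T T T 0 (\<lambda>z. D (D z)) id t + tensor_map T T T 0 id (\<lambda>z. D (D z)) t"
    if "t \<in> tensors T T" for t
    using that
    by (rule tensors_eqI)
      (simp_all add: tensor_map_add tensor_map_pure'[OF d bimod_hom_id'] tensor_map_pure'[OF bimod_hom_id' d]
        tensor_map_pure'[OF dd bimod_hom_id'] tensor_map_pure'[OF bimod_hom_id' dd] T.koszul_trivial
        k sgn neg T.koszul_koszul)
  then have "\<Delta> (D (D z)) = tensor_map T T T 0 (\<lambda>z. D (D z)) id (\<Delta> z) + tensor_map T T T 0 id (\<lambda>z. D (D z)) (\<Delta> z)"
    if "z \<in> gcar T" for z
    using that D by (simp add: coderivation_iff comult_tensors)
  then show ?thesis
    by (intro rigidity[OF dd bimod_hom_id bimod_hom_id _ _ _ _ proj z]) simp_all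
qed

end

section \<open>Suspensions, kernels and products of graded bimodules\<close>

lemma susp_sel [simp]:
  "gcomp (susp V) i = gcomp V (i - 1)" "lact (susp V) = lact V" "ract (susp V) = ract V"
  by (simp_all add: susp_def)

lemma kernel_bimod_sel [simp]:
  "gcomp (kernel_bimod V h) i = {x \<in> gcomp V i. h x = 0}" "lact (kernel_bimod V h) = lact V" "ract (kernel_bimod V h) = ract V"
  by (simp_all add: kernel_bimod_def)

lemma graded_bimodule_cong:
  assumes "gcomp X = gcomp Y" "lact X = lact Y" "ract X = ract Y"
  shows "graded_bimodule X = graded_bimodule Y"
  using assms gcar_cong[OF assms(1)] by (simp add: graded_bimodule_def)

context graded_bimodule
begin

lemma gcar_susp [simp]: "gcar (susp V) = gcar V"
proof (intro equalityI subsetI)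
  fix x assume "x \<in> gcar (susp V)"
  then show "x \<in> gcar V"
    by (induction rule: gcar_induct) (auto intro: gcar_gcomp)
next
  fix x assume "x \<in> gcar V"
  then show "x \<in> gcar (susp V)"
  proof (induction rule: gcar_induct)
    case zero
    show ?case by (rule gcar_gcomp[of _ _ 0]) (simp add: comp_zero)
  next
    case (add i x y)
    have "x \<in> gcar (susp V)" by (rule gcar_gcomp[of _ _ "i + 1"]) (simp add: add)
    with add show ?case by (intro gcar_add) (simp_all add: comp_zero comp_add)
  qed
qed

lemma graded_susp: "graded_bimodule (susp V)"
proof
  fix I z and i :: int
  assume *: "finite I" "\<And>i. i \<in> I \<Longrightarrow> z i \<in> gcomp (susp V) i" "sum z I = 0" "i \<in> I"
  have "(\<Sum>j\<in>(\<lambda>i. i - 1) ` I. z (j + 1)) = 0"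
    using *(3) by (subst sum.reindex) (auto simp: inj_on_def)
  moreover have "z (j + 1) \<in> gcomp V j" if "j \<in> (\<lambda>i. i - 1) ` I" for j
    using *(2)[of "j + 1"] that by auto
  ultimately show "z i = 0"
    using comp_direct[of "(\<lambda>i. i - 1) ` I" "\<lambda>j. z (j + 1)" "i - 1"] *(1,4) by simp
qed (simp_all add: comp_zero comp_add comp_uminus comp_lact comp_ract lact_add_right ract_add_left
    lact_add_left ract_add_right lact_mult ract_mult lact_one ract_one lact_ract central)

context
  fixes h :: "'v \<Rightarrow> 'k ^ 't"
  assumes h: "bimod_hom V base_bimod 0 h"
begin

lemma base_hom_props:
  "x \<in> gcar V \<Longrightarrow> y \<in> gcar V \<Longrightarrow> h (x + y) = h x + h y" "h 0 = 0"
  "x \<in> gcar V \<Longrightarrow> h (lact V c x) = c * h x" "x \<in> gcar V \<Longrightarrow> h (ract V x c) = h x * c"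
  using bimod_homD(1)[OF h, of 0 0] bimod_homD(1-3)[OF h] by (simp_all add: base_bimod_def)

lemma gcar_kernelD: "x \<in> gcar (kernel_bimod V h) \<Longrightarrow> x \<in> gcar V \<and> h x = 0"
  by (induction rule: gcar_induct) (auto simp: base_hom_props gcar_gcomp)

lemma graded_kernel: "graded_bimodule (kernel_bimod V h)"
proof
  fix x i assume "x \<in> gcomp (kernel_bimod V h) i"
  then show "- x \<in> gcomp (kernel_bimod V h) i"
    using base_hom_props(1)[of x "- x"] gcar_gcomp[of x V i] by (simp add: comp_uminus base_hom_props(2))
next
  fix I z and i :: int
  assume "finite I" "\<And>i. i \<in> I \<Longrightarrow> z i \<in> gcomp (kernel_bimod V h) i" "sum z I = 0" "i \<in> I"
  then show "z i = 0"
    using comp_direct[of I z i] by auto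
qed (auto dest!: gcar_kernelD simp: comp_zero comp_add comp_lact comp_ract gcar_gcomp base_hom_props lact_add_right ract_add_left
    lact_add_left ract_add_right lact_mult ract_mult lact_one ract_one lact_ract central)

end

end

lemma gcar_prod:
  assumes Y: "graded_bimodule Y" and Z: "graded_bimodule Z" and X: "\<And>i. gcomp X i = gcomp Y i \<times> gcomp Z i"
  shows "gcar X = gcar Y \<times> gcar Z"
proof (intro equalityI subsetI)
  interpret Y: graded_bimodule Y by fact
  interpret Z: graded_bimodule Z by fact
  fix x assume "x \<in> gcar X"
  then show "x \<in> gcar Y \<times> gcar Z"
  proof (induction rule: gcar_induct)
    case zero
    show ?case by (simp add: zero_prod_def)
  next
    case (add i x y)
    then show ?case by (auto simp: X gcar_gcomp intro!: Y.gcar_plus Z.gcar_plus)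
  qed
next
  interpret Y: graded_bimodule Y by fact
  interpret Z: graded_bimodule Z by fact
  fix x assume "x \<in> gcar Y \<times> gcar Z"
  then obtain y z where x: "x = (y, z)" and y: "y \<in> gcar Y" and z: "z \<in> gcar Z" by blast
  have plus: "p + q \<in> gcar X" if "p \<in> gcar X" "q \<in> gcar X" for p q
    using that by (intro gcar_add) (auto simp: X zero_prod_def Y.comp_zero Z.comp_zero Y.comp_add Z.comp_add)
  have 0: "0 \<in> gcar X"
    by (rule gcar_gcomp[of _ _ 0]) (simp add: X zero_prod_def Y.comp_zero Z.comp_zero)
  from y have "(y, 0) \<in> gcar X"
  proof (induction rule: gcar_induct)
    case (add i p q)
    have "(p, 0) \<in> gcar X" by (rule gcar_gcomp[of _ _ i]) (simp add: X add Z.comp_zero)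
    from plus[OF this add(3)] show ?case by simp
  qed (use 0 in \<open>simp add: zero_prod_def\<close>)
  moreover from z have "(0, z) \<in> gcar X"
  proof (induction rule: gcar_induct)
    case (add i p q)
    have "(0, p) \<in> gcar X" by (rule gcar_gcomp[of _ _ i]) (simp add: X add Y.comp_zero)
    from plus[OF this add(3)] show ?case by simp
  qed (use 0 in \<open>simp add: zero_prod_def\<close>)
  ultimately show "x \<in> gcar X"
    using plus[of "(y, 0)" "(0, z)"] by (simp add: x)
qed

lemma graded_prod:
  assumes Y: "graded_bimodule Y" and Z: "graded_bimodule Z" and X: "\<And>i. gcomp X i = gcomp Y i \<times> gcomp Z i"
    and l: "\<And>c a m. lact X c (a, m) = (lact Y c a, lact Z c m)"
    and r: "\<And>c a m. ract X (a, m) c = (ract Y a c, ract Z m c)"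
  shows "graded_bimodule X"
proof -
  interpret Y: graded_bimodule Y by fact
  interpret Z: graded_bimodule Z by fact
  note c = gcar_prod[OF Y Z X]
  show ?thesis
  proof
    fix I z and i :: int
    assume *: "finite I" "\<And>i. i \<in> I \<Longrightarrow> z i \<in> gcomp X i" "sum z I = 0" "i \<in> I"
    have c: "fst (z j) \<in> gcomp Y j" "snd (z j) \<in> gcomp Z j" if "j \<in> I" for j
      using *(2)[OF that] unfolding X by auto
    have s: "(\<Sum>j\<in>I. fst (z j)) = 0" "(\<Sum>j\<in>I. snd (z j)) = 0"
      using arg_cong[OF *(3), of fst] arg_cong[OF *(3), of snd] by (simp_all add: fst_sum snd_sum)
    have "fst (z i) = 0"
      by (rule Y.comp_direct[of I "\<lambda>j. fst (z j)" i, OF *(1) c(1) s(1) *(4)])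
    moreover have "snd (z i) = 0"
      by (rule Z.comp_direct[of I "\<lambda>j. snd (z j)" i, OF *(1) c(2) s(2) *(4)])
    ultimately show "z i = 0" by (simp add: prod_eq_iff)
  qed (auto simp: X c l r zero_prod_def uminus_prod_def Y.comp_zero Z.comp_zero Y.comp_add Z.comp_add
      Y.comp_uminus Z.comp_uminus Y.comp_lact Z.comp_lact Y.comp_ract Z.comp_ract
      Y.lact_add_right Z.lact_add_right Y.ract_add_left Z.ract_add_left Y.lact_add_left Z.lact_add_left
      Y.ract_add_right Z.ract_add_right Y.lact_mult Z.lact_mult Y.ract_mult Z.ract_mult
      Y.lact_one Z.lact_one Y.ract_one Z.ract_one Y.lact_ract Z.lact_ract Y.central Z.central)
qed

lemma biadditive_gcar:
  assumes V: "graded_bimodule V" and W: "graded_bimodule W" and X: "graded_bimodule X"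
    and l: "\<And>x x' y. x \<in> gcar V \<Longrightarrow> x' \<in> gcar V \<Longrightarrow> y \<in> gcar W \<Longrightarrow> \<phi> (x + x') y = \<phi> x y + \<phi> x' y"
    and r: "\<And>x y y'. x \<in> gcar V \<Longrightarrow> y \<in> gcar W \<Longrightarrow> y' \<in> gcar W \<Longrightarrow> \<phi> x (y + y') = \<phi> x y + \<phi> x y'"
    and d: "\<And>i j x y. x \<in> gcomp V i \<Longrightarrow> y \<in> gcomp W j \<Longrightarrow> \<phi> x y \<in> gcomp X (i + j)"
    and x: "x \<in> gcar V" and y: "y \<in> gcar W"
  shows "\<phi> x y \<in> gcar X"
proof -
  interpret V: graded_bimodule V by fact
  interpret W: graded_bimodule W by fact
  interpret X: graded_bimodule X by fact
  show ?thesis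
    using x
  proof (induction rule: gcar_induct)
    case zero
    show ?case using l[of 0 0 y] y by simp
  next
    case (add i p q)
    note p = gcar_gcomp[OF add(1)]
    have "\<phi> p y \<in> gcar X"
      using y
    proof (induction rule: gcar_induct)
      case zero
      show ?case using r[of p 0 0] p by simp
    next
      case (add j s t)
      then show ?case
        using r[OF p gcar_gcomp[OF add(1)] add(2)] gcar_gcomp[OF d[OF \<open>p \<in> gcomp V i\<close> add(1)]] by simp
    qed
    with l[OF p add(2) y] add(3) show ?case by simp
  qed
qed

section \<open>Corestrictions on the Hochschild extension\<close>

context dg_bimodule
begin

text \<open>
  The letters of the bar construction of \<open>A\<close> and of the extension: \<open>U = sI\<close> and \<open>E = s(I \<oplus> M)\<close> for the
  augmentation ideal \<open>I\<close>.
\<close>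

abbreviation "U \<equiv> susp (aug_ideal A)"
abbreviation "E \<equiv> susp (kernel_bimod (ext_bimod A M) (\<lambda>(a, m). aug A a))"

lemma graded_U: "graded_bimodule U"
  by (rule graded_bimodule.graded_susp[OF A.graded_kernel[OF A.aug_hom]])

lemma ext_bimod_sel [simp]:
  "gcomp (ext_bimod A M) i = gcomp A i \<times> gcomp M i"
  "lact (ext_bimod A M) c (a, m) = (lact A c a, lact M c m)"
  "ract (ext_bimod A M) (a, m) c = (ract A a c, ract M m c)"
  by (simp_all add: ext_bimod_def)

lemma graded_ext_bimod: "graded_bimodule (ext_bimod A M)"
  by (rule graded_prod[OF A.graded_bimodule_axioms graded_bimodule_axioms]) simp_all

lemma gcomp_E: "gcomp E i = gcomp U i \<times> gcomp (susp M) i"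
  by auto

lemma gcar_E: "gcar E = gcar U \<times> gcar M"
  using gcar_prod[OF graded_U graded_susp gcomp_E] by simp

lemma graded_E: "graded_bimodule E"
  by (rule graded_prod[OF graded_U graded_susp gcomp_E]) simp_all

interpretation U: graded_bimodule U by (rule graded_U)
interpretation E: graded_bimodule E by (rule graded_E)

lemma gcar_U: "a \<in> gcar U \<Longrightarrow> a \<in> gcar A" "a \<in> gcar U \<Longrightarrow> aug A a = 0"
  using graded_bimodule.gcar_susp[OF A.graded_kernel[OF A.aug_hom]] A.gcar_kernelD[OF A.aug_hom, of a] by auto

lemma fst_hom: "bimod_hom E U 0 fst"
  by (auto simp: bimod_hom_def gcar_E)

lemma koszul_E_fst: "x \<in> gcar E \<Longrightarrow> fst (koszul E q x) = koszul U q (fst x)"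
  using koszul_bimod_hom[OF graded_E graded_U fst_hom, of x q] by simp

lemma dif_lin:
  "a \<in> gcar A \<Longrightarrow> b \<in> gcar A \<Longrightarrow> dif A (a + b) = dif A a + dif A b" "dif A 0 = 0"
  "a \<in> gcar A \<Longrightarrow> dif A (lact A c a) = lact A c (dif A a)" "a \<in> gcar A \<Longrightarrow> dif A (ract A a c) = ract A (dif A a) c"
  "a \<in> gcomp A i \<Longrightarrow> dif A a \<in> gcomp A (i - 1)" "a \<in> gcar A \<Longrightarrow> dif A a \<in> gcar A"
  "a \<in> gcar A \<Longrightarrow> dif A (- a) = - dif A a"
  using bimod_homD[OF A.dif_hom] bimod_hom_0[OF A.graded_bimodule_axioms A.graded_bimodule_axioms A.dif_hom]
    bimod_hom_gcar[OF A.graded_bimodule_axioms A.graded_bimodule_axioms A.dif_hom]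
    bimod_hom_uminus[OF A.graded_bimodule_axioms A.graded_bimodule_axioms A.dif_hom] by auto

lemma mdif_lin:
  "m \<in> gcar M \<Longrightarrow> n \<in> gcar M \<Longrightarrow> mdif M (m + n) = mdif M m + mdif M n" "mdif M 0 = 0"
  "m \<in> gcar M \<Longrightarrow> mdif M (lact M c m) = lact M c (mdif M m)" "m \<in> gcar M \<Longrightarrow> mdif M (ract M m c) = ract M (mdif M m) c"
  "m \<in> gcomp M i \<Longrightarrow> mdif M m \<in> gcomp M (i - 1)" "m \<in> gcar M \<Longrightarrow> mdif M m \<in> gcar M"
  "m \<in> gcar M \<Longrightarrow> mdif M (- m) = - mdif M m"
  using bimod_homD[OF mdif_hom] bimod_hom_0[OF graded_bimodule_axioms graded_bimodule_axioms mdif_hom]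
    bimod_hom_gcar[OF graded_bimodule_axioms graded_bimodule_axioms mdif_hom]
    bimod_hom_uminus[OF graded_bimodule_axioms graded_bimodule_axioms mdif_hom] by auto

lemma mul_zero [simp]: "a \<in> gcar A \<Longrightarrow> mul A a 0 = 0" "a \<in> gcar A \<Longrightarrow> mul A 0 a = 0"
  using A.mul_add_right[of a 0 0] A.mul_add_left[of 0 0 a] by simp_all

lemma lmul_zero [simp]: "a \<in> gcar A \<Longrightarrow> lmul M a 0 = 0" "m \<in> gcar M \<Longrightarrow> lmul M 0 m = 0"
  using lmul_add_right[of a 0 0] lmul_add_left[of 0 0 m] by simp_all

lemma rmul_zero [simp]: "a \<in> gcar A \<Longrightarrow> rmul M 0 a = 0" "m \<in> gcar M \<Longrightarrow> rmul M m 0 = 0"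
  using rmul_add_right[of m 0 0] rmul_add_left[of 0 0 a] by simp_all

lemma mul_uminus: "a \<in> gcar A \<Longrightarrow> b \<in> gcar A \<Longrightarrow> mul A (- a) b = - mul A a b"
  "a \<in> gcar A \<Longrightarrow> b \<in> gcar A \<Longrightarrow> mul A a (- b) = - mul A a b"
  using A.mul_add_left[of a "- a" b] A.mul_add_right[of a b "- b"] by (simp_all add: eq_neg_iff_add_eq_0 add.commute)

lemma lmul_uminus: "a \<in> gcar A \<Longrightarrow> m \<in> gcar M \<Longrightarrow> lmul M (- a) m = - lmul M a m"
  "a \<in> gcar A \<Longrightarrow> m \<in> gcar M \<Longrightarrow> lmul M a (- m) = - lmul M a m"
  using lmul_add_left[of a "- a" m] lmul_add_right[of a m "- m"] by (simp_all add: eq_neg_iff_add_eq_0 add.commute)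

lemma rmul_uminus: "a \<in> gcar A \<Longrightarrow> m \<in> gcar M \<Longrightarrow> rmul M (- m) a = - rmul M m a"
  "a \<in> gcar A \<Longrightarrow> m \<in> gcar M \<Longrightarrow> rmul M m (- a) = - rmul M m a"
  using rmul_add_left[of m "- m" a] rmul_add_right[of m a "- a"] by (simp_all add: eq_neg_iff_add_eq_0 add.commute)

lemma mul_gcar [simp]: "a \<in> gcar A \<Longrightarrow> b \<in> gcar A \<Longrightarrow> mul A a b \<in> gcar A"
  by (rule biadditive_gcar[OF A.graded_bimodule_axioms A.graded_bimodule_axioms A.graded_bimodule_axioms])
    (simp_all add: A.mul_add_left A.mul_add_right A.mul_comp)

lemma lmul_gcar [simp]: "a \<in> gcar A \<Longrightarrow> m \<in> gcar M \<Longrightarrow> lmul M a m \<in> gcar M"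
  by (rule biadditive_gcar[OF A.graded_bimodule_axioms graded_bimodule_axioms graded_bimodule_axioms])
    (simp_all add: lmul_add_left lmul_add_right lmul_comp)

lemma rmul_gcar [simp]: "m \<in> gcar M \<Longrightarrow> a \<in> gcar A \<Longrightarrow> rmul M m a \<in> gcar M"
  by (rule biadditive_gcar[OF graded_bimodule_axioms A.graded_bimodule_axioms graded_bimodule_axioms])
    (simp_all add: rmul_add_left rmul_add_right rmul_comp)

subsection \<open>The bar differential of the square-zero extension\<close>

text \<open>
  The corestriction of the bar differential of \<open>A \<oplus> M\<close>, the dg algebra in which the product of two
  elements of \<open>M\<close> is zero. The sign \<open>(-1)\<^bsup>|a|\<^esup>\<close> refers to degrees before suspension, hence to
  \<open>koszul A\<close> and \<open>koszul M\<close> instead of \<open>koszul E\<close>.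
\<close>

definition sq_bar :: "('a \<times> 'm) list \<Rightarrow> 'a \<times> 'm" where
  "sq_bar w = (case w of
      [(a, m)] \<Rightarrow> (- dif A a, - mdif M m)
    | [(a, m), (b, n)] \<Rightarrow> (mul A (koszul A 1 a) b, lmul M (koszul A 1 a) n + rmul M (koszul M 1 m) b)
    | _ \<Rightarrow> (0, 0))"

lemma sq_bar_simps [simp]:
  "sq_bar [] = 0"
  "sq_bar [(a, m)] = (- dif A a, - mdif M m)"
  "sq_bar [(a, m), (b, n)] = (mul A (koszul A 1 a) b, lmul M (koszul A 1 a) n + rmul M (koszul M 1 m) b)"
  "sq_bar (x # y # z # w) = 0"
  by (simp_all add: sq_bar_def zero_prod_def split: prod.split)

lemma sq_bar_long: "length w > 2 \<Longrightarrow> sq_bar w = 0"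
  by (cases w; cases "tl w"; cases "tl (tl w)") auto

lemma short_cases:
  obtains "u = []" "v = []" | y where "u = []" "v = [y]" | y where "u = [y]" "v = []" | "length u + length v > 1"
  by (cases u; cases v; cases "tl u"; cases "tl v") auto

lemma gcomp_U_mul: "a \<in> gcomp U i \<Longrightarrow> b \<in> gcomp U j \<Longrightarrow> mul A a b \<in> gcomp U (i + j - 1)"
  using A.mul_comp[of a "i - 1" b "j - 1"] A.aug_mul[of a b] gcar_gcomp[of a A "i - 1"] gcar_gcomp[of b A "j - 1"]
  by (simp add: algebra_simps)

lemma gcomp_U_dif: "a \<in> gcomp U i \<Longrightarrow> dif A a \<in> gcomp U (i - 1)"
  using dif_lin(5)[of a "i - 1"] A.aug_dif[of a] gcar_gcomp[of a A "i - 1"] by simp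

lemma letter_cochain_sq_bar: "letter_cochain E (- 1) sq_bar"
proof (rule letter_cochainI)
  note simps = gcar_E gcar_U dif_lin mdif_lin A.koszul_add koszul_add A.koszul_lact A.koszul_ract koszul_lact koszul_ract
    A.mul_add_left A.mul_add_right lmul_add_left lmul_add_right rmul_add_left rmul_add_right
    A.mul_balanced A.mul_lact A.mul_ract lmul_balanced lmul_lact lmul_ract rmul_balanced rmul_lact rmul_ract
    A.lact_uminus A.ract_uminus lact_uminus ract_uminus lact_add_right ract_add_left
  show "multilin E sq_bar"
  proof (rule multilinI)
    fix u v x y assume *: "u \<in> E.L" "v \<in> E.L" "x \<in> gcar E" "y \<in> gcar E"
    show "sq_bar (u @ (x + y) # v) = sq_bar (u @ x # v) + sq_bar (u @ y # v)"
      by (rule short_cases[of u v]; cases x; cases y) (use * in \<open>auto simp: simps sq_bar_long\<close>)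
  next
    fix u v x y c assume *: "u \<in> E.L" "v \<in> E.L" "x \<in> gcar E" "y \<in> gcar E"
    show "sq_bar (u @ ract E x c # y # v) = sq_bar (u @ x # lact E c y # v)"
      by (rule short_cases[of u "y # v"]; cases x; cases y) (use * in \<open>auto simp: simps sq_bar_long\<close>)
  qed
  fix c x w assume *: "x \<in> gcar E" "w \<in> E.L"
  show "sq_bar (lact E c x # w) = lact E c (sq_bar (x # w))"
    by (rule short_cases[of "[]" w]; cases x) (use * in \<open>auto simp: simps sq_bar_long zero_prod_def\<close>)
  show "sq_bar (w @ [ract E x c]) = ract E (sq_bar (w @ [x])) c"
    by (rule short_cases[of w "[]"]; cases x) (use * in \<open>auto simp: simps sq_bar_long zero_prod_def\<close>)
next
  fix w assume w: "w \<in> hwords E"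
  show "sq_bar (map snd w) \<in> gcomp E (sum_list (map fst w) + - 1)"
  proof (cases "length w > 2")
    case True
    then have "sq_bar (map snd w) = 0" by (simp add: sq_bar_long)
    then show ?thesis by (simp only: E.comp_zero)
  next
    case False
    then consider "w = []" | i a m where "w = [(i, (a, m))]" | i a m j b n where "w = [(i, (a, m)), (j, (b, n))]"
      by (cases w; cases "tl w"; cases "tl (tl w)") auto
    then show ?thesis
    proof cases
      case 1
      then have "sq_bar (map snd w) = 0" by simp
      then show ?thesis by (simp only: E.comp_zero)
    next
      case 2
      then have "a \<in> gcomp U i" "m \<in> gcomp M (i - 1)" using w by (auto simp: hwords_def)
      then show ?thesis
        using U.comp_uminus[OF gcomp_U_dif, of a i] comp_uminus[OF mdif_lin(5), of m "i - 1"] 2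
        by simp
    next
      case 3
      then have *: "a \<in> gcomp U i" "m \<in> gcomp M (i - 1)" "b \<in> gcomp U j" "n \<in> gcomp M (j - 1)"
        using w by (auto simp: hwords_def)
      then have "koszul A 1 a = ksgn (i - 1) a" "koszul M 1 m = ksgn (i - 1) m"
        using A.koszul_homog[of a "i - 1" 1] koszul_homog[of m "i - 1" 1] by simp_all
      moreover have "mul A (ksgn (i - 1) a) b \<in> gcomp U (i + j - 1)"
        using gcomp_U_mul[OF U.comp_ksgn[OF *(1)] *(3)] .
      moreover have "lmul M (ksgn (i - 1) a) n + rmul M (ksgn (i - 1) m) b \<in> gcomp M (i + j - 1 - 1)"
        using lmul_comp[OF A.comp_ksgn, of a "i - 1" n "j - 1" "i - 1"] rmul_comp[OF comp_ksgn, of m "i - 1" b "j - 1" "i - 1"] *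
        by (simp add: comp_add algebra_simps)
      ultimately show ?thesis using 3 by simp
    qed
  qed
qed simp

subsection \<open>Cochains with values in M\<close>

text \<open>
  A cochain with values in \<open>M\<close>, read as a map from words in \<open>E\<close> to letters. Only the components in
  \<open>I\<close> of the letters are used, so it vanishes as soon as one letter lies in \<open>M\<close>.
\<close>

definition cext :: "(('k, 't, 'a) words \<Rightarrow> 'm) \<Rightarrow> ('a \<times> 'm) list \<Rightarrow> 'a \<times> 'm" where
  "cext g w = (0, g (bar_word A (map fst w)))"

lemma hoch_cochain_iff: "hoch_cochain A M p g \<longleftrightarrow> bimod_hom U.T M p g"
  unfolding hoch_cochain_def by (rule bimod_hom_cong) simp_all

lemma lists_fst [simp]: "w \<in> E.L \<Longrightarrow> map fst w \<in> U.L"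
  by (auto simp: in_lists_conv_set gcar_E)

context
  fixes p g assumes g: "hoch_cochain A M p g"
begin

lemma cochain_hom: "bimod_hom U.T M p g"
  using g by (simp add: hoch_cochain_iff)

lemma multilin_cochain: "multilin U (\<lambda>w. g (bar_word A w))"
  by (rule multilinI)
    (simp_all add: U.tword_letter_add bimod_homD(1)[OF cochain_hom]
      U.tword_letter_bal[unfolded susp_sel kernel_bimod_sel])

lemma cochain_gcar [simp]: "w \<in> U.L \<Longrightarrow> g (bar_word A w) \<in> gcar M"
  by (rule bimod_hom_gcar[OF U.graded_tensor graded_bimodule_axioms cochain_hom]) simp

lemma cochain_lact: "x \<in> gcar U \<Longrightarrow> w \<in> U.L \<Longrightarrow> g (bar_word A (lact A c x # w)) = lact M c (g (bar_word A (x # w)))"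
  using bimod_homD(2)[OF cochain_hom, of "bar_word A (x # w)" c] U.tword_lact[of w x 1 c]
  by (simp add: U.lact_tword)

lemma cochain_ract: "x \<in> gcar U \<Longrightarrow> w \<in> U.L \<Longrightarrow> g (bar_word A (w @ [ract A x c])) = ract M (g (bar_word A (w @ [x]))) c"
  using bimod_homD(3)[OF cochain_hom, of "bar_word A (w @ [x])" c]
  by (simp add: U.ract_tword_snoc)

lemma cochain_degree: "w \<in> hwords U \<Longrightarrow> g (bar_word A (map snd w)) \<in> gcomp M (sum_list (map fst w) + p)"
  by (rule bimod_homD(4)[OF cochain_hom U.tword_gcomp])

lemma letter_cochain_cext:
  assumes "g (bar_word A []) = 0"
  shows "letter_cochain E (p + 1) (cext g)"
proof (rule letter_cochainI)
  show "multilin E (cext g)"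
  proof (rule multilinI)
    fix u v x y assume *: "u \<in> E.L" "v \<in> E.L" "x \<in> gcar E" "y \<in> gcar E"
    then have "fst x \<in> gcar U" "fst y \<in> gcar U" by (auto simp: gcar_E)
    then show "cext g (u @ (x + y) # v) = cext g (u @ x # v) + cext g (u @ y # v)"
      using * by (simp add: cext_def multilin_add[OF multilin_cochain])
    show "cext g (u @ ract E x c # y # v) = cext g (u @ x # lact E c y # v)" for c
      using * multilin_bal[OF multilin_cochain, of "map fst u" "map fst v" "fst x" "fst y" c]
      by (cases x; cases y) (simp add: cext_def gcar_E)
  qed
  fix c x w assume *: "x \<in> gcar E" "w \<in> E.L"
  then show "cext g (lact E c x # w) = lact E c (cext g (x # w))"
    "cext g (w @ [ract E x c]) = ract E (cext g (w @ [x])) c"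
    using lists_fst[OF *(2)] by (cases x; simp add: cext_def gcar_E cochain_lact cochain_ract)+
next
  fix w assume w: "w \<in> hwords E"
  let ?w = "map (\<lambda>(i, x). (i, fst x)) w"
  have "?w \<in> hwords U" using w by (auto simp: hwords_def)
  from cochain_degree[OF this] show "cext g (map snd w) \<in> gcomp E (sum_list (map fst w) + (p + 1))"
    by (simp add: cext_def comp_def case_prod_unfold A.comp_zero A.base_hom_props[OF A.aug_hom] algebra_simps)
qed (simp add: cext_def assms zero_prod_def)

end

section \<open>The bar differential and the Hochschild differential\<close>

lemma diff_simps:
  "m \<in> gcar M \<Longrightarrow> n \<in> gcar M \<Longrightarrow> mdif M (m - n) = mdif M m - mdif M n"
  "m \<in> gcar M \<Longrightarrow> n \<in> gcar M \<Longrightarrow> koszul M q (m - n) = koszul M q m - koszul M q n"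
  "a \<in> gcar A \<Longrightarrow> m \<in> gcar M \<Longrightarrow> n \<in> gcar M \<Longrightarrow> lmul M a (m - n) = lmul M a m - lmul M a n"
  "a \<in> gcar A \<Longrightarrow> m \<in> gcar M \<Longrightarrow> n \<in> gcar M \<Longrightarrow> rmul M (m - n) a = rmul M m a - rmul M n a"
  using mdif_lin(1)[of "m - n" n] koszul_add[of "m - n" n q] lmul_add_right[of a "m - n" n] rmul_add_left[of "m - n" n a]
  by simp_all

lemma sq_bar_zero: "u \<in> E.L \<Longrightarrow> v \<in> E.L \<Longrightarrow> sq_bar (u @ 0 # v) = 0"
  by (rule E.multilin_zero[OF letter_cochainD(1)[OF letter_cochain_sq_bar]])

lemma sq_bar_zero_short [simp]:
  "sq_bar [0] = 0" "x \<in> gcar E \<Longrightarrow> sq_bar [0, x] = 0" "x \<in> gcar E \<Longrightarrow> sq_bar [x, 0] = 0"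
  using sq_bar_zero[of "[]" "[]"] sq_bar_zero[of "[]" "[x]"] sq_bar_zero[of "[x]" "[]"] by simp_all

lemma sq_bar_gcar [simp]: "w \<in> E.L \<Longrightarrow> sq_bar w \<in> gcar E"
  by (rule E.letter_cochain_gcar[OF letter_cochain_sq_bar])

text \<open>
  On two letters the square of the bar differential vanishes by the Leibniz rules.
\<close>

lemma sq_bar_square_2:
  assumes x: "(a, m) \<in> gcomp E i" and y: "(b, n) \<in> gcomp E j"
  shows "sq_bar [sq_bar [(a, m)], (b, n)] + sq_bar [sq_bar [(a, m), (b, n)]] + sq_bar [koszul E (- 1) (a, m), sq_bar [(b, n)]] = 0"
proof -
  have a: "a \<in> gcomp A (i - 1)" "m \<in> gcomp M (i - 1)" and b: "b \<in> gcomp A (j - 1)" "n \<in> gcomp M (j - 1)"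
    using x y by auto
  note [simp] = a[THEN gcar_gcomp] b[THEN gcar_gcomp] dif_lin(6) mdif_lin(6)
  have k: "koszul E (- 1) (a, m) = ksgn i (a, m)" "koszul A 1 a = ksgn (i - 1) a" "koszul M 1 m = ksgn (i - 1) m"
    "koszul A 1 (dif A a) = ksgn i (dif A a)" "koszul M 1 (mdif M m) = ksgn i (mdif M m)"
    using E.koszul_homog[OF x, of "- 1"] A.koszul_homog[OF a(1), of 1] koszul_homog[OF a(2), of 1]
      A.koszul_homog[OF dif_lin(5)[OF a(1)], of 1] koszul_homog[OF mdif_lin(5)[OF a(2)], of 1]
    by (simp_all add: ksgn_def)
  note d = A.dif_mul[OF a(1), of b] mdif_lmul[OF a(1), of n] mdif_rmul[OF a(2), of b]
  show ?thesis
    by (cases "even i")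
      (simp_all add: k d ksgn_def A.koszul_uminus koszul_uminus mul_uminus lmul_uminus rmul_uminus
        dif_lin(7) mdif_lin mdif_lin(7) diff_simps zero_prod_def algebra_simps)
qed

text \<open>
  On three letters the square of the bar differential vanishes by associativity.
\<close>

lemma sq_bar_square_3:
  assumes x: "(a, m) \<in> gcomp E i" and y: "(b, n) \<in> gcomp E j" and z: "(c, l) \<in> gcomp E k"
  shows "sq_bar [sq_bar [(a, m), (b, n)], (c, l)] + sq_bar [koszul E (- 1) (a, m), sq_bar [(b, n), (c, l)]] = 0"
proof -
  have a: "a \<in> gcomp A (i - 1)" "m \<in> gcomp M (i - 1)" and b: "b \<in> gcomp A (j - 1)" "n \<in> gcomp M (j - 1)"
    and c: "c \<in> gcomp A (k - 1)" "l \<in> gcomp M (k - 1)"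
    using x y z by auto
  note [simp] = a[THEN gcar_gcomp] b[THEN gcar_gcomp] c[THEN gcar_gcomp]
  have k: "koszul E (- 1) (a, m) = ksgn i (a, m)" "koszul A 1 a = ksgn (i - 1) a" "koszul M 1 m = ksgn (i - 1) m"
    "koszul A 1 b = ksgn (j - 1) b" "koszul M 1 n = ksgn (j - 1) n"
    "koszul A 1 (mul A a b) = ksgn (i + j) (mul A a b)" "koszul M 1 (lmul M a n) = ksgn (i + j) (lmul M a n)"
    "koszul M 1 (rmul M m b) = ksgn (i + j) (rmul M m b)"
    using E.koszul_homog[OF x, of "- 1"] A.koszul_homog[OF a(1), of 1] koszul_homog[OF a(2), of 1]
      A.koszul_homog[OF b(1), of 1] koszul_homog[OF b(2), of 1]
      A.koszul_homog[OF A.mul_comp[OF a(1) b(1)], of 1] koszul_homog[OF lmul_comp[OF a(1) b(2)], of 1]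
      koszul_homog[OF rmul_comp[OF a(2) b(1)], of 1]
    by (simp_all add: ksgn_def)
  show ?thesis
    by (cases "even i"; cases "even j")
      (simp_all add: k ksgn_def A.koszul_uminus koszul_uminus koszul_add mul_uminus lmul_uminus rmul_uminus
        A.mul_assoc lmul_assoc rmul_assoc lmul_rmul lmul_add_right rmul_add_left diff_simps zero_prod_def algebra_simps)
qed

lemma sq_bar_square:
  assumes w: "w \<in> hwords E"
  shows "deconc3 (map snd w) (\<lambda>u s v. sq_bar (map (koszul E (- 1)) u @ sq_bar s # v)) = 0"
proof -
  have L: "map snd w \<in> E.L" by (rule E.hwords_lists[OF w])
  consider "w = []" | x where "w = [x]" | x y where "w = [x, y]" | x y z where "w = [x, y, z]" | "length w > 3"
    by (cases w; cases "tl w"; cases "tl (tl w)"; cases "tl (tl (tl w))") auto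
  then show ?thesis
  proof cases
    case 1
    then show ?thesis by (simp add: deconc3_def)
  next
    case 2
    obtain i a m where x: "x = (i, (a, m))" by (metis prod.exhaust)
    with w 2 have h: "(a, m) \<in> gcomp E i" by (simp add: hwords_def)
    then have "a \<in> gcar A" "m \<in> gcar M" by (auto intro: gcar_gcomp)
    with gcar_gcomp[OF h] show ?thesis
      by (simp add: deconc3_def deconc_Cons 2 x dif_lin mdif_lin A.dif_square mdif_square zero_prod_def[symmetric])
  next
    case 3
    obtain i a m j b n where x: "x = (i, (a, m))" "y = (j, (b, n))" by (metis prod.exhaust)
    with w 3 have h: "(a, m) \<in> gcomp E i" "(b, n) \<in> gcomp E j" by (simp_all add: hwords_def)
    note [simp] = h[THEN gcar_gcomp]
    show ?thesis
      using sq_bar_square_2[OF h] by (simp add: deconc3_def deconc_Cons 3 x add.assoc del: sq_bar_simps(2,3))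
  next
    case 4
    obtain i a m j b n k c l where x: "x = (i, (a, m))" "y = (j, (b, n))" "z = (k, (c, l))" by (metis prod.exhaust)
    with w 4 have h: "(a, m) \<in> gcomp E i" "(b, n) \<in> gcomp E j" "(c, l) \<in> gcomp E k" by (simp_all add: hwords_def)
    note [simp] = h[THEN gcar_gcomp]
    show ?thesis
      using sq_bar_square_3[OF h] by (simp add: deconc3_def deconc_Cons 4 x add.assoc del: sq_bar_simps(2,3))
  next
    case 5
    show ?thesis
    proof (rule deconc3_zero)
      fix u s v assume usv: "u @ s @ v = map snd w"
      then have l: "length u + length s + length v > 3" using 5 by (metis add.assoc length_append length_map)
      from usv L have uv: "u \<in> E.L" "v \<in> E.L" by (metis append_in_lists_conv)+
      show "sq_bar (map (koszul E (- 1)) u @ sq_bar s # v) = 0"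
      proof (cases "length s > 2")
        case True
        then show ?thesis using uv by (simp add: sq_bar_long sq_bar_zero)
      next
        case False
        with l show ?thesis by (intro sq_bar_long) simp
      qed
    qed
  qed
qed

subsection \<open>The Hochschild differential in terms of the bar differential\<close>

definition barA :: "'a list \<Rightarrow> 'a" where
  "barA s = (case s of [a] \<Rightarrow> - dif A a | [a, b] \<Rightarrow> mul A (koszul A 1 a) b | _ \<Rightarrow> 0)"

lemma fst_sq_bar: "fst (sq_bar w) = barA (map fst w)"
  by (auto simp: sq_bar_def barA_def split: list.split prod.split)

text \<open>
  The composite of a cochain with the bar differential of \<open>A\<close>, spelled out on a word.
\<close>

definition bar_pull :: "(('k, 't, 'a) words \<Rightarrow> 'm) \<Rightarrow> 'a list \<Rightarrow> 'm" where
  "bar_pull g w = deconc3 w (\<lambda>u s v. g (bar_word A (map (koszul U (- 1)) u @ barA s # v)))"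

text \<open>
  From degrees in \<open>I\<close> to degrees in the suspension \<open>U\<close>.
\<close>

definition shift :: "(int \<times> 'a) list \<Rightarrow> (int \<times> 'a) list" where
  "shift w = map (\<lambda>(i, a). (i + 1, a)) w"

lemma shift_hwords: "w \<in> hwords (aug_ideal A) \<Longrightarrow> shift w \<in> hwords U"
  by (auto simp: shift_def hwords_def)

lemma snd_shift [simp]: "map snd (shift w) = map snd w"
  by (simp add: shift_def comp_def case_prod_unfold)

lemma eps_eq: "i \<le> length w \<Longrightarrow> eps w i = sum_list (map fst (shift (take i w)))"
proof (induction i)
  case (Suc i)
  then show ?case by (simp add: eps_def shift_def take_Suc_conv_app_nth case_prod_unfold)
qed (simp add: eps_def shift_def)

lemma hwords_take: "w \<in> hwords V \<Longrightarrow> take i w \<in> hwords V"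
  by (auto simp: hwords_def dest: in_set_takeD)

context
  fixes p g assumes g: "hoch_cochain A M p g"
begin

lemma cochain_koszul:
  assumes "w \<in> hwords (aug_ideal A)" "i \<le> length w" "v \<in> U.L"
  shows "g (bar_word A (map (koszul U (- 1)) (take i (map snd w)) @ v)) = ksgn (eps w i) (g (bar_word A (take i (map snd w) @ v)))"
  using U.multilin_koszul[OF multilin_cochain[OF g] hwords_take[OF shift_hwords[OF assms(1)], of i] assms(3), of "- 1"] assms(2)
  by (simp add: eps_eq take_map[symmetric]) (simp add: shift_def take_map ksgn_def)

text \<open>
  The terms of the Hochschild differential that change a letter or merge two letters are, up to the
  sign \<open>-(-1)\<^bsup>p\<^esup>\<close>, the pullback of the cochain along the bar differential.
\<close>

lemma bar_pull_eq:
  assumes w: "w \<in> hwords (aug_ideal A)"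
  defines "a \<equiv> map snd w"
  shows "(\<Sum>i<length w. ksgn (eps w i + p) (g (bar_word A (a[i := dif A (a ! i)])))) +
    (\<Sum>i=1..length w - 1. ksgn (p + eps w i)
        (g (bar_word A (take (i - 1) a @ [mul A (a ! (i - 1)) (a ! i)] @ drop (i + 1) a)))) = - ksgn p (bar_pull g a)"
proof -
  define n where "n = length w"
  have len: "length a = n" by (simp add: a_def n_def)
  have aL: "a \<in> U.L" unfolding a_def using U.hwords_lists[OF shift_hwords[OF w]] by simp
  have hom: "a ! i \<in> gcomp A (fst (w ! i))" "a ! i \<in> gcar U" if "i < n" for i
  proof -
    have "w ! i \<in> set w" using that by (simp add: n_def)
    then have "snd (w ! i) \<in> gcomp (aug_ideal A) (fst (w ! i))" using w by (auto simp: hwords_def)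
    then show "a ! i \<in> gcomp A (fst (w ! i))" using that by (simp add: a_def n_def)
    show "a ! i \<in> gcar U" using aL that by (metis in_lists_conv_set len nth_mem)
  qed
  have tL: "take i a \<in> U.L" "drop i a \<in> U.L" for i
    using aL by (auto simp: in_lists_conv_set dest: in_set_takeD in_set_dropD)
  define G where "G u s v = g (bar_word A (map (koszul U (- 1)) u @ barA s # v))" for u s v
  have G0: "G u s v = 0" if "u \<in> U.L" "v \<in> U.L" "length s \<noteq> 1" "length s \<noteq> 2" for u s v
  proof -
    have "barA s = 0" using that(3,4) by (auto simp: barA_def split: list.split)
    then show ?thesis using U.multilin_zero[OF multilin_cochain[OF g], of "map (koszul U (- 1)) u" v] that by (simp add: G_def)
  qed
  have G1: "G (take i a) [a ! i] (drop (Suc i) a) = - ksgn (eps w i) (g (bar_word A (a[i := dif A (a ! i)])))" if "i < n" for i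
  proof -
    have d: "dif A (a ! i) \<in> gcar U"
      using gcar_gcomp[OF gcomp_U_dif[of "a ! i" "fst (w ! i) + 1"]] hom[OF that] gcar_U(2)[OF hom(2)[OF that]] by simp
    have "G (take i a) [a ! i] (drop (Suc i) a) = ksgn (eps w i) (g (bar_word A (take i a @ (- dif A (a ! i)) # drop (Suc i) a)))"
      using cochain_koszul[OF w, of i "- dif A (a ! i) # drop (Suc i) a"] that tL d
      by (simp add: G_def barA_def a_def[symmetric] n_def)
    also have "g (bar_word A (take i a @ (- dif A (a ! i)) # drop (Suc i) a)) = - g (bar_word A (take i a @ dif A (a ! i) # drop (Suc i) a))"
      by (rule U.multilin_uminus[OF multilin_cochain[OF g] tL d])
    finally show ?thesis
      using that len by (simp add: upd_conv_take_nth_drop ksgn_minus)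
  qed
  have G2: "G (take i a) [a ! i, a ! Suc i] (drop (Suc (Suc i)) a) =
      - ksgn (eps w (Suc i)) (g (bar_word A (take i a @ [mul A (a ! i) (a ! Suc i)] @ drop (Suc (Suc i)) a)))" if "Suc i < n" for i
  proof -
    have i: "i < n" using that by simp
    have m: "mul A (a ! i) (a ! Suc i) \<in> gcar U"
      using gcar_gcomp[OF gcomp_U_mul[of "a ! i" "fst (w ! i) + 1" "a ! Suc i" "fst (w ! Suc i) + 1"]]
        hom[OF i] gcar_U(2)[OF hom(2)[OF i]] hom[OF that] gcar_U(2)[OF hom(2)[OF that]] by simp
    have k: "mul A (koszul A 1 (a ! i)) (a ! Suc i) = ksgn (fst (w ! i)) (mul A (a ! i) (a ! Suc i))"
      using A.koszul_homog[OF hom(1)[OF i], of 1] hom(2)[OF i] hom(2)[OF that] by (simp add: ksgn_def mul_uminus gcar_U)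
    have "G (take i a) [a ! i, a ! Suc i] (drop (Suc (Suc i)) a) =
        ksgn (eps w i) (g (bar_word A (take i a @ ksgn (fst (w ! i)) (mul A (a ! i) (a ! Suc i)) # drop (Suc (Suc i)) a)))"
      using cochain_koszul[OF w, of i "ksgn (fst (w ! i)) (mul A (a ! i) (a ! Suc i)) # drop (Suc (Suc i)) a"] i tL m
      by (simp add: G_def barA_def k a_def[symmetric] n_def)
    also have "\<dots> = ksgn (eps w i) (ksgn (fst (w ! i)) (g (bar_word A (take i a @ mul A (a ! i) (a ! Suc i) # drop (Suc (Suc i)) a))))"
      by (subst U.multilin_ksgn[OF multilin_cochain[OF g] tL m]) rule
    finally show ?thesis
      by (simp add: ksgn_ksgn eps_def ksgn_def)
  qed
  have "bar_pull g a = (\<Sum>i\<le>n. (if drop i a = [] then 0 else G (take i a) [hd (drop i a)] (tl (drop i a))) +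
      (if length (drop i a) < 2 then 0 else G (take i a) (take 2 (drop i a)) (drop 2 (drop i a))))"
    unfolding bar_pull_def deconc3_def G_def[symmetric] deconc_def[of a] len
  proof (rule sum.cong[OF refl])
    fix i
    show "deconc (drop i a) (G (take i a)) = (if drop i a = [] then 0 else G (take i a) [hd (drop i a)] (tl (drop i a))) +
      (if length (drop i a) < 2 then 0 else G (take i a) (take 2 (drop i a)) (drop 2 (drop i a)))"
    proof (rule deconc_short)
      fix s v assume "s @ v = drop i a" "length s \<noteq> 1" "length s \<noteq> 2"
      moreover from this(1) have "v \<in> U.L" using tL(2)[of i] by (metis append_in_lists_conv)
      ultimately show "G (take i a) s v = 0" using G0 tL(1) by blast
    qed
  qed
  also have "\<dots> = (\<Sum>i<n. G (take i a) [a ! i] (drop (Suc i) a)) + (\<Sum>i<n - 1. G (take i a) [a ! i, a ! Suc i] (drop (Suc (Suc i)) a))"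
  proof -
    have "(\<Sum>i\<le>n. if drop i a = [] then 0 else G (take i a) [hd (drop i a)] (tl (drop i a))) =
        (\<Sum>i<n. G (take i a) [a ! i] (drop (Suc i) a))"
      by (rule sum.mono_neutral_cong_right) (auto simp: len hd_drop_conv_nth drop_Suc tl_drop)
    moreover have "(\<Sum>i\<le>n. if length (drop i a) < 2 then 0 else G (take i a) (take 2 (drop i a)) (drop 2 (drop i a))) =
        (\<Sum>i<n - 1. G (take i a) [a ! i, a ! Suc i] (drop (Suc (Suc i)) a))"
    proof (rule sum.mono_neutral_cong_right)
      fix i assume i: "i \<in> {..<n - 1}"
      then have "drop i a = a ! i # a ! Suc i # drop (Suc (Suc i)) a"
        using len by (simp add: Cons_nth_drop_Suc)
      then show "(if length (drop i a) < 2 then 0 else G (take i a) (take 2 (drop i a)) (drop 2 (drop i a))) =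
          G (take i a) [a ! i, a ! Suc i] (drop (Suc (Suc i)) a)"
        by (simp del: length_drop drop_drop)
    qed (auto simp: len)
    ultimately show ?thesis by (simp add: sum.distrib)
  qed
  also have "\<dots> = (\<Sum>i<n. - ksgn (eps w i) (g (bar_word A (a[i := dif A (a ! i)])))) +
      (\<Sum>i<n - 1. - ksgn (eps w (Suc i)) (g (bar_word A (take i a @ [mul A (a ! i) (a ! Suc i)] @ drop (Suc (Suc i)) a))))"
    by (simp add: G1 G2)
  finally have "- ksgn p (bar_pull g a) = (\<Sum>i<n. ksgn (p + eps w i) (g (bar_word A (a[i := dif A (a ! i)])))) +
      (\<Sum>i<n - 1. ksgn (p + eps w (Suc i)) (g (bar_word A (take i a @ [mul A (a ! i) (a ! Suc i)] @ drop (Suc (Suc i)) a))))"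
    by (simp add: ksgn_diff ksgn_minus ksgn_sum ksgn_ksgn sum_negf)
  then show ?thesis
    by (simp add: n_def sum.atLeast1_atMost_eq add.commute[of _ p])
qed

lemma hoch_diff_Nil: "hoch_diff A M p g [] = mdif M (g (bar_word A []))"
  by (simp add: hoch_diff_def hoch_diff0_def hoch_diff1_def)

text \<open>
  In this form the Hochschild differential can be compared with corestrictions. The sign of the last
  term is absorbed into a Koszul sign because the degree of the value of \<open>g\<close> is known.
\<close>

lemma hoch_diff_eq:
  assumes w: "w \<in> hwords (aug_ideal A)" and ne: "w \<noteq> []"
  defines "a \<equiv> map snd w"
  shows "hoch_diff A M p g w = mdif M (g (bar_word A a)) - ksgn p (bar_pull g a)
    + ksgn (p * (fst (hd w) + 1)) (lmul M (hd a) (g (bar_word A (tl a))))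
    - rmul M (koszul M 1 (g (bar_word A (butlast a)))) (last a)"
proof -
  have b: "butlast a = map snd (shift (take (length w - 1) w))"
    by (simp add: a_def butlast_conv_take take_map)
  have deg: "g (bar_word A (butlast a)) \<in> gcomp M (eps w (length w - 1) + p)"
    unfolding b using cochain_degree[OF g shift_hwords[OF hwords_take[OF w]], of "length w - 1"] by (simp add: eps_eq)
  have "last a \<in> gcar A"
    using U.hwords_lists[OF shift_hwords[OF w]] ne gcar_U(1) by (auto simp: a_def in_lists_conv_set last_map)
  then have "rmul M (koszul M 1 (g (bar_word A (butlast a)))) (last a) =
      ksgn (eps w (length w - 1) + p) (rmul M (g (bar_word A (butlast a))) (last a))"
    using koszul_homog[OF deg, of 1] gcar_gcomp[OF deg] by (simp add: ksgn_def rmul_uminus)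
  then have r: "ksgn (p + eps w (length w - 1) + 1) (rmul M (g (bar_word A (butlast a))) (last a)) =
      - rmul M (koszul M 1 (g (bar_word A (butlast a)))) (last a)"
    by (simp add: ksgn_def)
  have "hoch_diff A M p g w = mdif M (g (bar_word A a)) + ((\<Sum>i<length w. ksgn (eps w i + p) (g (bar_word A (a[i := dif A (a ! i)])))) +
    (\<Sum>i=1..length w - 1. ksgn (p + eps w i)
        (g (bar_word A (take (i - 1) a @ [mul A (a ! (i - 1)) (a ! i)] @ drop (i + 1) a))))) +
    ksgn (p * (fst (hd w) + 1)) (lmul M (hd a) (g (bar_word A (tl a)))) +
    ksgn (p + eps w (length w - 1) + 1) (rmul M (g (bar_word A (butlast a))) (last a))"
    using ne by (simp add: hoch_diff_def hoch_diff0_def hoch_diff1_def Let_def a_def)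
  also have "(\<Sum>i<length w. ksgn (eps w i + p) (g (bar_word A (a[i := dif A (a ! i)])))) +
    (\<Sum>i=1..length w - 1. ksgn (p + eps w i)
        (g (bar_word A (take (i - 1) a @ [mul A (a ! (i - 1)) (a ! i)] @ drop (i + 1) a)))) = - ksgn p (bar_pull g a)"
    unfolding a_def by (rule bar_pull_eq[OF w])
  finally show ?thesis unfolding r by simp
qed

end

section \<open>The differential of the Hochschild extension\<close>

text \<open>
  The corestriction of the differential of the extension.
\<close>

definition ext_b :: "(('k, 't, 'a) words \<Rightarrow> 'm) \<Rightarrow> ('a \<times> 'm) list \<Rightarrow> 'a \<times> 'm" where
  "ext_b \<alpha> w = sq_bar w + - cext \<alpha> w"

lemma cochain_zero:
  "hoch_cochain A M p g \<Longrightarrow> u \<in> U.L \<Longrightarrow> v \<in> U.L \<Longrightarrow> g (bar_word A (u @ 0 # v)) = 0"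
  by (rule U.multilin_zero[OF multilin_cochain])

lemma cochain_empty_zero:
  assumes "hoch_cochain A M p g" "gcomp M p = {0}"
  shows "g (bar_word A []) = 0"
  using cochain_degree[OF assms(1), of "[]"] assms(2) by (simp add: hwords_def)

lemma ext_b_eq: "ext_b \<alpha> w = sq_bar w - (0, \<alpha> (bar_word A (map fst w)))"
  by (simp add: ext_b_def cext_def)

lemma ext_letters: "w \<in> ext_words A M \<Longrightarrow> map (ext_letter \<circ> snd) w \<in> E.L"
proof -
  assume w: "w \<in> ext_words A M"
  have "ext_letter x \<in> gcar E" if "(j, x) \<in> set w" for j x
  proof (rule gcar_gcomp[of _ _ "j + 1"])
    from that w show "ext_letter x \<in> gcomp E (j + 1)"
      by (cases x) (auto simp: ext_words_def ext_letter_def comp_zero A.comp_zero A.base_hom_props[OF A.aug_hom])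
  qed
  then show ?thesis by (auto simp: in_lists_conv_set)
qed

lemma ext_words_split:
  assumes w: "w \<in> ext_words A M" and ni: "\<not> (\<forall>x\<in>set w. isl (snd x))"
  obtains u v where "map fst (map (ext_letter \<circ> snd) w) = u @ 0 # v" "u \<in> U.L" "v \<in> U.L"
proof -
  obtain i m p q where w': "w = p @ (i, Inr m) # q"
    using ni by (metis split_list prod.collapse sum.collapse(2))
  have e: "map fst (map (ext_letter \<circ> snd) w) =
      map fst (map (ext_letter \<circ> snd) p) @ 0 # map fst (map (ext_letter \<circ> snd) q)"
    by (simp add: w' ext_letter_def)
  have "map fst (map (ext_letter \<circ> snd) w) \<in> U.L"
    by (rule lists_fst[OF ext_letters[OF w]])
  then show ?thesis
    unfolding e append_in_lists_conv Cons_in_lists_iff by (intro that[OF e]) blast+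
qed

lemma ext_b_ext_words:
  assumes \<alpha>: "hoch_cochain A M (- 2) \<alpha>" and w: "w \<in> ext_words A M"
  shows "ext_b \<alpha> (map (ext_letter \<circ> snd) w) = ext_dbar A M \<alpha> w"
proof (cases "\<forall>x\<in>set w. isl (snd x)")
  case True
  define w' where "w' = map (map_prod id projl) w"
  have w'h: "w' \<in> hwords (aug_ideal A)"
    using w True by (fastforce simp: w'_def hwords_def ext_words_def isl_def)
  have 1: "map (ext_letter \<circ> snd) w = map (\<lambda>(i, a). (a, 0)) w'"
    using True by (auto simp: w'_def ext_letter_def isl_def)
  have 2: "map fst (map (ext_letter \<circ> snd) w) = map (projl \<circ> snd) w"
    using True by (auto simp: ext_letter_def isl_def)
  have "sq_bar (map (\<lambda>(i, a). (a, 0)) w') = (bar_dbar A w', 0)"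
  proof -
    consider "w' = []" | i a where "w' = [(i, a)]" | i a j b where "w' = [(i, a), (j, b)]" | "length w' > 2"
      by (cases w'; cases "tl w'"; cases "tl (tl w')") auto
    then show ?thesis
    proof cases
      case 3
      with w'h have "a \<in> gcomp A i" "b \<in> gcomp A j" by (auto simp: hwords_def)
      moreover from this have "a \<in> gcar A" "b \<in> gcar A" by (auto intro: gcar_gcomp)
      ultimately show ?thesis
        using A.koszul_homog[of a i 1] by (simp add: 3 ksgn_def mul_uminus)
    next
      case 4
      then obtain x y z v where "w' = x # y # z # v"
        by (cases w'; cases "tl w'"; cases "tl (tl w')") auto
      then show ?thesis by (cases x; cases y; cases z) (simp add: zero_prod_def)
    qed (simp_all add: zero_prod_def mdif_lin)
  qed
  then show ?thesis
    using True unfolding ext_b_eq 1 2[unfolded 1] by (simp add: ext_dbar_def w'_def)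
next
  case False
  obtain u v where uv: "map fst (map (ext_letter \<circ> snd) w) = u @ 0 # v" "u \<in> U.L" "v \<in> U.L"
    by (rule ext_words_split[OF w False])
  have "\<alpha> (bar_word A (map fst (map (ext_letter \<circ> snd) w))) = 0"
    unfolding uv(1) by (rule cochain_zero[OF \<alpha> uv(2,3)])
  then have 1: "ext_b \<alpha> (map (ext_letter \<circ> snd) w) = sq_bar (map (ext_letter \<circ> snd) w)"
    unfolding ext_b_eq by (simp add: zero_prod_def[symmetric])
  have "sq_bar (map (ext_letter \<circ> snd) w) = (case w of
          [(i, Inr m)] \<Rightarrow> (0, - mdif M m)
        | [(i, Inl a), (j, Inr m)] \<Rightarrow> (0, ksgn i (lmul M a m))
        | [(i, Inr m), (j, Inl a)] \<Rightarrow> (0, ksgn i (rmul M m a))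
        | _ \<Rightarrow> (0, 0))"
  proof -
    consider "w = []" | i x where "w = [(i, x)]" | i x j y where "w = [(i, x), (j, y)]" | x y z v where "w = x # y # z # v"
      by (cases w; cases "tl w"; cases "tl (tl w)") auto
    then show ?thesis
    proof cases
      case 2
      with False show ?thesis by (cases x) (simp_all add: ext_letter_def dif_lin)
    next
      case 3
      have g: "a \<in> gcomp (aug_ideal A) k \<Longrightarrow> a \<in> gcar A" for a k by (auto intro: gcar_gcomp)
      show ?thesis
        using w False A.koszul_homog[of _ i 1] koszul_homog[of _ i 1] unfolding 3
        by (cases x; cases y)
          (auto simp: ext_letter_def ext_words_def gcar_gcomp[of _ A] gcar_gcomp[of _ M] ksgn_def
            lmul_uminus rmul_uminus dest: gcar_gcomp)
    next
      case 4
      then show ?thesis by (cases x; cases y; cases z) (auto simp: zero_prod_def split: sum.split)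
    qed (use False in simp)
  qed
  then show ?thesis
    unfolding ext_dbar_def if_not_P[OF False] by (rule trans[OF 1])
qed

text \<open>
  Each letter \<open>(a, m)\<close> is the sum of \<open>(a, 0)\<close> and \<open>(0, m)\<close>.
\<close>

lemma multilin_eq_on_ext_words:
  assumes h: "multilin E h" and h': "multilin E h'" and w: "w \<in> E.L"
    and eq: "\<And>w. w \<in> ext_words A M \<Longrightarrow> h (map (ext_letter \<circ> snd) w) = h' (map (ext_letter \<circ> snd) w)"
  shows "h w = h' w"
proof (rule multilin_eq_on_homogeneous[OF graded_E h h' w])
  fix w assume w: "w \<in> hwords E"
  note l = ext_letters
  have "h (map (ext_letter \<circ> snd) u @ map snd w) = h' (map (ext_letter \<circ> snd) u @ map snd w)"
    if "u \<in> ext_words A M" for u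
    using w that
  proof (induction w arbitrary: u)
    case Nil
    from eq[OF Nil(2)] show ?case by (simp only: list.map append_Nil2)
  next
    case (Cons x w)
    obtain i a m where x: "x = (i, (a, m))" by (metis prod.exhaust)
    from Cons(2) have w: "w \<in> hwords E" and am: "(a, m) \<in> gcomp E i" by (auto simp: hwords_def x)
    have u1: "u @ [(i - 1, Inl a)] \<in> ext_words A M" and u2: "u @ [(i - 1, Inr m)] \<in> ext_words A M"
      using Cons(3) am by (auto simp: ext_words_def)
    have e: "snd x = ext_letter (Inl a) + ext_letter (Inr m)" by (simp add: x ext_letter_def)
    have g: "ext_letter (Inl a) \<in> gcar E" "ext_letter (Inr m) \<in> gcar E"
      using l[OF u1] l[OF u2] by simp_all
    show ?case
      using Cons(1)[OF w u1] Cons(1)[OF w u2]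
        multilin_add[OF h l[OF Cons(3)] E.hwords_lists[OF w] g] multilin_add[OF h' l[OF Cons(3)] E.hwords_lists[OF w] g]
      unfolding list.map e by (simp add: comp_def)
  qed
  from this[of "[]"] show "h (map snd w) = h' (map snd w)" by (simp add: ext_words_def)
qed

context
  fixes \<alpha> assumes \<alpha>: "hoch_cochain A M (- 2) \<alpha>" and \<alpha>0: "\<alpha> (bar_word A []) = 0"
begin

lemma letter_cochain_ext_b: "letter_cochain E (- 1) (ext_b \<alpha>)"
  using E.letter_cochain_plus[OF letter_cochain_sq_bar E.letter_cochain_uminus, of "cext \<alpha>"] letter_cochain_cext[OF \<alpha> \<alpha>0]
  by (simp add: ext_b_def[abs_def])

abbreviation "D \<equiv> E.cod (- 1) (ext_b \<alpha>)"

lemma coderivation_D: "coderivation (tensor_coalg E) (- 1) D"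
  by (rule E.coderivation_cod[OF letter_cochain_ext_b])

lemma D_gcar [simp]: "z \<in> gcar E.T \<Longrightarrow> D z \<in> gcar E.T"
  by (rule E.tensor_hom_gcar[OF E.bimod_hom_cod[OF letter_cochain_ext_b]])

text \<open>
  The coderivation with corestriction \<open>ext_b \<alpha>\<close> meets the description in \<open>hoch_ext\<close>, and by
  \<open>coderivation_unique\<close> it is the only one.
\<close>

lemma acod_hoch_ext: "acod (hoch_ext A M \<alpha>) = restrict D (gcar E.T)"
proof -
  have "(THE D. D \<in> extensional (gcar (tensor_coalg E)) \<and> coderivation (tensor_coalg E) (- 1) D \<and>
      (\<forall>w\<in>ext_words A M. tproj E (D (tword E 1 (map (ext_letter \<circ> snd) w))) = ext_dbar A M \<alpha> w)) =
    restrict D (gcar E.T)"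
  proof (rule the_equality, intro conjI ballI)
    show "coderivation (tensor_coalg E) (- 1) (restrict D (gcar E.T))"
      by (rule E.coderivation_cong[OF coderivation_D]) simp
    fix w assume w: "w \<in> ext_words A M"
    then show "tproj E (restrict D (gcar E.T) (tword E 1 (map (ext_letter \<circ> snd) w))) = ext_dbar A M \<alpha> w"
      using ext_letters[OF w] ext_b_ext_words[OF \<alpha> w] E.letter_cochain_gcar[OF letter_cochain_ext_b ext_letters[OF w]]
        E.tproj_cod[OF letter_cochain_ext_b ext_letters[OF w], of 1] E.lact_one
      by simp
  next
    fix D' assume D': "D' \<in> extensional (gcar (tensor_coalg E)) \<and> coderivation (tensor_coalg E) (- 1) D' \<and>
      (\<forall>w\<in>ext_words A M. tproj E (D' (tword E 1 (map (ext_letter \<circ> snd) w))) = ext_dbar A M \<alpha> w)"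
    then have d': "bimod_hom E.T E.T (- 1) D'"
      by (simp add: E.coderivation_iff)
    note [simp] = E.tensor_hom_gcar[OF d']
    have m: "multilin E (\<lambda>w. tproj E (D' (tword E 1 w)))"
      by (rule multilinI)
        (simp_all add: E.tword_letter_add E.tword_letter_bal[unfolded susp_sel kernel_bimod_sel] bimod_homD(1)[OF d'] E.tproj_add)
    have "tproj E (D' (tword E 1 w)) = ext_b \<alpha> w" if "w \<in> E.L" for w
      by (rule multilin_eq_on_ext_words[OF m letter_cochainD(1)[OF letter_cochain_ext_b] that])
        (use D' ext_b_ext_words[OF \<alpha>] in simp)
    then have "tproj E (D' (tword E c w)) = lact E c (ext_b \<alpha> w)" if "w \<in> E.L" for c w
      using that E.tproj_lact[of "D' (tword E 1 w)" c] bimod_homD(2)[OF d', of "tword E 1 w" c]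
      by (simp add: E.lact_tword)
    then have "D' z = D z" if "z \<in> gcar E.T" for z
      using D' that by (intro E.coderivation_unique[OF _ coderivation_D]) (simp_all add: E.tproj_cod[OF letter_cochain_ext_b])
    then show "D' = restrict D (gcar E.T)"
      using D' by (intro extensionalityI[of _ "gcar E.T"]) auto
  qed simp
  then show ?thesis
    by (simp add: hoch_ext_def Let_def gbimod.defs)
qed

end

text \<open>
  From words in \<open>E\<close>, with suspended degrees, to words in \<open>I\<close> with degrees before suspension.
\<close>

definition unshift :: "(int \<times> ('a \<times> 'm)) list \<Rightarrow> (int \<times> 'a) list" where
  "unshift w = map (\<lambda>(i, x). (i - 1, fst x)) w"

lemma unshift_hwords: "w \<in> hwords E \<Longrightarrow> unshift w \<in> hwords (aug_ideal A)"
  by (auto simp: unshift_def hwords_def)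

lemma snd_unshift: "map snd (unshift w) = map fst (map snd w)"
  by (simp add: unshift_def comp_def case_prod_unfold)

lemma koszul_koszul_U: "a \<in> gcar U \<Longrightarrow> koszul A 1 (koszul U (- 1) a) = - a"
proof (induction rule: gcar_induct)
  case (add i x y)
  have x: "x \<in> gcomp A (i - 1)" "x \<in> gcar U" using add(1) gcar_gcomp[OF add(1)] by auto
  have "koszul A 1 (koszul U (- 1) x) = - x"
    using U.koszul_homog[OF add(1), of "- 1"] A.koszul_homog[OF x(1), of 1] A.koszul_homog[OF A.comp_uminus[OF x(1)], of 1]
    by (simp add: ksgn_def)
  with add x show ?case
    by (simp add: U.koszul_add A.koszul_add gcar_U(1))
qed simp

lemma map_fst_koszul: "u \<in> E.L \<Longrightarrow> map fst (map (koszul E q) u) = map (koszul U q) (map fst u)"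
  by (simp add: koszul_E_fst in_lists_conv_set)

lemma fst_ext_b: "fst (ext_b g w) = barA (map fst w)"
  by (simp add: ext_b_def cext_def fst_sq_bar)

lemma cext_ext_b:
  assumes "u \<in> E.L"
  shows "cext g (map (koszul E (- 1)) u @ ext_b h s # v) =
    (0, g (bar_word A (map (koszul U (- 1)) (map fst u) @ barA (map fst s) # map fst v)))"
  unfolding cext_def map_append list.map fst_ext_b map_fst_koszul[OF assms] ..

lemma deconc3_bar_pull:
  assumes "w \<in> E.L"
  shows "deconc3 w (\<lambda>u s v. cext g (map (koszul E (- 1)) u @ ext_b h s # v)) = (0, bar_pull g (map fst w))"
proof -
  have pair: "deconc3 w (\<lambda>u s v. (0, k u s v)) = (0, deconc3 w k)" for k :: "_ \<Rightarrow> _ \<Rightarrow> _ \<Rightarrow> 'm"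
    by (simp add: deconc3_def deconc_def prod_eq_iff fst_sum snd_sum)
  have "deconc3 w (\<lambda>u s v. cext g (map (koszul E (- 1)) u @ ext_b h s # v)) = deconc3 w (\<lambda>u s v.
      (0, g (bar_word A (map (koszul U (- 1)) (map fst u) @ barA (map fst s) # map fst v))))"
    by (rule deconc3_cong, rule cext_ext_b) (use assms in auto)
  then show ?thesis
    unfolding pair by (simp add: bar_pull_def deconc3_map)
qed

lemma cext_gcar: "hoch_cochain A M p g \<Longrightarrow> w \<in> E.L \<Longrightarrow> cext g w \<in> gcar E"
  by (simp add: cext_def gcar_E cochain_gcar)

lemma sq_bar_add: "u \<in> E.L \<Longrightarrow> v \<in> E.L \<Longrightarrow> x \<in> gcar E \<Longrightarrow> y \<in> gcar E \<Longrightarrow>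
    sq_bar (u @ (x + y) # v) = sq_bar (u @ x # v) + sq_bar (u @ y # v)"
  by (rule multilin_add[OF letter_cochainD(1)[OF letter_cochain_sq_bar]])

lemma sq_bar_uminus: "u \<in> E.L \<Longrightarrow> v \<in> E.L \<Longrightarrow> x \<in> gcar E \<Longrightarrow>
    sq_bar (u @ (- x) # v) = - sq_bar (u @ x # v)"
  by (rule E.multilin_uminus[OF letter_cochainD(1)[OF letter_cochain_sq_bar]])

lemma sq_bar_M:
  "m \<in> gcar M \<Longrightarrow> sq_bar [(0, m)] = (0, - mdif M m)"
  "x \<in> gcar E \<Longrightarrow> m \<in> gcar M \<Longrightarrow> sq_bar [(0, m), x] = (0, rmul M (koszul M 1 m) (fst x))"
  "x \<in> gcar E \<Longrightarrow> m \<in> gcar M \<Longrightarrow> sq_bar [x, (0, m)] = (0, lmul M (koszul A 1 (fst x)) m)"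
  by (cases x; auto simp: dif_lin gcar_E gcar_U(1))+

text \<open>
  The terms with the bar differential twice cancel, and those with \<open>\<alpha>\<close> twice vanish. Applying \<open>\<alpha>\<close>
  first leaves the differential of its value and the two outer products; applying the bar
  differential first leaves its pullback. Together these are the terms in \<open>hoch_diff_eq\<close>.
\<close>

lemma ext_b_square:
  assumes \<alpha>: "hoch_cochain A M (- 2) \<alpha>" and \<alpha>0: "\<alpha> (bar_word A []) = 0" and w: "w \<in> hwords E"
  shows "deconc3 (map snd w) (\<lambda>u s v. ext_b \<alpha> (map (koszul E (- 1)) u @ ext_b \<alpha> s # v)) = (0, hoch_diff A M (- 2) \<alpha> (unshift w))"
proof (cases "w = []")
  case True
  have "ext_b \<alpha> [] = 0" "ext_b \<alpha> [0] = 0"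
    using letter_cochainD(2)[OF letter_cochain_ext_b[OF \<alpha> \<alpha>0]]
      E.multilin_zero[OF letter_cochainD(1)[OF letter_cochain_ext_b[OF \<alpha> \<alpha>0]], of "[]" "[]"] by simp_all
  then show ?thesis
    using True by (simp add: deconc3_def unshift_def hoch_diff_Nil[OF \<alpha>] \<alpha>0 mdif_lin zero_prod_def)
next
  case False
  let ?w = "map snd w" and ?k = "map (koszul E (- 1))"
  have L: "?w \<in> E.L" by (rule E.hwords_lists[OF w])
  have ne: "?w \<noteq> []" using False by simp
  have hd: "hd ?w \<in> gcar E" and tl: "tl ?w \<in> E.L" and last: "last ?w \<in> gcar E" and bl: "butlast ?w \<in> E.L"
    using lists_parts[OF L ne] by blast+
  have "deconc3 ?w (\<lambda>u s v. ext_b \<alpha> (?k u @ ext_b \<alpha> s # v)) =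
    deconc3 ?w (\<lambda>u s v. (sq_bar (?k u @ sq_bar s # v) + - sq_bar (?k u @ cext \<alpha> s # v)) + - cext \<alpha> (?k u @ ext_b \<alpha> s # v))"
  proof (rule deconc3_cong)
    fix u s v assume "u @ s @ v = ?w"
    then have *: "u \<in> E.L" "s \<in> E.L" "v \<in> E.L"
      using L by (metis append_in_lists_conv)+
    then have "sq_bar (?k u @ ext_b \<alpha> s # v) = sq_bar (?k u @ sq_bar s # v) + - sq_bar (?k u @ cext \<alpha> s # v)"
      unfolding ext_b_def using cext_gcar[OF \<alpha>] by (subst sq_bar_add) (simp_all add: sq_bar_uminus)
    then show "ext_b \<alpha> (?k u @ ext_b \<alpha> s # v) =
        (sq_bar (?k u @ sq_bar s # v) + - sq_bar (?k u @ cext \<alpha> s # v)) + - cext \<alpha> (?k u @ ext_b \<alpha> s # v)"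
      by (subst ext_b_def) simp
  qed
  also have "\<dots> = - deconc3 ?w (\<lambda>u s v. sq_bar (?k u @ cext \<alpha> s # v)) - (0, bar_pull \<alpha> (map fst ?w))"
  proof -
    have neg: "deconc3 v (\<lambda>u s v. - k u s v) = - deconc3 v k" for v :: "('a \<times> 'm) list" and k :: "_ \<Rightarrow> _ \<Rightarrow> _ \<Rightarrow> 'a \<times> 'm"
      by (simp add: deconc3_def deconc_def sum_negf)
    show ?thesis
      by (simp only: deconc3_plus neg sq_bar_square[OF w] deconc3_bar_pull[OF L] add_0 diff_conv_add_uminus)
  qed
  also have "deconc3 ?w (\<lambda>u s v. sq_bar (?k u @ cext \<alpha> s # v)) =
      sq_bar [cext \<alpha> ?w] + sq_bar [cext \<alpha> (butlast ?w), last ?w] + sq_bar [koszul E (- 1) (hd ?w), cext \<alpha> (tl ?w)]"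
    using deconc3_two[of "\<lambda>u s v. sq_bar (?k u @ cext \<alpha> s # v)" ?w] ne by (simp add: sq_bar_long)
  also have "\<dots> = (0, - mdif M (\<alpha> (bar_word A (map fst ?w))) + rmul M (koszul M 1 (\<alpha> (bar_word A (map fst (butlast ?w))))) (fst (last ?w))
      - lmul M (fst (hd ?w)) (\<alpha> (bar_word A (map fst (tl ?w)))))"
  proof -
    have h: "fst (hd ?w) \<in> gcar U" using hd by (auto simp: gcar_E)
    show ?thesis
      unfolding cext_def
      using L hd tl last bl h
      by (simp add: sq_bar_M dif_lin(2) cochain_gcar[OF \<alpha>] koszul_E_fst koszul_koszul_U lmul_uminus gcar_U(1))
  qed
  also have "- \<dots> - (0, bar_pull \<alpha> (map fst ?w)) = (0, hoch_diff A M (- 2) \<alpha> (unshift w))"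
    using False
    by (subst hoch_diff_eq[OF \<alpha> unshift_hwords[OF w]])
      (simp_all add: unshift_def comp_def case_prod_unfold ksgn_def hd_map last_map map_tl[symmetric] map_butlast[symmetric])
  finally show ?thesis .
qed

lemma tproj_D_square:
  assumes \<alpha>: "hoch_cochain A M (- 2) \<alpha>" and \<alpha>0: "\<alpha> (bar_word A []) = 0" and w: "w \<in> hwords E"
  shows "tproj E (D \<alpha> (D \<alpha> (tword E 1 (map snd w)))) = (0, hoch_diff A M (- 2) \<alpha> (unshift w))"
proof -
  note b = letter_cochain_ext_b[OF \<alpha> \<alpha>0]
  have L: "map snd w \<in> E.L" by (rule E.hwords_lists[OF w])
  have "tproj E (D \<alpha> (D \<alpha> (tword E 1 (map snd w)))) =
    deconc (map snd w) (\<lambda>u r. deconc r (\<lambda>s v. tproj E (D \<alpha> (tword E 1 (map (koszul E (- 1)) u @ ext_b \<alpha> s # v)))))"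
    by (rule E.cod_tword_hom[OF b L]) (simp_all add: E.cod_0[OF b] E.cod_add[OF b] E.tproj_add D_gcar[OF \<alpha> \<alpha>0])
  also have "\<dots> = deconc3 (map snd w) (\<lambda>u s v. ext_b \<alpha> (map (koszul E (- 1)) u @ ext_b \<alpha> s # v))"
    unfolding deconc3_def
    by (rule deconc_cong_lists[OF L], rule deconc_cong_lists[where S = "gcar E"])
      (simp_all add: E.tproj_cod[OF b] E.lact_one[simplified] E.letter_cochain_gcar[OF b])
  finally show ?thesis
    using ext_b_square[OF assms] by simp
qed

lemma D_square_iff:
  assumes \<alpha>: "hoch_cochain A M (- 2) \<alpha>" and \<alpha>0: "\<alpha> (bar_word A []) = 0"
  shows "(\<forall>z\<in>gcar E.T. D \<alpha> (D \<alpha> z) = 0) \<longleftrightarrow> hoch_cocycle A M (- 2) \<alpha>"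
proof
  note b = letter_cochain_ext_b[OF \<alpha> \<alpha>0]
  assume D: "\<forall>z\<in>gcar E.T. D \<alpha> (D \<alpha> z) = 0"
  have "hoch_diff A M (- 2) \<alpha> w = 0" if w: "w \<in> hwords (aug_ideal A)" for w
  proof -
    let ?w = "map (\<lambda>(i, a). (i + 1, (a, 0 :: 'm))) w"
    have h: "?w \<in> hwords E" using w by (auto simp: hwords_def comp_zero)
    have "tproj E (D \<alpha> (D \<alpha> (tword E 1 (map snd ?w)))) = 0"
      using D E.tword_gcar[OF E.hwords_lists[OF h], of 1] by (metis E.tproj_0)
    moreover have "unshift ?w = w" by (simp add: unshift_def comp_def case_prod_unfold)
    ultimately show ?thesis
      using tproj_D_square[OF \<alpha> \<alpha>0 h] by (simp add: zero_prod_def)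
  qed
  with \<alpha> show "hoch_cocycle A M (- 2) \<alpha>" by (simp add: hoch_cocycle_def)
next
  note b = letter_cochain_ext_b[OF \<alpha> \<alpha>0]
  assume c: "hoch_cocycle A M (- 2) \<alpha>"
  have m: "multilin E (\<lambda>w. tproj E (D \<alpha> (D \<alpha> (tword E 1 w))))"
    by (rule multilinI)
      (simp_all add: E.tword_letter_add E.tword_letter_bal[unfolded susp_sel kernel_bimod_sel]
        E.cod_add[OF b] E.tproj_add D_gcar[OF \<alpha> \<alpha>0])
  have "tproj E (D \<alpha> (D \<alpha> (tword E 1 w))) = 0" if "w \<in> E.L" for w
    by (rule multilin_eq_on_homogeneous[OF graded_E m multilin_const that])
      (use c in \<open>simp add: tproj_D_square[OF \<alpha> \<alpha>0] hoch_cocycle_def unshift_hwords zero_prod_def\<close>)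
  then have "tproj E (D \<alpha> (D \<alpha> (tword E k w))) = 0" if "w \<in> E.L" for k w
    using that E.tproj_lact[of "D \<alpha> (D \<alpha> (tword E 1 w))" k] E.cod_lact[OF b, of "tword E 1 w" k]
      E.cod_lact[OF b, of "D \<alpha> (tword E 1 w)" k] E.lact_0[of k]
    by (simp add: E.lact_tword D_gcar[OF \<alpha> \<alpha>0])
  then show "\<forall>z\<in>gcar E.T. D \<alpha> (D \<alpha> z) = 0"
    using E.coderivation_square_zero[OF coderivation_D[OF \<alpha> \<alpha>0]] by simp
qed

section \<open>Cohomologous cocycles\<close>

text \<open>
  The corestriction of the isomorphism induced by \<open>\<beta>\<close>.
\<close>

definition ext_f :: "(('k, 't, 'a) words \<Rightarrow> 'm) \<Rightarrow> ('a \<times> 'm) list \<Rightarrow> 'a \<times> 'm" where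
  "ext_f \<beta> w = (case w of [x] \<Rightarrow> x | _ \<Rightarrow> 0) + cext \<beta> w"

lemma ext_f_simps:
  "ext_f \<beta> [x] = x + cext \<beta> [x]" "length w \<noteq> 1 \<Longrightarrow> ext_f \<beta> w = cext \<beta> w"
  by (auto simp: ext_f_def split: list.split)

context
  fixes \<beta> assumes \<beta>: "hoch_cochain A M (- 1) \<beta>" and \<beta>0: "\<beta> (bar_word A []) = 0"
begin

lemma letter_cochain_ext_f: "letter_cochain E 0 (ext_f \<beta>)"
  using E.letter_cochain_plus[OF E.letter_cochain_id] letter_cochain_cext[OF \<beta> \<beta>0]
  by (simp add: ext_f_def[abs_def])

lemma coalg_map_ext_f: "E.coalg_map (E.cmap (ext_f \<beta>))"
  by (rule E.coalg_map_cmap[OF letter_cochain_ext_f])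

lemma cext_beta_gcar [simp]: "w \<in> E.L \<Longrightarrow> cext \<beta> w \<in> gcar E"
  by (rule cext_gcar[OF \<beta>])

lemma cext_beta_Nil [simp]: "cext \<beta> [] = 0"
  by (simp add: cext_def \<beta>0 zero_prod_def)

lemma fst_ext_f: "fst (ext_f \<beta> s) = (case s of [x] \<Rightarrow> fst x | _ \<Rightarrow> 0)"
  by (auto simp: ext_f_def cext_def split: list.split)

text \<open>
  The value of \<open>ext_f \<beta>\<close> on a block of two or more letters lies in \<open>M\<close>. A function that only sees
  components in \<open>I\<close> and vanishes if one of them is zero therefore detects nothing but the
  decomposition into single letters.
\<close>

lemma blocks_cext:
  assumes h: "\<And>u v. u \<in> U.L \<Longrightarrow> v \<in> U.L \<Longrightarrow> h (u @ 0 # v) = 0"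
  shows "s \<in> E.L \<Longrightarrow> s \<noteq> [] \<Longrightarrow> v \<in> E.L \<Longrightarrow> p \<in> U.L \<Longrightarrow>
    blocks (ext_f \<beta>) s v (\<lambda>l. h (p @ map fst l)) = (if length s = 1 then h (p @ map fst (s @ v)) else 0)"
proof (induction v arbitrary: s p)
  case Nil
  then show ?case
    using h[of p "[]"] by (auto simp: fst_ext_f length_Suc_conv split: list.split)
next
  case (Cons y v)
  have y: "y \<in> gcar E" "v \<in> E.L" using Cons(4) by auto
  have f: "fst (ext_f \<beta> s) \<in> gcar U"
    using Cons(2) by (auto simp: fst_ext_f gcar_E split: list.split)
  have "blocks (ext_f \<beta>) [y] v (\<lambda>l. h (p @ map fst (ext_f \<beta> s # l))) =
      blocks (ext_f \<beta>) [y] v (\<lambda>l. h ((p @ [fst (ext_f \<beta> s)]) @ map fst l))"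
    by simp
  also have "\<dots> = h ((p @ [fst (ext_f \<beta> s)]) @ map fst (y # v))"
    using Cons(1)[of "[y]" "p @ [fst (ext_f \<beta> s)]"] y f Cons(5) by simp
  also have "\<dots> = (if length s = 1 then h (p @ map fst (s @ y # v)) else 0)"
    using h[OF Cons(5), of "map fst (y # v)"] lists_fst[OF Cons(4)] Cons(3)
    by (auto simp: fst_ext_f length_Suc_conv split: list.split)
  finally show ?case
    using Cons(1)[of "s @ [y]" p] Cons(2,3,5) y by simp
qed

lemma block_sum_cext:
  assumes g: "hoch_cochain A M p g" and w: "w \<in> E.L"
  shows "block_sum (ext_f \<beta>) w (cext g) = cext g w"
proof (cases w)
  case (Cons x v)
  have "blocks (ext_f \<beta>) [x] v (\<lambda>l. (\<lambda>a. (0, g (bar_word A a))) ([] @ map fst l)) = (0, g (bar_word A (map fst ([x] @ v))))"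
    by (subst blocks_cext) (use w Cons cochain_zero[OF g] in \<open>auto simp: zero_prod_def\<close>)
  then show ?thesis by (simp add: Cons cext_def[abs_def])
qed simp

lemma block_sum_id:
  assumes "w \<in> E.L"
  shows "block_sum (ext_f \<beta>) w (\<lambda>w. case w of [x] \<Rightarrow> x | _ \<Rightarrow> 0) = ext_f \<beta> w"
proof (cases w)
  case Nil
  then show ?thesis by (simp add: ext_f_simps)
next
  case (Cons x v)
  show ?thesis
    unfolding Cons block_sum_Cons by (subst blocks_letters) (auto split: list.split)
qed

text \<open>
  The bar differential takes one or two blocks. Expanding each block value into its letter and its
  part \<open>\<beta>\<close>, a letter contributes only for a block of length one, and a product of two values of \<open>\<beta>\<close> is zero
  in the square-zero extension.
\<close>

lemma block_sum_sq_bar: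
  assumes w: "w \<in> E.L" and ne: "w \<noteq> []"
  shows "block_sum (ext_f \<beta>) w sq_bar =
    sq_bar w + sq_bar [cext \<beta> w] + sq_bar [hd w, cext \<beta> (tl w)] + sq_bar [cext \<beta> (butlast w), last w]"
proof -
  obtain x v where xv: "w = x # v" using ne by (cases w) auto
  have x: "x \<in> gcar E" and v: "v \<in> E.L" using w xv by auto
  define \<iota> where "\<iota> w = (case w of [x] \<Rightarrow> x | _ \<Rightarrow> 0)" for w :: "('a \<times> 'm) list"
  have \<iota>: "\<iota> s \<in> gcar E" if "s \<in> E.L" for s
    using that by (auto simp: \<iota>_def split: list.split)
  have \<iota>0: "length s \<noteq> 1 \<Longrightarrow> \<iota> s = 0" and \<iota>1: "\<iota> [y] = y" for s y
    by (auto simp: \<iota>_def split: list.split)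
  have add1: "sq_bar [y + z] = sq_bar [y] + sq_bar [z]" if "y \<in> gcar E" "z \<in> gcar E" for y z
    using sq_bar_add[of "[]" "[]" y z] that by simp
  have add2: "sq_bar [y + z, y' + z'] = sq_bar [y, y'] + sq_bar [y, z'] + sq_bar [z, y'] + sq_bar [z, z']"
    if "y \<in> gcar E" "z \<in> gcar E" "y' \<in> gcar E" "z' \<in> gcar E" for y z y' z'
    using sq_bar_add[of "[]" "[y' + z']" y z] sq_bar_add[of "[y]" "[]" y' z'] sq_bar_add[of "[z]" "[]" y' z'] that
    by (simp add: algebra_simps)
  have MM: "sq_bar [cext \<beta> s, cext \<beta> t] = 0" if "s \<in> E.L" "t \<in> E.L" for s t
    using that by (simp add: cext_def cochain_gcar[OF \<beta>] zero_prod_def)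
  have "block_sum (ext_f \<beta>) w sq_bar =
      sq_bar [ext_f \<beta> (x # v)] + deconc v (\<lambda>p y. if y = [] then 0 else sq_bar [ext_f \<beta> (x # p), ext_f \<beta> y])"
    unfolding xv block_sum_Cons by (subst blocks_pairs) (simp_all add: sq_bar_long cong: if_cong)
  also have "deconc v (\<lambda>p y. if y = [] then 0 else sq_bar [ext_f \<beta> (x # p), ext_f \<beta> y]) =
      deconc v (\<lambda>p y. ((if y = [] then 0 else sq_bar [\<iota> (x # p), \<iota> y]) + sq_bar [\<iota> (x # p), cext \<beta> y])
        + sq_bar [cext \<beta> (x # p), \<iota> y])"
  proof (rule deconc_cong_lists[OF v])
    fix p y assume *: "p \<in> E.L" "y \<in> E.L"
    have g: "\<iota> (x # p) \<in> gcar E" "\<iota> y \<in> gcar E" "cext \<beta> (x # p) \<in> gcar E" "cext \<beta> y \<in> gcar E"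
      using * x \<iota> by simp_all
    show "(if y = [] then 0 else sq_bar [ext_f \<beta> (x # p), ext_f \<beta> y]) =
        ((if y = [] then 0 else sq_bar [\<iota> (x # p), \<iota> y]) + sq_bar [\<iota> (x # p), cext \<beta> y]) + sq_bar [cext \<beta> (x # p), \<iota> y]"
    proof (cases "y = []")
      case True
      then show ?thesis using g by (simp add: \<iota>0)
    next
      case False
      have "ext_f \<beta> s = \<iota> s + cext \<beta> s" for s by (simp only: ext_f_def \<iota>_def)
      then show ?thesis
        using False add2[OF g(1,3,2,4)] MM[of "x # p" y] * x by simp
    qed
  qed
  also have "\<dots> = deconc v (\<lambda>p y. if y = [] then 0 else sq_bar [\<iota> (x # p), \<iota> y]) + deconc v (\<lambda>p y. sq_bar [\<iota> (x # p), cext \<beta> y])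
      + deconc v (\<lambda>p y. sq_bar [cext \<beta> (x # p), \<iota> y])"
    by (simp only: deconc_plus)
  also have "deconc v (\<lambda>p y. if y = [] then 0 else sq_bar [\<iota> (x # p), \<iota> y]) = (if v = [] then 0 else sq_bar [x, \<iota> v])"
  proof (subst deconc_left_Nil)
    fix p y assume *: "p \<noteq> []" "p @ y = v"
    then have "y \<in> E.L" using v by auto
    with * \<iota> show "(if y = [] then 0 else sq_bar [\<iota> (x # p), \<iota> y]) = 0" by (simp add: \<iota>0)
  qed (simp add: \<iota>1)
  also have "deconc v (\<lambda>p y. sq_bar [\<iota> (x # p), cext \<beta> y]) = sq_bar [x, cext \<beta> v]"
  proof (subst deconc_left_Nil)
    fix p y assume *: "p \<noteq> []" "p @ y = v"
    then have "y \<in> E.L" using v by auto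
    with * show "sq_bar [\<iota> (x # p), cext \<beta> y] = 0" by (simp add: \<iota>0)
  qed (simp add: \<iota>1)
  also have "deconc v (\<lambda>p y. sq_bar [cext \<beta> (x # p), \<iota> y]) = sq_bar [cext \<beta> (butlast (x # v)), last (x # v)]"
  proof (cases v rule: rev_cases)
    case Nil
    then show ?thesis using x by (simp add: \<iota>0)
  next
    case (snoc v' z)
    then have v': "v' \<in> E.L" "z \<in> gcar E" using v by auto
    have "deconc v' (\<lambda>a b. sq_bar [cext \<beta> (x # a), \<iota> (b @ [z])]) = sq_bar [cext \<beta> (x # v'), \<iota> [z]]"
    proof (subst deconc_right_Nil)
      fix a b assume *: "b \<noteq> []" "a @ b = v'"
      then have "a \<in> E.L" using v' by auto
      with * x show "sq_bar [cext \<beta> (x # a), \<iota> (b @ [z])] = 0" by (simp add: \<iota>0)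
    qed simp
    moreover have "sq_bar [cext \<beta> (x # v' @ [z]), \<iota> []] = 0"
      using x v' by (simp add: \<iota>0)
    ultimately show ?thesis
      using v' by (simp add: snoc deconc_snoc \<iota>1)
  qed
  also have "sq_bar [ext_f \<beta> (x # v)] = sq_bar [\<iota> (x # v)] + sq_bar [cext \<beta> (x # v)]"
    unfolding ext_f_def \<iota>_def[symmetric] by (rule add1) (use \<iota> x v in simp_all)
  finally have "block_sum (ext_f \<beta>) w sq_bar = (sq_bar [\<iota> (x # v)] + (if v = [] then 0 else sq_bar [x, \<iota> v]))
      + sq_bar [cext \<beta> (x # v)] + sq_bar [x, cext \<beta> v] + sq_bar [cext \<beta> (butlast (x # v)), last (x # v)]"
    by (simp add: algebra_simps)
  also have "sq_bar [\<iota> (x # v)] + (if v = [] then 0 else sq_bar [x, \<iota> v]) = sq_bar (x # v)"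
  proof -
    consider "v = []" | y where "v = [y]" | y z u where "v = y # z # u" by (cases v; cases "tl v") auto
    then show ?thesis by cases (use x in \<open>simp_all add: \<iota>0 \<iota>1\<close>)
  qed
  finally show ?thesis by (simp add: xv)
qed

text \<open>
  Both sides are \<open>sq_bar\<close> of the word plus an element of \<open>M\<close>. On the left this element consists of \<open>-\<alpha>\<close>
  and the pullback of \<open>\<beta>\<close> along the bar differential, on the right of \<open>-\<alpha>'\<close> and the remaining terms of
  the Hochschild differential of \<open>\<beta>\<close> with reversed sign.
\<close>

lemma ext_f_chain:
  assumes \<alpha>: "hoch_cochain A M (- 2) \<alpha>" and \<alpha>0: "\<alpha> (bar_word A []) = 0"
    and \<alpha>': "hoch_cochain A M (- 2) \<alpha>'" and \<alpha>'0: "\<alpha>' (bar_word A []) = 0"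
    and w: "w \<in> hwords E"
    and bounds: "\<alpha> (bar_word A (map snd (unshift w))) - \<alpha>' (bar_word A (map snd (unshift w))) = hoch_diff A M (- 1) \<beta> (unshift w)"
  shows "deconc3 (map snd w) (\<lambda>u s v. ext_f \<beta> (map (koszul E (- 1)) u @ ext_b \<alpha> s # v)) =
    block_sum (ext_f \<beta>) (map snd w) (ext_b \<alpha>')"
proof (cases "w = []")
  case True
  have z: "ext_b \<alpha> [] = 0" "ext_b \<alpha>' [] = 0" "ext_f \<beta> [0] = 0"
    using letter_cochainD(2)[OF letter_cochain_ext_b[OF \<alpha> \<alpha>0]] letter_cochainD(2)[OF letter_cochain_ext_b[OF \<alpha>' \<alpha>'0]]
      E.multilin_zero[OF letter_cochainD(1)[OF letter_cochain_ext_f], of "[]" "[]"] by simp_all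
  then show ?thesis using True by (simp add: deconc3_def)
next
  case False
  let ?w = "map snd w" and ?k = "map (koszul E (- 1))"
  have L: "?w \<in> E.L" by (rule E.hwords_lists[OF w])
  have ne: "?w \<noteq> []" using False by simp
  have hd: "hd ?w \<in> gcar E" and tl: "tl ?w \<in> E.L" and last: "last ?w \<in> gcar E" and bl: "butlast ?w \<in> E.L"
    using lists_parts[OF L ne] by blast+
  have "deconc3 ?w (\<lambda>u s v. ext_f \<beta> (?k u @ ext_b \<alpha> s # v)) =
      deconc3 ?w (\<lambda>u s v. case ?k u @ ext_b \<alpha> s # v of [x] \<Rightarrow> x | _ \<Rightarrow> 0) + (0, bar_pull \<beta> (map fst ?w))"
    unfolding ext_f_def deconc3_plus deconc3_bar_pull[OF L] ..
  also have "deconc3 ?w (\<lambda>u s v. case ?k u @ ext_b \<alpha> s # v of [x] \<Rightarrow> x | _ \<Rightarrow> 0) = ext_b \<alpha> ?w"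
    by (subst deconc3_two[OF _ ne]) (auto split: list.split simp: append_eq_Cons_conv Cons_eq_append_conv)
  finally have lhs: "deconc3 ?w (\<lambda>u s v. ext_f \<beta> (?k u @ ext_b \<alpha> s # v)) = ext_b \<alpha> ?w + (0, bar_pull \<beta> (map fst ?w))" .
  have hom: "fst (hd ?w) \<in> gcomp A (fst (hd w) - 1)" "fst (hd ?w) \<in> gcar A"
  proof -
    have "hd w \<in> set w" using False by simp
    then have "snd (hd w) \<in> gcomp E (fst (hd w))" using w by (auto simp: hwords_def)
    then show "fst (hd ?w) \<in> gcomp A (fst (hd w) - 1)" using False by (auto simp: hd_map)
    then show "fst (hd ?w) \<in> gcar A" by (rule gcar_gcomp)
  qed
  let ?c = "\<lambda>v. \<beta> (bar_word A (map fst v))"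
  have cm: "?c v \<in> gcar M" if "v \<in> E.L" for v
    using that by (simp add: cochain_gcar[OF \<beta>])
  have neg: "block_sum (ext_f \<beta>) ?w (\<lambda>l. - k l) = - block_sum (ext_f \<beta>) ?w k" for k :: "_ \<Rightarrow> 'a \<times> 'm"
  proof -
    have "blocks (ext_f \<beta>) s v (\<lambda>l. - k l) = - blocks (ext_f \<beta>) s v k" for s v
      using blocks_plus[of "ext_f \<beta>" s v k "\<lambda>l. - k l"] blocks_zero[of "\<lambda>l. 0 :: 'a \<times> 'm" "ext_f \<beta>" s v]
      by (simp add: eq_neg_iff_add_eq_0 add.commute)
    then show ?thesis by (cases ?w) simp_all
  qed
  have plus: "block_sum (ext_f \<beta>) ?w (\<lambda>l. k l + k' l) = block_sum (ext_f \<beta>) ?w k + block_sum (ext_f \<beta>) ?w k'" for k k' :: "_ \<Rightarrow> 'a \<times> 'm"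
    by (cases ?w) (simp_all add: blocks_plus)
  have "block_sum (ext_f \<beta>) ?w (ext_b \<alpha>') = block_sum (ext_f \<beta>) ?w sq_bar + - cext \<alpha>' ?w"
    unfolding ext_b_def[abs_def] plus neg block_sum_cext[OF \<alpha>' L] ..
  also have "\<dots> = ext_b \<alpha>' ?w + (sq_bar [cext \<beta> ?w] + sq_bar [hd ?w, cext \<beta> (tl ?w)] + sq_bar [cext \<beta> (butlast ?w), last ?w])"
    by (simp add: block_sum_sq_bar[OF L ne] ext_b_def algebra_simps)
  also have "\<dots> = ext_b \<alpha>' ?w + (0, - mdif M (?c ?w) + lmul M (koszul A 1 (fst (hd ?w))) (?c (tl ?w))
      + rmul M (koszul M 1 (?c (butlast ?w))) (fst (last ?w)))"
    unfolding cext_def using sq_bar_M(1)[OF cm[OF L]] sq_bar_M(2)[OF last cm[OF bl]] sq_bar_M(3)[OF hd cm[OF tl]] by simp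
  finally have rhs: "block_sum (ext_f \<beta>) ?w (ext_b \<alpha>') = ext_b \<alpha>' ?w + (0, - mdif M (?c ?w) + lmul M (koszul A 1 (fst (hd ?w))) (?c (tl ?w))
      + rmul M (koszul M 1 (?c (butlast ?w))) (fst (last ?w)))" .
  have k: "ksgn (- 1 * (fst (hd w) - 1 + 1)) (lmul M (fst (hd ?w)) (?c (tl ?w))) = - lmul M (koszul A 1 (fst (hd ?w))) (?c (tl ?w))"
    using A.koszul_homog[OF hom(1), of 1] hom(2) cm[OF tl] by (simp add: ksgn_def lmul_uminus)
  have "hoch_diff A M (- 1) \<beta> (unshift w) = mdif M (?c ?w) + bar_pull \<beta> (map fst ?w)
      - lmul M (koszul A 1 (fst (hd ?w))) (?c (tl ?w)) - rmul M (koszul M 1 (?c (butlast ?w))) (fst (last ?w))"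
  proof -
    have u: "unshift w \<noteq> []" "map snd (unshift w) = map fst ?w" "fst (hd (unshift w)) = fst (hd w) - 1"
      using False by (simp_all add: unshift_def comp_def case_prod_unfold hd_map)
    have s: "hd (map fst ?w) = fst (hd ?w)" "last (map fst ?w) = fst (last ?w)" "tl (map fst ?w) = map fst (tl ?w)"
      "butlast (map fst ?w) = map fst (butlast ?w)"
      using ne by (simp_all only: hd_map last_map map_tl map_butlast not_False_eq_True)
    have "ksgn (- 1) x = - x" for x :: 'm by (simp add: ksgn_def)
    then show ?thesis
      unfolding hoch_diff_eq[OF \<beta> unshift_hwords[OF w] u(1)] u s k by simp
  qed
  then have "\<alpha> (bar_word A (map fst ?w)) - \<alpha>' (bar_word A (map fst ?w)) = mdif M (?c ?w) + bar_pull \<beta> (map fst ?w)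
      - lmul M (koszul A 1 (fst (hd ?w))) (?c (tl ?w)) - rmul M (koszul M 1 (?c (butlast ?w))) (fst (last ?w))"
    using bounds unfolding snd_unshift by simp
  then show ?thesis
    unfolding lhs rhs unfolding ext_b_eq by (simp add: prod_eq_iff algebra_simps)
qed

end

section \<open>Hochschild extensions as augmented A-infinity algebras\<close>

lemma hoch_ext_sel [simp]:
  "gcomp (hoch_ext A M \<alpha>) = gcomp (ext_bimod A M)" "lact (hoch_ext A M \<alpha>) = lact (ext_bimod A M)"
  "ract (hoch_ext A M \<alpha>) = ract (ext_bimod A M)" "aunit (hoch_ext A M \<alpha>) = (\<lambda>c. (unit A c, 0))"
  "aaug (hoch_ext A M \<alpha>) = (\<lambda>(a, m). aug A a)"
  by (simp_all add: hoch_ext_def Let_def gbimod.defs)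

lemma kernel_hoch_ext [simp]: "kernel_bimod (hoch_ext A M \<alpha>) h = kernel_bimod (ext_bimod A M) h"
  by (simp add: kernel_bimod_def)

lemma ainf_sbar_hoch_ext: "ainf_sbar (hoch_ext A M \<alpha>) = E"
  by simp

lemma gcar_hoch_ext: "gcar (hoch_ext A M \<alpha>) = gcar A \<times> gcar M"
  using gcar_prod[OF A.graded_bimodule_axioms graded_bimodule_axioms, of "ext_bimod A M"] gcar_cong[of "hoch_ext A M \<alpha>" "ext_bimod A M"]
  by simp

theorem aug_ainf_algebra_hoch_ext_iff:
  assumes \<alpha>: "hoch_cochain A M (- 2) \<alpha>" and \<alpha>0: "\<alpha> (bar_word A []) = 0"
  shows "aug_ainf_algebra (hoch_ext A M \<alpha>) \<longleftrightarrow> hoch_cocycle A M (- 2) \<alpha>"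
proof
  assume "aug_ainf_algebra (hoch_ext A M \<alpha>)"
  then interpret X: aug_ainf_algebra "hoch_ext A M \<alpha>" .
  have "D \<alpha> (D \<alpha> z) = 0" if "z \<in> gcar E.T" for z
    using X.cod_square[of z] that D_gcar[OF \<alpha> \<alpha>0 that] by (simp add: acod_hoch_ext[OF \<alpha> \<alpha>0])
  then show "hoch_cocycle A M (- 2) \<alpha>"
    using D_square_iff[OF \<alpha> \<alpha>0] by blast
next
  assume "hoch_cocycle A M (- 2) \<alpha>"
  then have sq: "D \<alpha> (D \<alpha> z) = 0" if "z \<in> gcar E.T" for z
    using D_square_iff[OF \<alpha> \<alpha>0] that by blast
  note b = letter_cochain_ext_b[OF \<alpha> \<alpha>0]
  show "aug_ainf_algebra (hoch_ext A M \<alpha>)"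
  proof (intro aug_ainf_algebra.intro aug_ainf_algebra_axioms.intro)
    show "graded_bimodule (hoch_ext A M \<alpha>)"
      using graded_ext_bimod graded_bimodule_cong[of "hoch_ext A M \<alpha>" "ext_bimod A M"] by simp
    show "bimod_hom base_bimod (hoch_ext A M \<alpha>) 0 (aunit (hoch_ext A M \<alpha>))"
      using A.unit_hom by (auto simp: bimod_hom_def comp_zero)
    show "bimod_hom (hoch_ext A M \<alpha>) base_bimod 0 (aaug (hoch_ext A M \<alpha>))"
      using A.aug_hom by (auto simp: bimod_hom_def gcar_hoch_ext)
    show "aaug (hoch_ext A M \<alpha>) (aunit (hoch_ext A M \<alpha>) c) = c" for c
      by (simp add: A.aug_unit)
    show "coderivation (tensor_coalg (ainf_sbar (hoch_ext A M \<alpha>))) (- 1) (acod (hoch_ext A M \<alpha>))"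
      unfolding ainf_sbar_hoch_ext acod_hoch_ext[OF \<alpha> \<alpha>0]
      by (rule E.coderivation_cong[OF coderivation_D[OF \<alpha> \<alpha>0]]) simp
    show "acod (hoch_ext A M \<alpha>) (coaug (tensor_coalg (ainf_sbar (hoch_ext A M \<alpha>))) c) = 0" for c
      unfolding ainf_sbar_hoch_ext acod_hoch_ext[OF \<alpha> \<alpha>0] by (simp add: E.cod_unit[OF b])
    show "acod (hoch_ext A M \<alpha>) (acod (hoch_ext A M \<alpha>) z) = 0"
      if "z \<in> gcar (tensor_coalg (ainf_sbar (hoch_ext A M \<alpha>)))" for z
      using that sq[of z] D_gcar[OF \<alpha> \<alpha>0, of z] unfolding ainf_sbar_hoch_ext acod_hoch_ext[OF \<alpha> \<alpha>0] by simp
  qed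
qed

lemma dg_coalg_hom_ainf_bar:
  assumes \<alpha>: "hoch_cochain A M (- 2) \<alpha>" and \<alpha>0: "\<alpha> (bar_word A []) = 0"
    and \<alpha>': "hoch_cochain A M (- 2) \<alpha>'" and \<alpha>'0: "\<alpha>' (bar_word A []) = 0"
    and F: "E.coalg_map F" and FD: "\<And>z. z \<in> gcar E.T \<Longrightarrow> F (D \<alpha> z) = D \<alpha>' (F z)"
  shows "dg_coalg_hom (ainf_bar (hoch_ext A M \<alpha>)) (ainf_bar (hoch_ext A M \<alpha>')) F"
proof -
  have sel: "gcomp (ainf_bar (hoch_ext A M g)) = gcomp E.T" "lact (ainf_bar (hoch_ext A M g)) = lact E.T"
    "ract (ainf_bar (hoch_ext A M g)) = ract E.T" "comult (ainf_bar (hoch_ext A M g)) = comult (tensor_coalg E)"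
    "counit (ainf_bar (hoch_ext A M g)) = counit (tensor_coalg E)" "coaug (ainf_bar (hoch_ext A M g)) = (\<lambda>c. tword E c [])"
    "codiff (ainf_bar (hoch_ext A M g)) = acod (hoch_ext A M g)" for g
    by (simp_all add: ainf_bar_def coaug_coalg.defs)
  have f: "bimod_hom E.T E.T 0 F" using F by (simp add: E.coalg_map_def)
  note [simp] = E.tensor_hom_gcar[OF f]
  have g: "gcar (ainf_bar (hoch_ext A M g)) = gcar E.T" for g
    by (rule gcar_cong) (simp add: sel)
  have t: "tensor_map (ainf_bar (hoch_ext A M \<alpha>)) (ainf_bar (hoch_ext A M \<alpha>')) (ainf_bar (hoch_ext A M \<alpha>')) 0 F F =
      tensor_map E.T E.T E.T 0 F F"
    by (rule arg_cong[where f = "\<lambda>t. t 0 F F"], rule tensor_map_cong) (simp_all add: sel)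
  have h: "bimod_hom (ainf_bar (hoch_ext A M \<alpha>)) (ainf_bar (hoch_ext A M \<alpha>')) 0 F"
    using f by (subst bimod_hom_cong[of _ "E.T" _ "E.T"]) (simp_all add: sel)
  show ?thesis
    unfolding dg_coalg_hom_def t g sel acod_hoch_ext[OF \<alpha> \<alpha>0] acod_hoch_ext[OF \<alpha>' \<alpha>'0]
    using F h FD by (simp add: E.coalg_map_def)
qed

lemma ext_f_intertwines:
  assumes \<beta>: "hoch_cochain A M (- 1) \<beta>" and \<beta>0: "\<beta> (bar_word A []) = 0"
    and \<alpha>: "hoch_cochain A M (- 2) \<alpha>" and \<alpha>0: "\<alpha> (bar_word A []) = 0"
    and \<alpha>': "hoch_cochain A M (- 2) \<alpha>'" and \<alpha>'0: "\<alpha>' (bar_word A []) = 0"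
    and bounds: "\<And>w. w \<in> hwords (aug_ideal A) \<Longrightarrow>
      \<alpha> (bar_word A (map snd w)) - \<alpha>' (bar_word A (map snd w)) = hoch_diff A M (- 1) \<beta> w"
    and z: "z \<in> gcar E.T"
  shows "E.cmap (ext_f \<beta>) (D \<alpha> z) = D \<alpha>' (E.cmap (ext_f \<beta>) z)"
proof -
  note b = letter_cochain_ext_b[OF \<alpha> \<alpha>0] and b' = letter_cochain_ext_b[OF \<alpha>' \<alpha>'0] and f = letter_cochain_ext_f[OF \<beta> \<beta>0]
  let ?F = "E.cmap (ext_f \<beta>)"
  note cF = coalg_map_ext_f[OF \<beta> \<beta>0]
  note Fhom = E.bimod_hom_cmap[OF f]
  note [simp] = E.tensor_hom_gcar[OF Fhom] D_gcar[OF \<alpha> \<alpha>0] D_gcar[OF \<alpha>' \<alpha>'0]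
  have m: "multilin E (\<lambda>w. tproj E (?F (D \<alpha> (tword E 1 w))))" "multilin E (\<lambda>w. tproj E (D \<alpha>' (?F (tword E 1 w))))"
    by (rule multilinI;
      simp add: E.tword_letter_add E.tword_letter_bal[unfolded susp_sel kernel_bimod_sel]
        E.cod_add[OF b] E.cod_add[OF b'] E.cmap_add[OF f] E.tproj_add)+
  have "tproj E (?F (D \<alpha> (tword E 1 w))) = tproj E (D \<alpha>' (?F (tword E 1 w)))" if "w \<in> E.L" for w
  proof (rule multilin_eq_on_homogeneous[OF graded_E m that])
    fix w assume w: "w \<in> hwords E"
    have L: "map snd w \<in> E.L" by (rule E.hwords_lists[OF w])
    have "tproj E (?F (D \<alpha> (tword E 1 (map snd w)))) =
        deconc (map snd w) (\<lambda>u r. deconc r (\<lambda>s v. tproj E (?F (tword E 1 (map (koszul E (- 1)) u @ ext_b \<alpha> s # v)))))"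
      by (rule E.cod_tword_hom[OF b L]) (simp_all add: E.cmap_0[OF f] E.cmap_add[OF f] E.tproj_add)
    also have "\<dots> = deconc3 (map snd w) (\<lambda>u s v. ext_f \<beta> (map (koszul E (- 1)) u @ ext_b \<alpha> s # v))"
      unfolding deconc3_def
      by (rule deconc_cong_lists[OF L], rule deconc_cong_lists[where S = "gcar E"])
        (simp_all add: E.tproj_cmap[OF f] E.lact_one[simplified] E.letter_cochain_gcar[OF b] E.letter_cochain_gcar[OF f])
    also have "\<dots> = block_sum (ext_f \<beta>) (map snd w) (ext_b \<alpha>')"
      by (rule ext_f_chain[OF \<beta> \<beta>0 \<alpha> \<alpha>0 \<alpha>' \<alpha>'0 w bounds[OF unshift_hwords[OF w]]])
    also have "\<dots> = block_sum (ext_f \<beta>) (map snd w) (\<lambda>l. tproj E (D \<alpha>' (tword E 1 l)))"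
      by (rule E.block_sum_cong[OF f L])
        (simp add: E.tproj_cod[OF b'] E.lact_one[simplified] E.letter_cochain_gcar[OF b'])
    also have "\<dots> = tproj E (D \<alpha>' (?F (tword E 1 (map snd w))))"
      by (rule E.cmap_tword_hom[OF f L, symmetric]) (simp add: E.cod_add[OF b'] E.tproj_add)
    finally show "tproj E (?F (D \<alpha> (tword E 1 (map snd w)))) = tproj E (D \<alpha>' (?F (tword E 1 (map snd w))))" .
  qed
  then have "tproj E (?F (D \<alpha> (tword E c w))) = tproj E (D \<alpha>' (?F (tword E c w)))" if w: "w \<in> E.L" for c w
  proof -
    have "tword E c w = lact E.T c (tword E 1 w)" using w by (simp add: E.lact_tword)
    then show ?thesis
      using \<open>\<And>w. w \<in> E.L \<Longrightarrow> tproj E (?F (D \<alpha> (tword E 1 w))) = tproj E (D \<alpha>' (?F (tword E 1 w)))\<close>[OF w] w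
      by (simp only: E.cod_lact[OF b] E.cod_lact[OF b'] E.cmap_lact[OF f] E.tword_gcar E.tproj_lact
          E.tensor_hom_gcar[OF Fhom] D_gcar[OF \<alpha> \<alpha>0] D_gcar[OF \<alpha>' \<alpha>'0])
  qed
  then show ?thesis
    by (rule E.coalg_map_intertwines[OF cF coderivation_D[OF \<alpha> \<alpha>0] coderivation_D[OF \<alpha>' \<alpha>'0] _ z])
qed

lemma hoch_cochain_uminus: "hoch_cochain A M p g \<Longrightarrow> hoch_cochain A M p (\<lambda>x. - g x)"
  unfolding hoch_cochain_iff bimod_hom_def
  using bimod_hom_gcar[OF U.graded_tensor graded_bimodule_axioms, of p g]
  by (auto simp: bimod_hom_def lact_uminus ract_uminus comp_uminus)

text \<open>
  The identity part of the second corestriction returns the first one, with its term \<open>\<beta>\<close>. The part \<open>-\<beta>\<close>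
  only sees the decomposition into single letters (\<open>block_sum_cext\<close>) and cancels that term.
\<close>

lemma ext_f_inverse:
  assumes \<beta>: "hoch_cochain A M (- 1) \<beta>" and \<beta>0: "\<beta> (bar_word A []) = 0" and z: "z \<in> gcar E.T"
  shows "E.cmap (ext_f (\<lambda>x. - \<beta> x)) (E.cmap (ext_f \<beta>) z) = z"
proof -
  let ?n = "\<lambda>x. - \<beta> x"
  have n: "hoch_cochain A M (- 1) ?n" "?n (bar_word A []) = 0"
    using hoch_cochain_uminus[OF \<beta>] \<beta>0 by simp_all
  note f = letter_cochain_ext_f[OF \<beta> \<beta>0] and g = letter_cochain_ext_f[OF n]
  have "tproj E (E.cmap (ext_f ?n) (E.cmap (ext_f \<beta>) (tword E c w))) = tproj E (id (tword E c w))"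
    if w: "w \<in> E.L" for c w
  proof -
    have cm: "lact E c (x + y) = lact E c x + lact E c y" if "x \<in> gcar E" "y \<in> gcar E" for x y
      using E.lact_add_right[OF that] .
    have "tproj E (E.cmap (ext_f ?n) (E.cmap (ext_f \<beta>) (tword E c w))) =
        block_sum (ext_f \<beta>) w (\<lambda>l. tproj E (E.cmap (ext_f ?n) (tword E c l)))"
      by (rule E.cmap_tword_hom[OF f w])
        (simp add: E.cmap_add[OF g] E.tproj_add E.tensor_hom_gcar[OF E.bimod_hom_cmap[OF g]])
    also have "\<dots> = block_sum (ext_f \<beta>) w (\<lambda>l. lact E c (ext_f ?n l))"
      by (rule E.block_sum_cong[OF f w]) (simp add: E.tproj_cmap[OF g])
    also have "\<dots> = lact E c (block_sum (ext_f \<beta>) w (ext_f ?n))"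
    proof (cases w)
      case Nil
      then show ?thesis by simp
    next
      case (Cons x v)
      then show ?thesis
        using E.blocks_hom[OF f, of "gcar E" "lact E c" "[x]" v "ext_f ?n"] w cm E.letter_cochain_gcar[OF g] by simp
    qed
    also have "block_sum (ext_f \<beta>) w (ext_f ?n) = (case w of [x] \<Rightarrow> x | _ \<Rightarrow> 0)"
    proof -
      have "block_sum (ext_f \<beta>) w (ext_f ?n) =
          block_sum (ext_f \<beta>) w (\<lambda>w. case w of [x] \<Rightarrow> x | _ \<Rightarrow> 0) + block_sum (ext_f \<beta>) w (cext ?n)"
        unfolding ext_f_def[of ?n, abs_def] by (cases w) (simp_all add: blocks_plus)
      also have "\<dots> = ext_f \<beta> w + cext ?n w"
        unfolding block_sum_id[OF \<beta> \<beta>0 w] block_sum_cext[OF \<beta> \<beta>0 n(1) w] ..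
      finally show ?thesis by (simp add: ext_f_def cext_def zero_prod_def[symmetric])
    qed
    also have "lact E c (case w of [x] \<Rightarrow> x | _ \<Rightarrow> 0) = tproj E (id (tword E c w))"
      using w E.lact_0[of c] by (simp add: E.tproj_tword split: list.split)
    finally show ?thesis .
  qed
  then have "E.cmap (ext_f ?n) (E.cmap (ext_f \<beta>) z) = id z"
    by (rule E.coalg_map_unique[OF E.coalg_map_comp[OF coalg_map_ext_f[OF n] coalg_map_ext_f[OF \<beta> \<beta>0]] E.coalg_map_id _ z])
  then show ?thesis by simp
qed

lemma hoch_diff_uminus:
  assumes \<beta>: "hoch_cochain A M p \<beta>" and w: "w \<in> hwords (aug_ideal A)"
  shows "hoch_diff A M p (\<lambda>x. - \<beta> x) w = - hoch_diff A M p \<beta> w"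
proof (cases "w = []")
  case True
  then show ?thesis
    using hoch_diff_Nil[OF \<beta>] hoch_diff_Nil[OF hoch_cochain_uminus[OF \<beta>]] cochain_gcar[OF \<beta>, of "[]"] by (simp add: mdif_lin(7))
next
  case False
  have L: "map snd w \<in> U.L" using U.hwords_lists[OF shift_hwords[OF w]] by simp
  have parts: "hd (map snd w) \<in> gcar U" "tl (map snd w) \<in> U.L" "last (map snd w) \<in> gcar U" "butlast (map snd w) \<in> U.L"
    using lists_parts[OF L] False by blast+
  have q: "bar_pull (\<lambda>x. - \<beta> x) (map snd w) = - bar_pull \<beta> (map snd w)"
    by (simp add: bar_pull_def deconc3_def deconc_def sum_negf)
  show ?thesis
    unfolding hoch_diff_eq[OF \<beta> w False] hoch_diff_eq[OF hoch_cochain_uminus[OF \<beta>] w False] q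
    using parts L by (simp add: mdif_lin(7) cochain_gcar[OF \<beta>] lmul_uminus rmul_uminus koszul_uminus gcar_U(1) ksgn_minus)
qed

theorem ainf_iso_hoch_ext:
  assumes \<alpha>: "hoch_cochain A M (- 2) \<alpha>" and \<alpha>0: "\<alpha> (bar_word A []) = 0"
    and \<alpha>': "hoch_cochain A M (- 2) \<alpha>'" and \<alpha>'0: "\<alpha>' (bar_word A []) = 0"
    and bounds: "hoch_bounds A M (- 2) \<beta> \<alpha> \<alpha>'" and \<beta>0: "\<beta> (bar_word A []) = 0"
  shows "ainf_iso (hoch_ext A M \<alpha>) (hoch_ext A M \<alpha>')"
proof -
  have \<beta>: "hoch_cochain A M (- 1) \<beta>"
    and d: "\<And>w. w \<in> hwords (aug_ideal A) \<Longrightarrow>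
      \<alpha> (bar_word A (map snd w)) - \<alpha>' (bar_word A (map snd w)) = hoch_diff A M (- 1) \<beta> w"
    using bounds by (simp_all add: hoch_bounds_def)
  let ?n = "\<lambda>x. - \<beta> x"
  have n: "hoch_cochain A M (- 1) ?n" "?n (bar_word A []) = 0"
    using hoch_cochain_uminus[OF \<beta>] \<beta>0 by simp_all
  have dn: "\<alpha>' (bar_word A (map snd w)) - \<alpha> (bar_word A (map snd w)) = hoch_diff A M (- 1) ?n w"
    if "w \<in> hwords (aug_ideal A)" for w
    unfolding hoch_diff_uminus[OF \<beta> that] d[OF that, symmetric] by simp
  let ?F = "E.cmap (ext_f \<beta>)" and ?G = "E.cmap (ext_f ?n)"
  have gc: "gcar (ainf_bar (hoch_ext A M g)) = gcar E.T" for g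
    by (rule gcar_cong) (simp add: ainf_bar_def coaug_coalg.defs)
  have "dg_coalg_hom (ainf_bar (hoch_ext A M \<alpha>)) (ainf_bar (hoch_ext A M \<alpha>')) ?F"
    by (rule dg_coalg_hom_ainf_bar[OF \<alpha> \<alpha>0 \<alpha>' \<alpha>'0 coalg_map_ext_f[OF \<beta> \<beta>0]])
      (rule ext_f_intertwines[OF \<beta> \<beta>0 \<alpha> \<alpha>0 \<alpha>' \<alpha>'0 d])
  moreover have "dg_coalg_hom (ainf_bar (hoch_ext A M \<alpha>')) (ainf_bar (hoch_ext A M \<alpha>)) ?G"
    by (rule dg_coalg_hom_ainf_bar[OF \<alpha>' \<alpha>'0 \<alpha> \<alpha>0 coalg_map_ext_f[OF n]])
      (rule ext_f_intertwines[OF n \<alpha>' \<alpha>'0 \<alpha> \<alpha>0 dn])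
  moreover have "\<forall>z\<in>gcar E.T. ?G (?F z) = z"
    using ext_f_inverse[OF \<beta> \<beta>0] by blast
  moreover have "\<forall>z\<in>gcar E.T. ?F (?G z) = z"
    using ext_f_inverse[OF n] by simp
  ultimately show ?thesis
    unfolding ainf_iso_def dg_coalg_iso_def gc by blast
qed

lemma hoch_class_refl: "hoch_cocycle A M p \<alpha> \<Longrightarrow> \<alpha> \<in> hoch_class A M p \<alpha>"
proof -
  assume c: "hoch_cocycle A M p \<alpha>"
  have z: "hoch_cochain A M (p + 1) (\<lambda>x. 0)"
    by (simp add: hoch_cochain_iff bimod_hom_def comp_zero)
  have "hoch_diff A M (p + 1) (\<lambda>x. 0) w = 0" if w: "w \<in> hwords (aug_ideal A)" for w
  proof (cases "w = []")
    case False
    have "map snd w \<in> U.L" using U.hwords_lists[OF shift_hwords[OF w]] by simp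
    then have "hd (map snd w) \<in> gcar A" "last (map snd w) \<in> gcar A"
      using lists_parts[of "map snd w" "gcar U"] False gcar_U(1) by blast+
    then show ?thesis
      by (simp add: hoch_diff_def hoch_diff0_def hoch_diff1_def Let_def mdif_lin(2) False)
  qed (simp add: hoch_diff_Nil[OF z] mdif_lin(2))
  with z have "hoch_bounds A M p (\<lambda>x. 0) \<alpha> \<alpha>" by (simp add: hoch_bounds_def)
  with c show ?thesis unfolding hoch_class_def by blast
qed

end

theorem theorem1:
  fixes A :: "('k::field, 't::finite, 'a::ab_group_add) dga"
    and M :: "('k, 't, 'a, 'm::ab_group_add) dg_bimod"
    and \<alpha> \<alpha>' :: "('k, 't, 'a) words \<Rightarrow> 'm"
  assumes "aug_dg_algebra A"
    and "dg_bimodule A M"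
    and "gcomp M (-2) = {0}"
    and "hoch_cochain A M (-2) \<alpha>"
    and "hoch_cochain A M (-2) \<alpha>'"
  shows "(aug_ainf_algebra (hoch_ext A M \<alpha>) \<longleftrightarrow> hoch_cocycle A M (-2) \<alpha>) \<and>
    (hoch_cocycle A M (-2) \<alpha> \<and> hoch_cocycle A M (-2) \<alpha>' \<and>
       hoch_class A M (-2) \<alpha> = hoch_class A M (-2) \<alpha>' \<and>
       (gcomp M (-1) = {0} \<or> (\<exists>\<beta>. hoch_bounds A M (-2) \<beta> \<alpha> \<alpha>' \<and> \<beta> (bar_word A []) = 0)) \<longrightarrow>
     ainf_iso (hoch_ext A M \<alpha>) (hoch_ext A M \<alpha>'))"
proof -
  interpret dg_bimodule A M by fact
  note z = cochain_empty_zero[OF assms(4,3)] cochain_empty_zero[OF assms(5,3)]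
  have "\<exists>\<beta>. hoch_bounds A M (- 2) \<beta> \<alpha> \<alpha>' \<and> \<beta> (bar_word A []) = 0"
    if c: "hoch_cocycle A M (- 2) \<alpha>'" "hoch_class A M (- 2) \<alpha> = hoch_class A M (- 2) \<alpha>'" and M1: "gcomp M (- 1) = {0}"
  proof -
    obtain \<beta> where \<beta>: "hoch_bounds A M (- 2) \<beta> \<alpha> \<alpha>'"
      using hoch_class_refl[OF c(1)] c(2) by (auto simp: hoch_class_def)
    moreover from this have "\<beta> (bar_word A []) = 0"
      using cochain_empty_zero[of "- 1" \<beta>] M1 by (simp add: hoch_bounds_def)
    ultimately show ?thesis by blast
  qed
  then show ?thesis
    using aug_ainf_algebra_hoch_ext_iff[OF assms(4) z(1)] ainf_iso_hoch_ext[OF assms(4) z(1) assms(5) z(2)] by blast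
qed

end
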